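(* The family of Markov choice models is compatible. Moreover, for any compatible choice model $\phi$ that admits a polynomial time algorithm for finding optimal unconstrained assortments, the algorithm Framework described in the context, for the constrained assortment optimization problem $\max_{S\in\mathcal{F}}f_\phi(S)$ with $f_\phi(S)=\max_{X\subseteq S}R_\phi(X)$, runs in polynomial time (for fixed $\epsilon$) and matches the guarantee obtained by the underlying algorithm $\mathcal{A}$ for submodular order functions under cardinality, budget, and matroid constraint. That is, Framework is: - for a cardinality constraint $\mathcal{F}=\{S:|S|\le k\}$: $(1-\epsilon)\,0.5$ approximate with $\mathcal{A}$ = Threshold-Cardinality, $\epsilon\in(0,1)$ (so a $0.5-\epsilon$ guarantee); - for a budget constraint $\mathcal{F}=\{S:b(S)\le B\}$, $b(S)=\sum_{i\in S}b_i$: $(1-\epsilon)/3$ approximate with $\mathcal{A}$ = Threshold-Budget, $\epsilon\in(0,1)$, and $0.5-\epsilon$ approximate with $\mathcal{A}$ = Enumerate-Budget, $\epsilon\in(0,0.5)$; - for a matroid constraint, $\mathcal{F}=\mathcal{I}$ the family of independent sets of a matroid on $N$: $0.25$ approximate with $\mathcal{A}$ = Matroid-Swap.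
   Context: Choice models. A choice model on a finite product set $N$ gives, for each assortment $S\subseteq N$ and $i\in S$, the probability $\phi(i,S)$ that a customer offered $S$ chooses $i$; with probability $1-\sum_{i\in S}\phi(i,S)$ the customer chooses the outside option $0$. With fixed prices $(r_i)_{i\in N}$, $R_\phi(S)=\sum_{i\in S}r_i\phi(i,S)$ and $R_\phi(X\mid Y)=R_\phi(X\cup Y)-R_\phi(Y)$. An optimal unconstrained assortment on a ground set $Y\subseteq N$ is a maximizer of $R_\phi(X)$ over $X\subseteq Y$; $U_\phi(Y)$ denotes such an assortment, so $f_\phi(Y)=R_\phi(U_\phi(Y))$. An algorithm is $\alpha$ approximate if it outputs $S\in\mathcal{F}$ with $f_\phi(S)\ge\alpha\max_{T\in\mathcal{F}}f_\phi(T)$. $\phi$ is substitutable if $\phi(i,S\cup\{j\})\le\phi(i,S)$ for all $i\in S$, $j\notin S$. Compatible: given a substitutable choice model $\phi$, let $S$ be an optimal unconstrained assortment on the ground set $N$. Then $\phi$ is compatible if $$R_\phi(A\mid C)\ge0\quad\forall A\subseteq S,\ C\subseteq N,\qquad R_\phi(C\mid A)\le R_\phi(C\mid B)\quad\forall B\subseteq A\subseteq S,\ C\subseteq N.$$ Markov choice model: given by probabilities $\lambda_i$ ($i\in N$) and transition probabilities $\rho_{ij}$. Given assortment $S$, the customer starts at product $i\in N$ with probability $\lambda_i$; a customer at a product $i\notin S$ transitions to $j\in N\cup\{0\}$ with probability $\rho_{ij}$, independently of the past; the process terminates on reaching $S\cup\{0\}$, and that state is the final choice. Underlying algorithms, for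 a set function $f$ and an ordered ground set, with $f(j\mid S)=f(S\cup\{j\})-f(S)$. Each is described through its set $\Gamma_{\mathcal{A}}$ of parameter settings, computed from the full set $N$, $f_\phi$ and $\mathcal{F}$, and the run $\mathcal{A}_\gamma$ for a fixed $\gamma\in\Gamma_{\mathcal{A}}$, which returns a feasible set $S$ and a set $R$ (a minimal set such that all marginals queried in the run are with respect to subsets of $S\cup R$). Threshold-Cardinality: $\Gamma_{\mathcal{A}}$ consists of the thresholds $\tau=(1+\epsilon)^{i-1}\frac1k\max_{e\in N}f(\{e\})$, $i=1,\dots,\lceil\log_{1+\epsilon}k\rceil$. Run: start with $S=\emptyset$; parse elements $j$ in order while $|S|<k$, adding $j$ if $f(j\mid S)\ge\tau$. $R=\emptyset$. Threshold-Budget: elements with $b_e>B$ are ignored. $\Gamma_{\mathcal{A}}$ consists of $\tau=(1+\epsilon)^{i-1}\frac1B\max_{e\in N}f(\{e\})$, $i=1,\dots,\lceil\log_{1+\epsilon}n\rceil$, $n=|N|$. Run: start with $S=\emptyset$; parse $j$ in order while $b(S)<B$, adding $j$ if $b_j<B-b(S)$ and $f(j\mid S)/b_j\ge\tau$. $R=\emptyset$. This algorithm also compares its sets with all singletons at the end. Enumerate-Budget: $\Gamma_{\mathcal{A}}$ consists of pairs $(X,\tau)$ with $X\subseteq N$, $b(X)\le B$, $|X|\le1/\epsilon$, and $\tau=(1+\epsilon)^{i-1}\frac1B\max_{e\in N_X}f(\{e\})$, $i=1,\dots,\lceil\log_{1+\epsilon}|N_X|\rceil$, where $N_X$ is $N$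 without the elements $e\notin X$ with $b_e>\min_{i\in X}b_i$ (no removal if $X=\emptyset$). Run: start with $S=\emptyset$; parse the elements $j$ of the given ground set that lie in $N_X$, in order, while $b(S)<B$. If $f(j\mid S)/b_j\ge\tau$: if $b_j+b(S)\le B$, add $j$ to $S$; otherwise set $S$ to Final-Add$(S\cup\{j\})$ and stop. Final-Add: while the budget exceeds $B$, remove an element $i$ with $b_i<\epsilon B$; end if none exists. $R$ is the set of elements removed by Final-Add. Only feasible sets are considered for output. Matroid-Swap: $\Gamma_{\mathcal{A}}$ is a singleton (no parameters). Run: start with $S=R=\emptyset$ and $v_j=0$ for all $j$. Parse $j$ in order. If $S\cup\{j\}\in\mathcal{I}$, set $v_j=f(j\mid S\cup R)$ and add $j$ to $S$. Otherwise find the circuit $C$ in $S\cup\{j\}$, let $i^*\in\arg\min_{i\in C\setminus\{j\}}v_i$ and $v_C=v_{i^*}$; if $f(j\mid S\cup R)>v_C$, set $v_j=v_C+f(j\mid S\cup R)$, replace $S$ by $(S\setminus\{i^*\})\cup\{j\}$ and $R$ by $R\cup\{i^*\}$. Framework (input $\mathcal{A}$, $N$, $\mathcal{F}$, oracles for $f_\phi$ and $U_\phi$): for each $\gamma\in\Gamma_{\mathcal{A}}$, start with $W=N$, $\hat N=U_\phi(N)$, $M=\emptyset$, and an arbitrary order $\pi_{\hat N}$ on $\hat N$. While $\hat N\setminus M\ne\emptyset$: let $(S,R)$ be the output of $\mathcal{A}_\gamma$ on $f_\phi$ with ground set $\hat N$ ordered by $\pi_{\hat N}$ and constraint $\mathcal{F}$;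 set $M=S\cup R$; replace $W$ by $(W\setminus\hat N)\cup M$; set $\hat N=U_\phi(W)\cup M$; update $\pi_{\hat N}$ by adding the elements of $\hat N\setminus M$ last in the order. When the loop ends put $S_\gamma=S$. Output the best (largest $f_\phi$) of the sets $S_\gamma$, $\gamma\in\Gamma_{\mathcal{A}}$.
   Formalization: Compatibility is required on every ground set Y⊆N, its second condition for f_φ instead of R_φ; among tied optima U_φ returns one with nonnegative marginals; Enumerate-Budget also compares the sets X; at least one threshold is always used; matroid loops are skipped; b_i, B>0, k≥1. *)

theory Defs
  imports
    "HOL-Probability.Probability_Mass_Function"
    "HOL-Computational_Algebra.Polynomial"
    "HOL-Library.While_Combinator"
    "HOL-Library.Monad_Syntax"
begin

section \<open>Choice models and revenue\<close>

text \<open>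
  A choice model on a finite product set \<open>N\<close> is a function \<open>\<phi> i S\<close>, read as the probability that
  \<open>i \<in> S\<close> is chosen when \<open>S \<subseteq> N\<close> is offered; only these values matter.
\<close>

definition choice_model :: "'a set \<Rightarrow> ('a \<Rightarrow> 'a set \<Rightarrow> real) \<Rightarrow> bool" where
  "choice_model N \<phi> \<longleftrightarrow>
     finite N \<and> (\<forall>S\<subseteq>N. (\<forall>i\<in>S. 0 \<le> \<phi> i S) \<and> (\<Sum>i\<in>S. \<phi> i S) \<le> 1)"

definition substitutable :: "'a set \<Rightarrow> ('a \<Rightarrow> 'a set \<Rightarrow> real) \<Rightarrow> bool" where
  "substitutable N \<phi> \<longleftrightarrow>
     (\<forall>S\<subseteq>N. \<forall>i\<in>S. \<forall>j\<in>N - S. \<phi> i (insert j S) \<le> \<phi> i S)"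

definition revenue :: "('a \<Rightarrow> real) \<Rightarrow> ('a \<Rightarrow> 'a set \<Rightarrow> real) \<Rightarrow> 'a set \<Rightarrow> real" where
  "revenue r \<phi> S = (\<Sum>i\<in>S. r i * \<phi> i S)"

definition best_revenue :: "('a \<Rightarrow> real) \<Rightarrow> ('a \<Rightarrow> 'a set \<Rightarrow> real) \<Rightarrow> 'a set \<Rightarrow> real" where
  "best_revenue r \<phi> S = Max (revenue r \<phi> ` Pow S)"

definition marginal :: "('a set \<Rightarrow> real) \<Rightarrow> 'a set \<Rightarrow> 'a set \<Rightarrow> real" where
  "marginal g X Y = g (X \<union> Y) - g Y"

definition optimal_unconstrained ::
  "('a \<Rightarrow> real) \<Rightarrow> ('a \<Rightarrow> 'a set \<Rightarrow> real) \<Rightarrow> 'a set \<Rightarrow> 'a set \<Rightarrow> bool" where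
  "optimal_unconstrained r \<phi> Y S \<longleftrightarrow>
     S \<subseteq> Y \<and> (\<forall>X\<subseteq>Y. revenue r \<phi> X \<le> revenue r \<phi> S)"

section \<open>Compatible choice models\<close>

definition nonneg_marginals ::
  "('a \<Rightarrow> real) \<Rightarrow> ('a \<Rightarrow> 'a set \<Rightarrow> real) \<Rightarrow> 'a set \<Rightarrow> 'a set \<Rightarrow> bool" where
  "nonneg_marginals r \<phi> Y S \<longleftrightarrow>
     (\<forall>A\<subseteq>S. \<forall>C\<subseteq>Y. 0 \<le> marginal (revenue r \<phi>) A C)"

definition decreasing_marginals :: "('a set \<Rightarrow> real) \<Rightarrow> 'a set \<Rightarrow> 'a set \<Rightarrow> bool" where
  "decreasing_marginals g Y S \<longleftrightarrow>
     (\<forall>A\<subseteq>S. \<forall>B\<subseteq>A. \<forall>C\<subseteq>Y. marginal g C A \<le> marginal g C B)"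

text \<open>
  The two conditions are imposed on the restriction of the model to every ground set \<open>Y \<subseteq> N\<close>:
  the framework below works with optimal unconstrained assortments of such ground sets, and the
  conditions on \<open>N\<close> alone say nothing about the products left when \<open>S\<close> is discarded.

  Among tied optimal assortments, those with nonnegative marginals are meant. Ties are relevant,
  since a product that is never chosen from \<open>S\<close> can be added to \<open>S\<close> without changing the revenue
  of \<open>S\<close>: in the Markov model where every customer starts at \<open>a\<close>, moves on from \<open>a\<close> to \<open>b\<close> and
  from \<open>b\<close> to \<open>c\<close>, and prices are \<open>10, 1, 5\<close>, both \<open>{a}\<close> and \<open>{a, b}\<close> are optimal, but adding
  \<open>b\<close> to \<open>{c}\<close> loses revenue.

  The second condition is stated for \<open>f(S) = max {R(X) | X \<subseteq> S}\<close>. Given the first condition, it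
  follows from the same condition on \<open>R\<close> (lemma \<open>compatibleI_revenue\<close>), but \<open>R\<close> itself violates
  it in Markov models: let half of the customers start at \<open>i\<close> and half at \<open>a\<close>, let a customer move
  from \<open>i\<close> to \<open>d\<close>, from \<open>d\<close> to \<open>a\<close> and from \<open>a\<close> to the outside option, with prices \<open>11, 10, 1\<close> for
  \<open>i, a, d\<close>. Every optimal assortment contains \<open>A = {i, a}\<close>, and for \<open>B = {a}\<close>, \<open>C = {d}\<close> one has
  \<open>R(C | A) = 0\<close>, \<open>R(C | B) = 5.5 - 10\<close>.
\<close>

definition compatible :: "'a set \<Rightarrow> ('a \<Rightarrow> real) \<Rightarrow> ('a \<Rightarrow> 'a set \<Rightarrow> real) \<Rightarrow> bool" where
  "compatible N r \<phi> \<longleftrightarrow>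
     choice_model N \<phi> \<and> substitutable N \<phi> \<and>
     (\<forall>Y\<subseteq>N.
        (\<exists>S. optimal_unconstrained r \<phi> Y S \<and> nonneg_marginals r \<phi> Y S) \<and>
        (\<forall>S. optimal_unconstrained r \<phi> Y S \<and> nonneg_marginals r \<phi> Y S \<longrightarrow>
             decreasing_marginals (best_revenue r \<phi>) Y S))"

lemma ex_optimal_unconstrained:
  assumes "finite Y"
  shows "\<exists>S. optimal_unconstrained r \<phi> Y S"
proof -
  have fin: "finite (revenue r \<phi> ` Pow Y)" using assms by simp
  have "Max (revenue r \<phi> ` Pow Y) \<in> revenue r \<phi> ` Pow Y"
    by (rule Max_in[OF fin]) auto
  then obtain S where S: "S \<subseteq> Y" "revenue r \<phi> S = Max (revenue r \<phi> ` Pow Y)" by auto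
  have "revenue r \<phi> X \<le> revenue r \<phi> S" if "X \<subseteq> Y" for X
    unfolding S(2) by (rule Max_ge[OF fin]) (use that in auto)
  with S(1) show ?thesis unfolding optimal_unconstrained_def by auto
qed

lemma compatibleI_revenue:
  assumes "choice_model N \<phi>" and "substitutable N \<phi>"
    and R: "\<And>Y S. Y \<subseteq> N \<Longrightarrow> optimal_unconstrained r \<phi> Y S \<Longrightarrow>
      nonneg_marginals r \<phi> Y S \<and> decreasing_marginals (revenue r \<phi>) Y S"
  shows "compatible N r \<phi>"
proof -
  have finN: "finite N" using assms(1) unfolding choice_model_def by simp
  have "decreasing_marginals (best_revenue r \<phi>) Y S"
    if Y: "Y \<subseteq> N" and S: "optimal_unconstrained r \<phi> Y S" for Y S
    unfolding decreasing_marginals_def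
  proof (intro allI impI)
    fix A B C assume A: "A \<subseteq> S" and B: "B \<subseteq> A" and C: "C \<subseteq> Y"
    let ?R = "revenue r \<phi>" and ?f = "best_revenue r \<phi>"
    have SY: "S \<subseteq> Y" using S unfolding optimal_unconstrained_def by simp
    have finY: "finite Y" using finN Y finite_subset by auto
    have nn: "0 \<le> marginal ?R D E" if "D \<subseteq> S" "E \<subseteq> Y" for D E
      using R[OF Y S] that unfolding nonneg_marginals_def by simp
    have dm: "marginal ?R E D \<le> marginal ?R E D'" if "D \<subseteq> S" "D' \<subseteq> D" "E \<subseteq> Y" for D D' E
      using R[OF Y S] that unfolding decreasing_marginals_def by simp
    have fin: "finite (?R ` Pow E)" if "E \<subseteq> Y" for E
      using finite_subset[OF that finY] by simp
    have ub: "?R X \<le> ?f E" if "X \<subseteq> E" "E \<subseteq> Y" for X E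
      unfolding best_revenue_def by (rule Max_ge[OF fin]) (use that in auto)
    have att: "\<exists>X\<subseteq>E. ?f E = ?R X" if "E \<subseteq> Y" for E
    proof -
      have "Max (?R ` Pow E) \<in> ?R ` Pow E" by (rule Max_in[OF fin[OF that]]) auto
      then show ?thesis unfolding best_revenue_def by auto
    qed
    have fS: "?f D = ?R D" if D: "D \<subseteq> S" for D
    proof -
      obtain X where X: "X \<subseteq> D" "?f D = ?R X" using att[of D] D SY by blast
      have "0 \<le> marginal ?R D X" using nn[of D X] D X(1) SY by blast
      moreover have "D \<union> X = D" using X(1) by blast
      ultimately have "?R X \<le> ?R D" unfolding marginal_def by simp
      moreover have "?R D \<le> ?f D" using ub[of D D] D SY by blast
      ultimately show ?thesis using X(2) by simp
    qed
    obtain X where X: "X \<subseteq> C \<union> A" "?f (C \<union> A) = ?R X" using att[of "C \<union> A"] A C SY by blast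
    have "0 \<le> marginal ?R A X" using nn[of A X] A C X(1) SY by blast
    then have 1: "?f (C \<union> A) \<le> ?R (A \<union> X)" using X(2) unfolding marginal_def by simp
    have XC: "X - A \<subseteq> Y" using X(1) C by blast
    have "marginal ?R (X - A) A \<le> marginal ?R (X - A) B"
      using dm[OF A B XC] .
    then have 2: "?R (A \<union> X) - ?R A \<le> ?R ((X - A) \<union> B) - ?R B"
      unfolding marginal_def by (simp add: Un_commute)
    have 3: "?R ((X - A) \<union> B) \<le> ?f (C \<union> B)"
      using ub[of "(X - A) \<union> B" "C \<union> B"] A B C X(1) SY by blast
    have "B \<subseteq> S" using A B by blast
    then show "marginal ?f C A \<le> marginal ?f C B"
      using 1 2 3 fS[OF A] fS[of B] unfolding marginal_def by linarith
  qed
  moreover have "\<exists>S. optimal_unconstrained r \<phi> Y S \<and> nonneg_marginals r \<phi> Y S"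
    if "Y \<subseteq> N" for Y
  proof -
    have "finite Y" using that finN finite_subset by auto
    then obtain S where "optimal_unconstrained r \<phi> Y S"
      using ex_optimal_unconstrained by blast
    with R[OF that this] show ?thesis by auto
  qed
  ultimately show ?thesis using assms(1,2) unfolding compatible_def by simp
qed

section \<open>Markov choice models\<close>

text \<open>
  \<open>None\<close> is the outside option \<open>0\<close>. The initial distribution has \<open>pmf lam (Some i) = \<lambda>\<^sub>i\<close>, a
  possible remainder being the mass of \<open>None\<close>, and \<open>pmf (\<rho> i) (Some j) = \<rho>\<^sub>i\<^sub>j\<close>.
\<close>

definition markov_parameters ::
  "'a set \<Rightarrow> 'a option pmf \<Rightarrow> ('a \<Rightarrow> 'a option pmf) \<Rightarrow> bool" where
  "markov_parameters N lam \<rho> \<longleftrightarrow>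
     set_pmf lam \<subseteq> insert None (Some ` N) \<and>
     (\<forall>i\<in>N. set_pmf (\<rho> i) \<subseteq> insert None (Some ` N))"

definition markov_step ::
  "('a \<Rightarrow> 'a option pmf) \<Rightarrow> 'a set \<Rightarrow> 'a option \<Rightarrow> 'a option pmf" where
  "markov_step \<rho> S x =
     (case x of None \<Rightarrow> return_pmf None
      | Some i \<Rightarrow> if i \<in> S then return_pmf (Some i) else \<rho> i)"

primrec markov_state ::
  "'a option pmf \<Rightarrow> ('a \<Rightarrow> 'a option pmf) \<Rightarrow> 'a set \<Rightarrow> nat \<Rightarrow> 'a option pmf" where
  "markov_state lam \<rho> S 0 = lam"
| "markov_state lam \<rho> S (Suc n) = bind_pmf (markov_state lam \<rho> S n) (markov_step \<rho> S)"

text \<open>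
  The process is stopped in \<open>S \<union> {0}\<close>, so for \<open>i \<in> S\<close> the probabilities of being in \<open>i\<close> after \<open>n\<close>
  steps increase with \<open>n\<close> to the probability that the final choice is \<open>i\<close>.
\<close>

definition markov_choice ::
  "'a option pmf \<Rightarrow> ('a \<Rightarrow> 'a option pmf) \<Rightarrow> 'a \<Rightarrow> 'a set \<Rightarrow> real" where
  "markov_choice lam \<rho> i S = lim (\<lambda>n. pmf (markov_state lam \<rho> S n) (Some i))"

section \<open>Matroids\<close>

definition matroid :: "'a set \<Rightarrow> 'a set set \<Rightarrow> bool" where
  "matroid N \<I> \<longleftrightarrow>
     finite N \<and> \<I> \<subseteq> Pow N \<and> {} \<in> \<I> \<and>
     (\<forall>X\<in>\<I>. \<forall>Y\<subseteq>X. Y \<in> \<I>) \<and>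
     (\<forall>X\<in>\<I>. \<forall>Y\<in>\<I>. card X < card Y \<longrightarrow> (\<exists>e\<in>Y - X. insert e X \<in> \<I>))"

definition circuit :: "'a set set \<Rightarrow> 'a set \<Rightarrow> bool" where
  "circuit \<I> C \<longleftrightarrow> C \<notin> \<I> \<and> (\<forall>D. D \<subset> C \<longrightarrow> D \<in> \<I>)"

section \<open>Computations with running time\<close>

text \<open>
  Real arithmetic has unit cost, operations on a subset of \<open>N\<close> are charged \<open>|N| + 1\<close>, and a call
  of an oracle is charged the time that the oracle takes.
\<close>

datatype 'x timed = Timed (result: 'x) (cost: nat)

definition ret :: "'x \<Rightarrow> 'x timed" where
  "ret x = Timed x 0"

definition charge :: "nat \<Rightarrow> unit timed" where
  "charge c = Timed () c"

definition bind_timed :: "'x timed \<Rightarrow> ('x \<Rightarrow> 'y timed) \<Rightarrow> 'y timed" where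
  "bind_timed m k = Timed (result (k (result m))) (cost m + cost (k (result m)))"

adhoc_overloading Monad_Syntax.bind \<rightleftharpoons> bind_timed

primrec fold_timed :: "('x \<Rightarrow> 's \<Rightarrow> 's timed) \<Rightarrow> 'x list \<Rightarrow> 's \<Rightarrow> 's timed" where
  "fold_timed g [] s = ret s"
| "fold_timed g (x # xs) s = do { s' \<leftarrow> g x s; fold_timed g xs s' }"

primrec map_timed :: "('x \<Rightarrow> 'y timed) \<Rightarrow> 'x list \<Rightarrow> 'y list timed" where
  "map_timed g [] = ret []"
| "map_timed g (x # xs) = do { y \<leftarrow> g x; ys \<leftarrow> map_timed g xs; ret (y # ys) }"

text \<open>
  The input of the algorithms: the products, the oracles for \<open>f\<^sub>\<phi>\<close> and \<open>U\<^sub>\<phi>\<close> with the time they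
  take, and two functions that resolve the arbitrary choices: \<open>arrange X\<close> lists a finite set in
  some order, \<open>pick X\<close> is an element of a nonempty finite set.
\<close>

record 'a input =
  products :: "'a set"
  f_oracle :: "'a set \<Rightarrow> real"
  U_oracle :: "'a set \<Rightarrow> 'a set"
  f_time :: "'a set \<Rightarrow> nat"
  U_time :: "'a set \<Rightarrow> nat"
  arrange :: "'a set \<Rightarrow> 'a list"
  pick :: "'a set \<Rightarrow> 'a"

definition assortment_input ::
  "'a set \<Rightarrow> ('a \<Rightarrow> real) \<Rightarrow> ('a \<Rightarrow> 'a set \<Rightarrow> real) \<Rightarrow> 'a input \<Rightarrow> bool" where
  "assortment_input N r \<phi> I \<longleftrightarrow>
     products I = N \<and>
     (\<forall>Y\<subseteq>N. f_oracle I Y = best_revenue r \<phi> Y) \<and>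
     (\<forall>Y\<subseteq>N. optimal_unconstrained r \<phi> Y (U_oracle I Y) \<and>
             nonneg_marginals r \<phi> Y (U_oracle I Y)) \<and>
     (\<forall>X. finite X \<longrightarrow> set (arrange I X) = X \<and> distinct (arrange I X)) \<and>
     (\<forall>X. finite X \<and> X \<noteq> {} \<longrightarrow> pick I X \<in> X)"

text \<open>
  Since \<open>f\<^sub>\<phi>(Y) = R\<^sub>\<phi>(U\<^sub>\<phi>(Y))\<close>, a polynomial time algorithm for \<open>U\<^sub>\<phi>\<close> makes both oracles
  polynomial.
\<close>

definition oracle_time_le :: "'a input \<Rightarrow> nat poly \<Rightarrow> bool" where
  "oracle_time_le I q \<longleftrightarrow>
     (\<forall>Y\<subseteq>products I. f_time I Y \<le> poly q (card (products I)) \<and>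
                     U_time I Y \<le> poly q (card (products I)))"

definition query_f :: "'a input \<Rightarrow> 'a set \<Rightarrow> real timed" where
  "query_f I Y = Timed (f_oracle I Y) (f_time I Y)"

definition query_U :: "'a input \<Rightarrow> 'a set \<Rightarrow> 'a set timed" where
  "query_U I Y = Timed (U_oracle I Y) (U_time I Y)"

definition set_ops :: "'a input \<Rightarrow> unit timed" where
  "set_ops I = charge (card (products I) + 1)"

definition query_marginal :: "'a input \<Rightarrow> 'a \<Rightarrow> 'a set \<Rightarrow> real timed" where
  "query_marginal I j S = do {
     x \<leftarrow> query_f I (insert j S);
     y \<leftarrow> query_f I S;
     set_ops I;
     ret (x - y) }"

section \<open>The framework\<close>

text \<open>
  An underlying algorithm consists of its parameter settings, of the run for one setting on an
  ordered ground set, which returns the pair \<open>(S, R)\<close>, and of the sets that are compared at the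
  end, as a function of the sets found for the parameter settings.
\<close>

record ('g, 'a) algorithm =
  settings :: "'g list timed"
  run :: "'g \<Rightarrow> 'a list \<Rightarrow> ('a set \<times> 'a set) timed"
  candidates :: "'a set list \<Rightarrow> 'a set list timed"

text \<open>The state of the loop is \<open>(W, xs, M, S)\<close>, where \<open>xs\<close> lists the current ground set in order.\<close>

definition framework_body ::
  "'a input \<Rightarrow> ('a list \<Rightarrow> ('a set \<times> 'a set) timed) \<Rightarrow>
   'a set \<times> 'a list \<times> 'a set \<times> 'a set \<Rightarrow> ('a set \<times> 'a list \<times> 'a set \<times> 'a set) timed" where
  "framework_body I rn = (\<lambda>(W, xs, M, S). do {
     (S', R') \<leftarrow> rn xs;
     let M' = S' \<union> R';
     let W' = (W - set xs) \<union> M';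
     X \<leftarrow> query_U I W';
     set_ops I;
     ret (W', filter (\<lambda>j. j \<in> M') xs @ arrange I (X - M'), M', S') })"

definition framework_loop ::
  "'a input \<Rightarrow> ('a list \<Rightarrow> ('a set \<times> 'a set) timed) \<Rightarrow> 'a set timed option" where
  "framework_loop I rn =
     map_option (\<lambda>t. do { (W, xs, M, S) \<leftarrow> t; ret S })
       (while_option
          (\<lambda>t. case result t of (W, xs, M, S) \<Rightarrow> set xs - M \<noteq> {})
          (\<lambda>t. do { s \<leftarrow> t; set_ops I; framework_body I rn s })
          (do { X \<leftarrow> query_U I (products I);
                set_ops I;
                ret (products I, arrange I X, {}, {}) }))"

definition select_best :: "'a input \<Rightarrow> 'a set list \<Rightarrow> 'a set timed" where
  "select_best I Ss = do {
     map_timed (query_f I) Ss;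
     charge (length Ss);
     ret (arg_max_on (f_oracle I) (set Ss)) }"

text \<open>The result is \<open>None\<close> if the loop does not end for some parameter setting.\<close>

definition framework :: "('g, 'a) algorithm \<Rightarrow> 'a input \<Rightarrow> 'a set timed option" where
  "framework \<A> I =
     map_option
       (\<lambda>ts. do {
          settings \<A>;
          Ss \<leftarrow> map_timed (\<lambda>t. t) ts;
          Cs \<leftarrow> candidates \<A> Ss;
          select_best I Cs })
       (those (map (\<lambda>\<gamma>. framework_loop I (run \<A> \<gamma>)) (result (settings \<A>))))"

definition approximate_solution ::
  "real \<Rightarrow> 'a set set \<Rightarrow> ('a set \<Rightarrow> real) \<Rightarrow> 'a set \<Rightarrow> bool" where
  "approximate_solution \<alpha> \<F> f S \<longleftrightarrow> S \<in> \<F> \<and> \<alpha> * Max (f ` \<F>) \<le> f S"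

section \<open>Underlying algorithms\<close>

text \<open>
  The thresholds \<open>(1+\<epsilon>)\<^bsup>i-1\<^esup> max {f({e}) | e \<in> E} / c\<close> for \<open>i = 1, \<dots>, \<lceil>log\<^bsub>1+\<epsilon>\<^esub> m\<rceil>\<close>. At least one
  threshold is used, also if \<open>m = 1\<close>, where the logarithm is zero.
\<close>

definition thresholds :: "'a input \<Rightarrow> real \<Rightarrow> 'a set \<Rightarrow> real \<Rightarrow> nat \<Rightarrow> real list timed" where
  "thresholds I \<epsilon> E c m = do {
     map_timed (\<lambda>e. query_f I {e}) (arrange I E);
     set_ops I;
     let v = Max ((\<lambda>e. f_oracle I {e}) ` E);
     let l = max 1 (nat \<lceil>log (1 + \<epsilon>) (real m)\<rceil>);
     charge l;
     ret (map (\<lambda>i. (1 + \<epsilon>) ^ (i - 1) * (1 / c) * v) [1..<l + 1]) }"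

subsection \<open>Threshold-Cardinality\<close>

definition cardinality_step :: "'a input \<Rightarrow> nat \<Rightarrow> real \<Rightarrow> 'a \<Rightarrow> 'a set \<Rightarrow> 'a set timed" where
  "cardinality_step I k \<tau> j S = do {
     set_ops I;
     if card S < k then do {
       w \<leftarrow> query_marginal I j S;
       ret (if w \<ge> \<tau> then insert j S else S) }
     else ret S }"

definition threshold_cardinality :: "'a input \<Rightarrow> real \<Rightarrow> nat \<Rightarrow> (real, 'a) algorithm" where
  "threshold_cardinality I \<epsilon> k =
     \<lparr> settings = thresholds I \<epsilon> (products I) (real k) k,
       run = (\<lambda>\<tau> xs. do { S \<leftarrow> fold_timed (cardinality_step I k \<tau>) xs {}; ret (S, {}) }),
       candidates = ret \<rparr>"

subsection \<open>Threshold-Budget\<close>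

definition budget_step ::
  "'a input \<Rightarrow> ('a \<Rightarrow> real) \<Rightarrow> real \<Rightarrow> real \<Rightarrow> 'a \<Rightarrow> 'a set \<Rightarrow> 'a set timed" where
  "budget_step I b B \<tau> j S = do {
     set_ops I;
     if b j \<le> B \<and> sum b S < B \<and> b j < B - sum b S then do {
       w \<leftarrow> query_marginal I j S;
       ret (if w / b j \<ge> \<tau> then insert j S else S) }
     else ret S }"

text \<open>
  The elements with \<open>b\<^sub>e > B\<close> are also ignored in the maximum that determines the thresholds and
  in the final comparison with the singletons.
\<close>

definition threshold_budget ::
  "'a input \<Rightarrow> real \<Rightarrow> ('a \<Rightarrow> real) \<Rightarrow> real \<Rightarrow> (real, 'a) algorithm" where
  "threshold_budget I \<epsilon> b B =
     \<lparr> settings = thresholds I \<epsilon> {e \<in> products I. b e \<le> B} B (card (products I)),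
       run = (\<lambda>\<tau> xs. do { S \<leftarrow> fold_timed (budget_step I b B \<tau>) xs {}; ret (S, {}) }),
       candidates = (\<lambda>Ss. do {
         set_ops I;
         ret (Ss @ map (\<lambda>e. {e}) (arrange I {e \<in> products I. b e \<le> B})) }) \<rparr>"

subsection \<open>Enumerate-Budget\<close>

fun small_subsets :: "nat \<Rightarrow> 'a list \<Rightarrow> 'a set list timed" where
  "small_subsets 0 xs = do { charge 1; ret [{}] }"
| "small_subsets (Suc m) [] = do { charge 1; ret [{}] }"
| "small_subsets (Suc m) (x # xs) = do {
     Xs \<leftarrow> small_subsets m xs;
     Ys \<leftarrow> small_subsets (Suc m) xs;
     charge (1 + length xs * (length Xs + length Ys));
     ret (map (insert x) Xs @ Ys) }"

definition enumerated_sets ::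
  "'a input \<Rightarrow> real \<Rightarrow> ('a \<Rightarrow> real) \<Rightarrow> real \<Rightarrow> 'a set list timed" where
  "enumerated_sets I \<epsilon> b B = do {
     Xs \<leftarrow> small_subsets (nat \<lfloor>1 / \<epsilon>\<rfloor>) (arrange I (products I));
     map_timed (\<lambda>_. set_ops I) Xs;
     ret (filter (\<lambda>X. sum b X \<le> B) Xs) }"

definition restricted_products :: "'a set \<Rightarrow> ('a \<Rightarrow> real) \<Rightarrow> 'a set \<Rightarrow> 'a set" where
  "restricted_products N b X =
     (if X = {} then N else N - {e. e \<notin> X \<and> b e > Min (b ` X)})"

definition enumerate_settings ::
  "'a input \<Rightarrow> real \<Rightarrow> ('a \<Rightarrow> real) \<Rightarrow> real \<Rightarrow> ('a set \<times> real) list timed" where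
  "enumerate_settings I \<epsilon> b B = do {
     Xs \<leftarrow> enumerated_sets I \<epsilon> b B;
     pss \<leftarrow> map_timed (\<lambda>X. do {
         set_ops I;
         let E = restricted_products (products I) b X;
         ts \<leftarrow> thresholds I \<epsilon> E B (card E);
         charge (length ts);
         ret (map (Pair X) ts) }) Xs;
     charge (length (concat pss));
     ret (concat pss) }"

text \<open>
  Each effective removal step makes the set smaller, so \<open>card S\<close> steps reach the end of the loop
  of Final-Add.
\<close>

definition final_add_step ::
  "'a input \<Rightarrow> real \<Rightarrow> ('a \<Rightarrow> real) \<Rightarrow> real \<Rightarrow> 'a set \<Rightarrow> 'a set" where
  "final_add_step I \<epsilon> b B S =
     (if sum b S > B \<and> {i \<in> S. b i < \<epsilon> * B} \<noteq> {} then S - {pick I {i \<in> S. b i < \<epsilon> * B}} else S)"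

definition final_add ::
  "'a input \<Rightarrow> real \<Rightarrow> ('a \<Rightarrow> real) \<Rightarrow> real \<Rightarrow> 'a set \<Rightarrow> 'a set timed" where
  "final_add I \<epsilon> b B S =
     fold_timed (\<lambda>_ T. do { set_ops I; ret (final_add_step I \<epsilon> b B T) }) [0..<card S] S"

text \<open>The state of a run is \<open>(S, R, stopped)\<close>.\<close>

definition enumerate_step ::
  "'a input \<Rightarrow> real \<Rightarrow> ('a \<Rightarrow> real) \<Rightarrow> real \<Rightarrow> 'a set \<times> real \<Rightarrow>
   'a \<Rightarrow> 'a set \<times> 'a set \<times> bool \<Rightarrow> ('a set \<times> 'a set \<times> bool) timed" where
  "enumerate_step I \<epsilon> b B = (\<lambda>(X, \<tau>) j (S, R, stopped). do {
     set_ops I;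
     if \<not> stopped \<and> j \<in> restricted_products (products I) b X \<and> sum b S < B then do {
       w \<leftarrow> query_marginal I j S;
       if w / b j \<ge> \<tau> then
         (if b j + sum b S \<le> B then ret (insert j S, R, False)
          else do {
            T \<leftarrow> final_add I \<epsilon> b B (insert j S);
            ret (T, insert j S - T, True) })
       else ret (S, R, False) }
     else ret (S, R, stopped) })"

text \<open>
  The enumerated sets \<open>X\<close> are themselves compared at the end, as the singletons are in
  Threshold-Budget. Without them a run may yield no feasible set: let \<open>B = 1\<close>, \<open>\<epsilon> = 0.1\<close> and let
  revenue be additive, with three products of cost \<open>0.4\<close> and value \<open>0.81\<close> that come first, and two
  products of cost \<open>0.5\<close> and value \<open>1\<close>. Each run then either takes the first three products, none of
  which can be removed again, or takes none at all.
\<close>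

definition enumerate_budget ::
  "'a input \<Rightarrow> real \<Rightarrow> ('a \<Rightarrow> real) \<Rightarrow> real \<Rightarrow> ('a set \<times> real, 'a) algorithm" where
  "enumerate_budget I \<epsilon> b B =
     \<lparr> settings = enumerate_settings I \<epsilon> b B,
       run = (\<lambda>\<gamma> xs. do {
         (S, R, stopped) \<leftarrow> fold_timed (enumerate_step I \<epsilon> b B \<gamma>) xs ({}, {}, False);
         ret (S, R) }),
       candidates = (\<lambda>Ss. do {
         map_timed (\<lambda>_. set_ops I) Ss;
         Xs \<leftarrow> enumerated_sets I \<epsilon> b B;
         ret (filter (\<lambda>S. sum b S \<le> B) Ss @ Xs) }) \<rparr>"

subsection \<open>Matroid-Swap\<close>

definition query_indep :: "'a set set \<Rightarrow> ('a set \<Rightarrow> nat) \<Rightarrow> 'a set \<Rightarrow> bool timed" where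
  "query_indep \<I> T X = Timed (X \<in> \<I>) (T X)"

text \<open>The circuit in a dependent set \<open>X = S \<union> {j}\<close> with \<open>S \<in> \<I>\<close>, found with \<open>|X|\<close> queries.\<close>

definition find_circuit ::
  "'a input \<Rightarrow> 'a set set \<Rightarrow> ('a set \<Rightarrow> nat) \<Rightarrow> 'a set \<Rightarrow> 'a set timed" where
  "find_circuit I \<I> T X = do {
     ds \<leftarrow> map_timed (\<lambda>i. do {
         d \<leftarrow> query_indep \<I> T (X - {i});
         set_ops I;
         ret (i, d) }) (arrange I X);
     ret {i. (i, True) \<in> set ds} }"

lemma result_map_timed: "result (map_timed g xs) = map (\<lambda>x. result (g x)) xs"
  by (induction xs) (simp_all add: bind_timed_def ret_def)

lemma find_circuit_iff:
  assumes "matroid N \<I>" and S: "S \<in> \<I>" and dep: "insert j S \<notin> \<I>"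
    and arr: "\<And>X. finite X \<Longrightarrow> set (arrange I X) = X"
  shows "C = result (find_circuit I \<I> T (insert j S)) \<longleftrightarrow> circuit \<I> C \<and> C \<subseteq> insert j S"
proof -
  let ?X = "insert j S"
  define D where "D = {i \<in> ?X. ?X - {i} \<in> \<I>}"
  have down: "Y \<in> \<I>" if "X \<in> \<I>" "Y \<subseteq> X" for X Y
    using assms(1) that unfolding matroid_def by auto
  have aug: "\<exists>e\<in>Y - X. insert e X \<in> \<I>" if "X \<in> \<I>" "Y \<in> \<I>" "card X < card Y" for X Y
    using assms(1) that unfolding matroid_def by auto
  have "finite S" using assms(1) S finite_subset unfolding matroid_def by auto
  then have fin: "finite ?X" by simp
  have "j \<notin> S"
  proof
    assume "j \<in> S"
    then have "insert j S = S" by (rule insert_absorb)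
    with S dep show False by simp
  qed
  then have cardX: "card ?X = Suc (card S)" using \<open>finite S\<close> by simp
  have res: "result (find_circuit I \<I> T ?X) = D"
    unfolding find_circuit_def D_def query_indep_def set_ops_def charge_def
    by (auto simp: bind_timed_def ret_def result_map_timed arr[OF fin])
  have D_dep: "D \<notin> \<I>"
  proof
    assume "D \<in> \<I>"
    define P where "P E \<longleftrightarrow> D \<subseteq> E \<and> E \<subseteq> ?X \<and> E \<in> \<I>" for E
    have "P D" using \<open>D \<in> \<I>\<close> unfolding P_def D_def by auto
    moreover have "\<forall>E. P E \<longrightarrow> card E < Suc (card ?X)"
      unfolding P_def using card_mono[OF fin] by (auto simp: less_Suc_eq_le)
    ultimately have "\<exists>E. P E \<and> (\<forall>E'. P E' \<longrightarrow> card E' \<le> card E)"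
      by (rule Lattices_Big.ex_has_greatest_nat)
    then obtain E where "P E" and "\<forall>E'. P E' \<longrightarrow> card E' \<le> card E" by auto
    then have E: "D \<subseteq> E \<and> E \<subseteq> ?X \<and> E \<in> \<I>"
      and mx: "\<And>E'. D \<subseteq> E' \<and> E' \<subseteq> ?X \<and> E' \<in> \<I> \<Longrightarrow> card E' \<le> card E"
      unfolding P_def by auto
    have finE: "finite E" using E fin finite_subset by blast
    have ge: "\<not> card E < card S"
    proof
      assume "card E < card S"
      then obtain e where e: "e \<in> S - E" "insert e E \<in> \<I>" using aug[of E S] S E by auto
      then have "card (insert e E) \<le> card E" using E by (intro mx) auto
      then show False using e(1) finE by simp
    qed
    have "E \<noteq> ?X" using E dep by auto
    then obtain i where i: "i \<in> ?X" "i \<notin> E" using E by blast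
    then have sub: "E \<subseteq> ?X - {i}" using E by blast
    have "card (?X - {i}) = card S" using i(1) fin cardX by (simp add: card_Diff_singleton)
    with ge have "card (?X - {i}) \<le> card E" by simp
    with sub fin have "E = ?X - {i}" by (intro card_seteq) simp_all
    then have "i \<in> D" using E i(1) unfolding D_def by auto
    then show False using E i(2) by blast
  qed
  have D_min: "E \<in> \<I>" if ED: "E \<subset> D" for E
  proof -
    obtain i where i: "i \<in> D" "i \<notin> E" using ED by auto
    then have "E \<subseteq> ?X - {i}" using ED unfolding D_def by blast
    moreover have "?X - {i} \<in> \<I>" using i(1) unfolding D_def by simp
    ultimately show ?thesis by (rule down[rotated])
  qed
  have "C = D" if "circuit \<I> C" "C \<subseteq> ?X"
  proof -
    have "D \<subseteq> C"
    proof
      fix i assume i: "i \<in> D"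
      show "i \<in> C"
      proof (rule ccontr)
        assume "i \<notin> C"
        then have "C \<subseteq> ?X - {i}" using that(2) by blast
        moreover have "?X - {i} \<in> \<I>" using i unfolding D_def by simp
        ultimately have "C \<in> \<I>" by (rule down[rotated])
        then show False using that(1) unfolding circuit_def by simp
      qed
    qed
    then show ?thesis using D_dep that(1) unfolding circuit_def by auto
  qed
  moreover have "circuit \<I> D" using D_dep D_min unfolding circuit_def by simp
  moreover have "D \<subseteq> ?X" unfolding D_def by auto
  ultimately show ?thesis unfolding res by auto
qed

text \<open>
  The state of a run is \<open>(S, R, v)\<close>. If the circuit is \<open>{j}\<close>, nothing can be exchanged for \<open>j\<close>, and
  \<open>j\<close> is skipped.
\<close>

definition matroid_step ::
  "'a input \<Rightarrow> 'a set set \<Rightarrow> ('a set \<Rightarrow> nat) \<Rightarrow>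
   'a \<Rightarrow> 'a set \<times> 'a set \<times> ('a \<Rightarrow> real) \<Rightarrow> ('a set \<times> 'a set \<times> ('a \<Rightarrow> real)) timed" where
  "matroid_step I \<I> T j = (\<lambda>(S, R, v). do {
     indep \<leftarrow> query_indep \<I> T (insert j S);
     w \<leftarrow> query_marginal I j (S \<union> R);
     if indep then ret (insert j S, R, v(j := w))
     else do {
       C \<leftarrow> find_circuit I \<I> T (insert j S);
       set_ops I;
       if C - {j} = {} then ret (S, R, v)
       else do {
         let vC = Min (v ` (C - {j}));
         let i = pick I {i \<in> C - {j}. v i = vC};
         ret (if w > vC then (insert j (S - {i}), insert i R, v(j := vC + w)) else (S, R, v)) } } })"

definition matroid_swap ::
  "'a input \<Rightarrow> 'a set set \<Rightarrow> ('a set \<Rightarrow> nat) \<Rightarrow> (unit, 'a) algorithm" where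
  "matroid_swap I \<I> T =
     \<lparr> settings = ret [()],
       run = (\<lambda>_ xs. do {
         (S, R, v) \<leftarrow> fold_timed (matroid_step I \<I> T) xs ({}, {}, \<lambda>_. 0);
         ret (S, R) }),
       candidates = ret \<rparr>"

end

theory Submission
  imports Defs
begin

text \<open>
  Markov models. Everything rests on one probabilistic fact, \<open>strong_markov\<close>: if \<open>A \<subseteq> T\<close>, a customer
  who ends in \<open>a \<in> A\<close> when \<open>A\<close> is offered passes through \<open>T\<close> first, so
  \<open>\<phi>(a, A) = (\<Sum>x\<in>T. \<phi>(x, T) * P\<^sub>x(a, A))\<close>, where \<open>P\<^sub>x\<close> refers to a customer who starts at \<open>x\<close>. If
  \<open>h\<^sub>A(x)\<close> denotes the expected revenue from such a customer (\<open>worth\<close>), this yields \<open>revenue_diff\<close>: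
  \<open>R(T) - R(A) = (\<Sum>x\<in>T - A. \<phi>(x, T) * (r\<^sub>x - h\<^sub>A(x)))\<close>, and the rest is algebra with this identity. An
  assortment \<open>S\<close> from a ground set \<open>Y\<close> that maximizes \<open>h\<close> for all starting points at once satisfies
  \<open>r\<^sub>s = h\<^sub>S(s) \<ge> h\<^sub>C(s)\<close> for all \<open>s \<in> S\<close> and \<open>C \<subseteq> Y\<close>, so adding parts of \<open>S\<close> never loses revenue. For
  decreasing marginals, let \<open>X \<subseteq> C\<close> be a smallest set with \<open>f(C \<union> A) = R(A \<union> X)\<close>. Each \<open>x \<in> X\<close> then
  satisfies \<open>r\<^sub>x \<ge> h\<^sub>A(x) \<ge> h\<^sub>B(x)\<close> and is chosen at least as often from \<open>B \<union> X\<close> as from \<open>A \<union> X\<close>, so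
  that adding \<open>X\<close> to \<open>B\<close> gains at least as much as adding it to \<open>A\<close>.

  The framework. Call an optimal assortment with nonnegative marginals ideal. The part of an ideal
  assortment that survives in a smaller ground set can be added to any ideal assortment of that
  ground set, and the result is again ideal (\<open>ideal_Un\<close>). Hence in every round the list handed to
  the underlying algorithm is ideal for the products that are still available, and compatibility
  gives decreasing marginals from its subsets with respect to all these products. A product that a
  run does not keep in \<open>S \<union> R\<close> leaves the state of the run unchanged, so that the runs of all rounds
  together are a single run over one long list \<open>\<pi>\<close>. Let \<open>gain j\<close> be the marginal value of \<open>j\<close> with
  respect to what is kept when \<open>j\<close> is read. Two inequalities capture all that the analysis of an
  underlying algorithm uses: the gains of a set of kept products sum up to at most its value
  (\<open>sum_gain_le\<close>), and \<open>f(X)\<close> exceeds the value of all kept products by at most the gains of the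
  rejected products in \<open>X\<close> (\<open>f_le_kept_plus_gain\<close>). The second one uses that at the end the unread
  products cannot improve on the kept ones.

  The underlying algorithms. A run with a threshold either collects gains up to the threshold times
  the size or budget, or it rejects products of the optimum only because their gains are small; the
  right threshold balances the two cases. For Matroid-Swap, the values \<open>v\<close> in \<open>S\<close> always sum up to
  the gains of all kept products, each value is at most twice the gain of its product, and the
  products of value at least \<open>\<theta>\<close> span everything rejected with gain at least \<open>\<theta>\<close>. This loses a
  factor of two twice.

  Running time. Every round reads a new product, so there are at most \<open>|N|\<close> rounds.
\<close>

section \<open>Markov chains stopped in a set of products\<close>

locale markov_chain =
  fixes N :: "'a set" and \<rho> :: "'a \<Rightarrow> 'a option pmf"
  assumes finite_N: "finite N"
    and transition_support: "\<And>i. i \<in> N \<Longrightarrow> set_pmf (\<rho> i) \<subseteq> insert None (Some ` N)"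
begin

abbreviation V :: "'a option set" where "V \<equiv> insert None (Some ` N)"

abbreviation state where "state lam \<equiv> markov_state lam \<rho>"
abbreviation choice where "choice lam \<equiv> markov_choice lam \<rho>"

text \<open>
  All distributions that occur live on the finite set \<open>V\<close>. As finite sums, their expectations
  commute with the limits that define choice probabilities.
\<close>

definition mean :: "'a option pmf \<Rightarrow> ('a option \<Rightarrow> real) \<Rightarrow> real" where
  "mean p g = (\<Sum>y\<in>V. pmf p y * g y)"

text \<open>
  \<open>P\<^sub>y(i, S)\<close>: the probability that a customer who is at \<open>y\<close> ends in \<open>i\<close> when \<open>S\<close> is offered.
\<close>

definition hit :: "'a option \<Rightarrow> 'a \<Rightarrow> 'a set \<Rightarrow> real" where
  "hit y = choice (return_pmf y)"

lemma finite_V: "finite V"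
  using finite_N by simp

lemma expectation_eq_mean:
  assumes "set_pmf p \<subseteq> V"
  shows "measure_pmf.expectation p g = mean p g"
  unfolding mean_def using integral_measure_pmf[OF finite_V, of p g] assms by auto

lemma pmf_bind_mean:
  assumes "set_pmf p \<subseteq> V"
  shows "pmf (bind_pmf p k) z = mean p (\<lambda>y. pmf (k y) z)"
  using expectation_eq_mean[OF assms] by (simp add: pmf_bind)

lemma mean_bind:
  assumes "set_pmf p \<subseteq> V"
  shows "mean (bind_pmf p k) g = mean p (\<lambda>y. mean (k y) g)"
proof -
  have "mean (bind_pmf p k) g = (\<Sum>z\<in>V. \<Sum>y\<in>V. pmf p y * (pmf (k y) z * g z))"
    unfolding mean_def[of "bind_pmf p k"] pmf_bind_mean[OF assms]
    by (simp add: mean_def sum_distrib_right mult.assoc del: sum.insert)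
  also have "\<dots> = (\<Sum>y\<in>V. \<Sum>z\<in>V. pmf p y * (pmf (k y) z * g z))"
    by (rule sum.swap)
  also have "\<dots> = mean p (\<lambda>y. mean (k y) g)"
    unfolding mean_def by (simp add: sum_distrib_left del: sum.insert)
  finally show ?thesis .
qed

lemma mean_return: "y \<in> V \<Longrightarrow> mean (return_pmf y) g = g y"
proof -
  assume y: "y \<in> V"
  have "mean (return_pmf y) g = (\<Sum>x\<in>V. if x = y then g x else 0)"
    unfolding mean_def by (rule sum.cong) auto
  also have "\<dots> = g y" using y finite_V by (simp only: sum.delta if_True)
  finally show ?thesis .
qed

lemma mean_mono: "(\<And>y. y \<in> V \<Longrightarrow> g y \<le> h y) \<Longrightarrow> mean p g \<le> mean p h"
  unfolding mean_def by (intro sum_mono mult_left_mono) auto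

lemma mean_cong: "(\<And>y. y \<in> V \<Longrightarrow> g y = h y) \<Longrightarrow> mean p g = mean p h"
  unfolding mean_def by (intro sum.cong) auto

lemma step_support: "y \<in> V \<Longrightarrow> set_pmf (markov_step \<rho> S y) \<subseteq> V"
  using transition_support unfolding markov_step_def by (auto split: option.splits)

lemma state_support: "set_pmf lam \<subseteq> V \<Longrightarrow> set_pmf (state lam S n) \<subseteq> V"
proof (induction n)
  case (Suc n)
  then have *: "set_pmf (state lam S n) \<subseteq> V" by simp
  show ?case unfolding markov_state.simps set_bind_pmf using * step_support by blast
qed simp

lemma state_shift:
  "state lam S (Suc n) = bind_pmf lam (\<lambda>y. state (markov_step \<rho> S y) S n)"
  by (induction n) (simp_all add: bind_assoc_pmf)

lemma state_mixture: "state lam S n = bind_pmf lam (\<lambda>y. state (return_pmf y) S n)"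
  by (induction n) (simp_all add: bind_assoc_pmf bind_return_pmf')

lemma step_stopped: "i \<in> S \<Longrightarrow> markov_step \<rho> S (Some i) = return_pmf (Some i)"
  by (simp add: markov_step_def)

text \<open>
  A customer who has reached \<open>i \<in> S\<close> stays there, so the limit in \<open>markov_choice\<close> is a supremum.
\<close>

lemma state_mono:
  assumes lam: "set_pmf lam \<subseteq> V" and i: "i \<in> S" "S \<subseteq> N"
  shows "incseq (\<lambda>n. pmf (state lam S n) (Some i))"
proof (rule incseq_SucI)
  fix n
  have i': "Some i \<in> V" using i by auto
  have "pmf (state lam S n) (Some i) * pmf (markov_step \<rho> S (Some i)) (Some i)
      \<le> mean (state lam S n) (\<lambda>y. pmf (markov_step \<rho> S y) (Some i))"
    unfolding mean_def by (rule member_le_sum[OF i']) (use finite_V in auto)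
  then show "pmf (state lam S n) (Some i) \<le> pmf (state lam S (Suc n)) (Some i)"
    using i(1) by (simp add: step_stopped pmf_bind_mean[OF state_support[OF lam]])
qed

lemma choice_LIMSEQ:
  assumes "set_pmf lam \<subseteq> V" and "i \<in> S" "S \<subseteq> N"
  shows "(\<lambda>n. pmf (state lam S n) (Some i)) \<longlonglongrightarrow> choice lam i S"
proof -
  have "convergent (\<lambda>n. pmf (state lam S n) (Some i))"
    using state_mono[OF assms] pmf_le_1
    by (intro Bseq_monoseq_convergent BseqI'[of _ 1]) (auto simp: incseq_imp_monoseq)
  then show ?thesis unfolding markov_choice_def by (simp add: convergent_LIMSEQ_iff)
qed

lemma state_le_choice:
  assumes "set_pmf lam \<subseteq> V" and "i \<in> S" "S \<subseteq> N"
  shows "pmf (state lam S n) (Some i) \<le> choice lam i S"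
  using incseq_le[OF state_mono[OF assms] choice_LIMSEQ[OF assms]] .

lemma choice_nonneg:
  assumes "set_pmf lam \<subseteq> V" and "i \<in> S" "S \<subseteq> N"
  shows "0 \<le> choice lam i S"
  using order_trans[OF pmf_nonneg state_le_choice[OF assms, of 0]] .

lemma choice_sum_le_1:
  assumes "set_pmf lam \<subseteq> V" and "S \<subseteq> N"
  shows "(\<Sum>i\<in>S. choice lam i S) \<le> 1"
proof (rule LIMSEQ_le_const2)
  show "(\<lambda>n. \<Sum>i\<in>S. pmf (state lam S n) (Some i)) \<longlonglongrightarrow> (\<Sum>i\<in>S. choice lam i S)"
    using assms by (intro tendsto_sum choice_LIMSEQ) auto
  have fin: "finite S" using assms(2) finite_N finite_subset by auto
  have "(\<Sum>i\<in>S. pmf p (Some i)) \<le> 1" for p :: "'a option pmf"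
  proof -
    have "(\<Sum>i\<in>S. pmf p (Some i)) = (\<Sum>y\<in>Some ` S. pmf p y)"
      by (simp add: sum.reindex)
    also have "\<dots> = measure p (Some ` S)" using fin by (simp add: measure_measure_pmf_finite)
    finally show ?thesis by simp
  qed
  then show "\<exists>M. \<forall>n\<ge>M. (\<Sum>i\<in>S. pmf (state lam S n) (Some i)) \<le> 1" by blast
qed

lemma choice_le_1:
  assumes "set_pmf lam \<subseteq> V" and "i \<in> S" "S \<subseteq> N"
  shows "choice lam i S \<le> 1"
  by (rule LIMSEQ_le_const2[OF choice_LIMSEQ[OF assms]]) (auto simp: pmf_le_1)

lemma choice_mixture:
  assumes lam: "set_pmf lam \<subseteq> V" and i: "i \<in> S" "S \<subseteq> N"
  shows "choice lam i S = mean lam (\<lambda>y. hit y i S)"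
proof (rule LIMSEQ_unique[OF choice_LIMSEQ[OF assms]])
  have "pmf (state lam S n) (Some i) = mean lam (\<lambda>y. pmf (state (return_pmf y) S n) (Some i))" for n
    by (subst state_mixture) (rule pmf_bind_mean[OF lam])
  moreover have "(\<lambda>n. mean lam (\<lambda>y. pmf (state (return_pmf y) S n) (Some i)))
      \<longlonglongrightarrow> mean lam (\<lambda>y. hit y i S)"
    unfolding mean_def hit_def using i by (intro tendsto_sum tendsto_mult_left choice_LIMSEQ) auto
  ultimately show "(\<lambda>n. pmf (state lam S n) (Some i)) \<longlonglongrightarrow> mean lam (\<lambda>y. hit y i S)"
    by simp
qed

lemma hit_step:
  assumes y: "y \<in> V" and i: "i \<in> S" "S \<subseteq> N"
  shows "hit y i S = choice (markov_step \<rho> S y) i S"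
proof -
  have s: "set_pmf (return_pmf y) \<subseteq> V" using y by simp
  have "(\<lambda>n. pmf (state (return_pmf y) S (Suc n)) (Some i)) \<longlonglongrightarrow> hit y i S"
    unfolding hit_def by (rule LIMSEQ_Suc[OF choice_LIMSEQ[OF s i]])
  moreover have "state (return_pmf y) S (Suc n) = state (markov_step \<rho> S y) S n" for n
    unfolding state_shift by (simp add: bind_return_pmf)
  ultimately show ?thesis
    using choice_LIMSEQ[OF step_support[OF y] i] LIMSEQ_unique by (simp only:) blast
qed

lemma hit_mean_step:
  assumes y: "y \<in> V" and i: "i \<in> S" "S \<subseteq> N"
  shows "hit y i S = mean (markov_step \<rho> S y) (\<lambda>z. hit z i S)"
  using hit_step[OF assms] choice_mixture[OF step_support[OF y] i] by simp

lemma state_return_stopped: "i \<in> S \<Longrightarrow> state (return_pmf (Some i)) S n = return_pmf (Some i)"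
  by (induction n) (simp_all add: bind_return_pmf step_stopped)

lemma hit_stopped:
  assumes "i \<in> S"
  shows "hit (Some i) j S = (if j = i then 1 else 0)"
  unfolding hit_def markov_choice_def state_return_stopped[OF assms] by simp

lemma hit_nonneg: "y \<in> V \<Longrightarrow> i \<in> S \<Longrightarrow> S \<subseteq> N \<Longrightarrow> 0 \<le> hit y i S"
  unfolding hit_def by (rule choice_nonneg) auto

text \<open>Stopping in a larger set.\<close>

text \<open>
  The function \<open>y \<mapsto> P\<^sub>y(a, A)\<close> is harmonic for the chain stopped in \<open>A\<close>. Stopping already in \<open>T \<supseteq> A\<close>
  either moves the customer as that chain does or does not move them at all.
\<close>

lemma mean_hit_state:
  assumes lam: "set_pmf lam \<subseteq> V" and a: "a \<in> A" "A \<subseteq> T" "T \<subseteq> N"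
  shows "mean (state lam T n) (\<lambda>y. hit y a A) = choice lam a A"
proof (induction n)
  case 0
  show ?case using choice_mixture[OF lam, of a A] a by simp
next
  case (Suc n)
  have "mean (markov_step \<rho> T y) (\<lambda>z. hit z a A) = hit y a A" if y: "y \<in> V" for y
  proof (cases "\<exists>i\<in>T. y = Some i")
    case True
    then obtain i where "i \<in> T" "y = Some i" by blast
    then show ?thesis using y by (simp add: step_stopped mean_return)
  next
    case False
    then have "markov_step \<rho> T y = markov_step \<rho> A y"
      using a(2) unfolding markov_step_def by (auto split: option.splits)
    then show ?thesis using hit_mean_step[OF y, of a A] a by simp
  qed
  then have "mean (state lam T (Suc n)) (\<lambda>y. hit y a A) = mean (state lam T n) (\<lambda>y. hit y a A)"
    unfolding markov_state.simps mean_bind[OF state_support[OF lam]] by (rule mean_cong)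
  with Suc show ?case by simp
qed

text \<open>
  If \<open>a\<close> is reached by time \<open>n\<close>, then \<open>T\<close> is reached by time \<open>n\<close>: customers who are still outside \<open>T\<close>
  at that time do not contribute.
\<close>

lemma state_le_mean_hit_stopped:
  assumes lam: "set_pmf lam \<subseteq> V" and a: "a \<in> A" "A \<subseteq> T" "T \<subseteq> N"
  shows "pmf (state lam A n) (Some a) \<le>
    mean (state lam T n) (\<lambda>y. if y \<in> Some ` T then hit y a A else 0)"
proof -
  let ?g = "\<lambda>y. if y \<in> Some ` T then hit y a A else 0"
  have AN: "A \<subseteq> N" using a by simp
  have pt: "pmf (state (return_pmf y) A n) (Some a) \<le> mean (state (return_pmf y) T n) ?g"
    if "y \<in> V" for y using that
  proof (induction n arbitrary: y)
    case 0
    then show ?case using a hit_nonneg[of y a A]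
      by (auto simp: mean_return hit_stopped indicator_def)
  next
    case (Suc n)
    show ?case
    proof (cases "y \<in> Some ` T")
      case True
      then have "state (return_pmf y) T (Suc n) = return_pmf y"
        using state_return_stopped by blast
      then have "mean (state (return_pmf y) T (Suc n)) ?g = hit y a A"
        using mean_return[OF Suc.prems, of ?g] True by simp
      moreover have "pmf (state (return_pmf y) A (Suc n)) (Some a) \<le> hit y a A"
        unfolding hit_def using Suc.prems a AN by (intro state_le_choice) auto
      ultimately show ?thesis by simp
    next
      case False
      let ?s = "markov_step \<rho> A y"
      have st: "markov_step \<rho> T y = ?s"
        using False a(2) unfolding markov_step_def by (auto split: option.splits)
      have supp: "set_pmf ?s \<subseteq> V" using step_support[OF Suc.prems] .
      have "pmf (state (return_pmf y) A (Suc n)) (Some a) = pmf (state ?s A n) (Some a)"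
        unfolding state_shift by (simp add: bind_return_pmf)
      also have "\<dots> = mean ?s (\<lambda>z. pmf (state (return_pmf z) A n) (Some a))"
        by (subst state_mixture) (rule pmf_bind_mean[OF supp])
      also have "\<dots> \<le> mean ?s (\<lambda>z. mean (state (return_pmf z) T n) ?g)"
        by (rule mean_mono) (rule Suc.IH)
      also have "\<dots> = mean (state ?s T n) ?g"
        by (subst (2) state_mixture) (rule mean_bind[OF supp, symmetric])
      also have "\<dots> = mean (state (return_pmf y) T (Suc n)) ?g"
        unfolding state_shift st[symmetric] by (simp add: bind_return_pmf)
      finally show ?thesis .
    qed
  qed
  have "pmf (state lam A n) (Some a) = mean lam (\<lambda>z. pmf (state (return_pmf z) A n) (Some a))"
    by (subst state_mixture) (rule pmf_bind_mean[OF lam])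
  also have "\<dots> \<le> mean lam (\<lambda>z. mean (state (return_pmf z) T n) ?g)"
    by (rule mean_mono) (rule pt)
  also have "\<dots> = mean (state lam T n) ?g"
    by (subst (2) state_mixture) (rule mean_bind[OF lam, symmetric])
  finally show ?thesis .
qed

lemma mean_if_Some:
  assumes "T \<subseteq> N"
  shows "mean p (\<lambda>y. if y \<in> Some ` T then g y else 0) = (\<Sum>x\<in>T. pmf p (Some x) * g (Some x))"
proof -
  have "mean p (\<lambda>y. if y \<in> Some ` T then g y else 0) = (\<Sum>y\<in>Some ` T. pmf p y * g y)"
    unfolding mean_def by (rule sum.mono_neutral_cong_right) (use assms finite_V in auto)
  then show ?thesis by (simp add: sum.reindex)
qed

text \<open>
  The expectation of \<open>P\<^sub>y(a, A)\<close> over the position \<open>y\<close> at time \<open>n\<close> in the chain stopped in \<open>T\<close> is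
  \<open>\<phi>(a, A)\<close> for every \<open>n\<close>. By the preceding lemma, the share of the positions inside \<open>T\<close> is
  at least the probability that \<open>a\<close> is reached by time \<open>n\<close>, which tends to \<open>\<phi>(a, A)\<close>. The customers
  who wander outside \<open>T\<close> for ever are disposed of by this squeeze.
\<close>

lemma strong_markov:
  assumes lam: "set_pmf lam \<subseteq> V" and a: "a \<in> A" "A \<subseteq> T" "T \<subseteq> N"
  shows "choice lam a A = (\<Sum>x\<in>T. choice lam x T * hit (Some x) a A)"
proof -
  let ?g = "\<lambda>y. if y \<in> Some ` T then hit y a A else 0"
  let ?F = "\<lambda>n. mean (state lam T n) ?g"
  have AN: "A \<subseteq> N" using a by simp
  have "?F \<longlonglongrightarrow> (\<Sum>x\<in>T. choice lam x T * hit (Some x) a A)"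
    unfolding mean_if_Some[OF a(3)]
    by (intro tendsto_sum tendsto_mult_right choice_LIMSEQ lam) (use a in auto)
  moreover have "?F \<longlonglongrightarrow> choice lam a A"
  proof (rule tendsto_sandwich[OF _ _ choice_LIMSEQ[OF lam a(1) AN] tendsto_const])
    show "\<forall>\<^sub>F n in sequentially. pmf (state lam A n) (Some a) \<le> ?F n"
      using state_le_mean_hit_stopped[OF lam a] by simp
    have "?F n \<le> mean (state lam T n) (\<lambda>y. hit y a A)" for n
      by (rule mean_mono) (use hit_nonneg[OF _ a(1) AN] in auto)
    then show "\<forall>\<^sub>F n in sequentially. ?F n \<le> choice lam a A"
      using mean_hit_state[OF lam a] by simp
  qed
  ultimately show ?thesis using LIMSEQ_unique by blast
qed

end

section \<open>Markov choice models are compatible\<close>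

lemma finite_maximizer:
  fixes g :: "'b \<Rightarrow> real"
  assumes "finite A" "A \<noteq> {}"
  obtains x where "x \<in> A" "\<And>y. y \<in> A \<Longrightarrow> g y \<le> g x"
proof -
  have "Max (g ` A) \<in> g ` A" using assms by (intro Max_in) auto
  then obtain x where "x \<in> A" "g x = Max (g ` A)" by auto
  then show thesis using that assms(1) by (metis Max_ge finite_imageI imageI)
qed

context markov_chain
begin

lemma choice_antimono:
  assumes lam: "set_pmf lam \<subseteq> V" and a: "a \<in> A" "A \<subseteq> T" "T \<subseteq> N"
  shows "choice lam a T \<le> choice lam a A"
proof -
  have fin: "finite T" using a(3) finite_N finite_subset by auto
  have "choice lam a T * hit (Some a) a A \<le> (\<Sum>x\<in>T. choice lam x T * hit (Some x) a A)"
    by (rule member_le_sum)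
      (use a fin in \<open>auto intro!: mult_nonneg_nonneg choice_nonneg[OF lam _ a(3)] hit_nonneg\<close>)
  then show ?thesis using strong_markov[OF lam a] hit_stopped[OF a(1)] by simp
qed

text \<open>
  Used to turn ``\<open>a\<close> is reached from \<open>x\<close>, which is reached'' into a positive choice probability of \<open>a\<close>.
\<close>

lemma choice_pos_via:
  assumes lam: "set_pmf lam \<subseteq> V" and a: "a \<in> A" "A \<subseteq> T" "T \<subseteq> N"
    and x: "x \<in> T" "0 < choice lam x T" "0 < hit (Some x) a A"
  shows "0 < choice lam a A"
proof -
  have fin: "finite T" using a(3) finite_N finite_subset by auto
  have "choice lam x T * hit (Some x) a A \<le> (\<Sum>x\<in>T. choice lam x T * hit (Some x) a A)"
    by (rule member_le_sum)
      (use a x fin in \<open>auto intro!: mult_nonneg_nonneg choice_nonneg[OF lam _ a(3)] hit_nonneg\<close>)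
  moreover have "0 < choice lam x T * hit (Some x) a A" using x by simp
  ultimately show ?thesis using strong_markov[OF lam a] by simp
qed

lemma substitutable_choice:
  assumes "set_pmf lam \<subseteq> V"
  shows "substitutable N (choice lam)"
  unfolding substitutable_def using choice_antimono[OF assms] by blast

lemma choice_model_choice:
  assumes "set_pmf lam \<subseteq> V"
  shows "choice_model N (choice lam)"
  unfolding choice_model_def
  by (intro conjI allI impI ballI finite_N choice_nonneg[OF assms] choice_sum_le_1[OF assms])

text \<open>
  \<open>h\<^sub>A(y)\<close>: the expected revenue from a customer who is at \<open>y\<close> when \<open>A\<close> is offered.
\<close>

definition worth :: "('a \<Rightarrow> real) \<Rightarrow> 'a set \<Rightarrow> 'a option \<Rightarrow> real" where
  "worth r A y = revenue r (hit y) A"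

lemma worth_stopped:
  assumes "x \<in> A" "A \<subseteq> N"
  shows "worth r A (Some x) = r x"
proof -
  have "finite A" using assms(2) finite_N finite_subset by auto
  then show ?thesis unfolding worth_def revenue_def hit_stopped[OF assms(1)]
    using assms(1) by (simp add: if_distrib cong: if_cong)
qed

lemma revenue_strong_markov:
  assumes lam: "set_pmf lam \<subseteq> V" and A: "A \<subseteq> T" "T \<subseteq> N"
  shows "revenue r (choice lam) A = (\<Sum>x\<in>T. choice lam x T * worth r A (Some x))"
proof -
  have "revenue r (choice lam) A = (\<Sum>a\<in>A. \<Sum>x\<in>T. choice lam x T * (r a * hit (Some x) a A))"
    unfolding revenue_def
    by (rule sum.cong) (simp_all add: strong_markov[OF lam _ A] sum_distrib_left algebra_simps)
  also have "\<dots> = (\<Sum>x\<in>T. choice lam x T * worth r A (Some x))"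
    unfolding worth_def revenue_def sum_distrib_left by (rule sum.swap)
  finally show ?thesis .
qed

text \<open>
  A customer who chooses \<open>x \<in> T - A\<close> from \<open>T\<close> pays \<open>r\<^sub>x\<close>; if only \<open>A\<close> is offered, the same customer
  moves on from \<open>x\<close> and is worth \<open>h\<^sub>A(x)\<close>.
\<close>

lemma revenue_diff:
  assumes lam: "set_pmf lam \<subseteq> V" and A: "A \<subseteq> T" "T \<subseteq> N"
  shows "revenue r (choice lam) T - revenue r (choice lam) A
    = (\<Sum>x\<in>T - A. choice lam x T * (r x - worth r A (Some x)))"
proof -
  have fin: "finite T" using A finite_N finite_subset by auto
  have "revenue r (choice lam) T - revenue r (choice lam) A
    = (\<Sum>x\<in>T. choice lam x T * (r x - worth r A (Some x)))"
    unfolding revenue_strong_markov[OF assms] unfolding revenue_def sum_subtractf[symmetric]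
    by (simp add: algebra_simps)
  also have "\<dots> = (\<Sum>x\<in>T - A. choice lam x T * (r x - worth r A (Some x)))"
    by (rule sum.mono_neutral_right) (use fin A worth_stopped[of _ A r] in auto)
  finally show ?thesis .
qed

lemma worth_diff:
  assumes y: "y \<in> V" and A: "A \<subseteq> T" "T \<subseteq> N"
  shows "worth r T y - worth r A y = (\<Sum>x\<in>T - A. hit y x T * (r x - worth r A (Some x)))"
  unfolding worth_def hit_def using revenue_diff[of "return_pmf y" A T r] assms
  by (simp add: worth_def hit_def)

lemma revenue_mixture:
  assumes lam: "set_pmf lam \<subseteq> V" and A: "A \<subseteq> N"
  shows "revenue r (choice lam) A = mean lam (worth r A)"
proof -
  have "revenue r (choice lam) A = (\<Sum>a\<in>A. \<Sum>y\<in>V. pmf lam y * (r a * hit y a A))"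
    unfolding revenue_def
    by (rule sum.cong)
      (simp_all add: choice_mixture[OF lam _ A] mean_def sum_distrib_left algebra_simps
        del: sum.insert)
  also have "\<dots> = mean lam (worth r A)"
    unfolding mean_def worth_def revenue_def sum_distrib_left by (rule sum.swap)
  finally show ?thesis .
qed

lemma worth_step:
  assumes "i \<in> N - A" "A \<subseteq> N"
  shows "worth r A (Some i) = revenue r (choice (\<rho> i)) A"
proof -
  have "markov_step \<rho> A (Some i) = \<rho> i" using assms by (simp add: markov_step_def)
  then show ?thesis unfolding worth_def revenue_def
    using hit_step[of "Some i" _ A] assms by (intro sum.cong) auto
qed

lemma worth_mono_nonneg:
  assumes y: "y \<in> V" and A: "A \<subseteq> T" "T \<subseteq> N"
    and "\<And>x. x \<in> T - A \<Longrightarrow> worth r A (Some x) \<le> r x"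
  shows "worth r A y \<le> worth r T y"
proof -
  have "0 \<le> (\<Sum>x\<in>T - A. hit y x T * (r x - worth r A (Some x)))"
    by (intro sum_nonneg mult_nonneg_nonneg hit_nonneg) (use assms in auto)
  then show ?thesis using worth_diff[OF y A, of r] by simp
qed

lemma worth_antimono:
  assumes y: "y \<in> V" and A: "A \<subseteq> T" "T \<subseteq> N"
    and "\<And>x. x \<in> T - A \<Longrightarrow> r x \<le> worth r A (Some x)"
  shows "worth r T y \<le> worth r A y"
proof -
  have "(\<Sum>x\<in>T - A. hit y x T * (r x - worth r A (Some x))) \<le> 0"
    by (intro sum_nonpos mult_nonneg_nonpos hit_nonneg) (use assms in auto)
  then show ?thesis using worth_diff[OF y A, of r] by simp
qed

text \<open>
  Take a maximizer \<open>S\<close> of the total worth \<open>G\<close> over all starting points. As no product can be added to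
  or removed from \<open>S\<close> with profit, \<open>h\<^sub>S\<close> is nonnegative, is at least the price at every product of \<open>Y\<close>,
  and does not increase on average in a step of the chain. So under any other offer \<open>C\<close> the expected
  worth \<open>h\<^sub>S\<close> of the current state never increases, while the customer pays at most \<open>h\<^sub>S(c)\<close> on
  stopping at \<open>c \<in> C\<close>.
\<close>

lemma ex_uniformly_optimal:
  assumes Y: "Y \<subseteq> N"
  obtains S where "S \<subseteq> Y" "\<And>C y. C \<subseteq> Y \<Longrightarrow> y \<in> V \<Longrightarrow> worth r C y \<le> worth r S y"
proof -
  define G where "G S = (\<Sum>j\<in>N. worth r S (Some j))" for S
  \<comment> \<open>A customer who starts at \<open>x\<close> itself stops there with certainty, so a profitable change at \<open>x\<close>
    is visible in \<open>G\<close>.\<close>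
  have add: "G A < G T" if A: "A \<subseteq> T" "T \<subseteq> N" and x: "x \<in> T - A" "worth r A (Some x) < r x"
    and "\<And>z. z \<in> T - A \<Longrightarrow> worth r A (Some z) \<le> r z" for A T x
    unfolding G_def
  proof (rule sum_strict_mono_ex1[OF finite_N])
    show "\<forall>j\<in>N. worth r A (Some j) \<le> worth r T (Some j)"
      using that by (intro ballI worth_mono_nonneg) auto
    show "\<exists>j\<in>N. worth r A (Some j) < worth r T (Some j)"
      using x A worth_stopped[of x T r] by force
  qed
  have remove: "G T < G A" if A: "A \<subseteq> T" "T \<subseteq> N" and x: "x \<in> T - A" "r x < worth r A (Some x)"
    and "\<And>z. z \<in> T - A \<Longrightarrow> r z \<le> worth r A (Some z)" for A T x
    unfolding G_def
  proof (rule sum_strict_mono_ex1[OF finite_N])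
    show "\<forall>j\<in>N. worth r T (Some j) \<le> worth r A (Some j)"
      using that by (intro ballI worth_antimono) auto
    show "\<exists>j\<in>N. worth r T (Some j) < worth r A (Some j)"
      using x A worth_stopped[of x T r] by force
  qed
  have finY: "finite Y" using Y finite_N finite_subset by auto
  obtain S where S: "S \<in> Pow Y" and mx: "\<And>T. T \<in> Pow Y \<Longrightarrow> G T \<le> G S"
    using finite_maximizer[of "Pow Y" G] finY by auto
  have SY: "S \<subseteq> Y" and SN: "S \<subseteq> N" using S Y by auto
  have price_le: "r x \<le> worth r S (Some x)" if x: "x \<in> Y" for x
  proof (cases "x \<in> S")
    case True
    then show ?thesis using worth_stopped[of x S r] SN by simp
  next
    case False
    then show ?thesis using add[of S "insert x S" x] mx[of "insert x S"] x SY Y by force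
  qed
  have worth_remove: "worth r (S - {s}) (Some s) \<le> r s" if s: "s \<in> S" for s
    using remove[of "S - {s}" S s] mx[of "S - {s}"] s SY SN by force
  have price_nonneg: "0 \<le> r s" if s: "s \<in> S" for s
  proof (rule ccontr)
    assume c: "\<not> ?thesis"
    let ?A = "{s \<in> S. 0 \<le> r s}"
    have nn: "0 \<le> worth r ?A (Some y)" if "y \<in> N" for y
      unfolding worth_def revenue_def
      by (intro sum_nonneg mult_nonneg_nonneg hit_nonneg) (use that SN in auto)
    have less: "r z < worth r ?A (Some z)" if "z \<in> S - ?A" for z
      using nn[of z] that SN by force
    then have "G S < G ?A"
      using s c SN by (intro remove[of ?A S s]) (auto intro: less_imp_le)
    then show False using mx[of ?A] SY by auto
  qed
  have worth_nonneg: "0 \<le> worth r S y" if "y \<in> V" for y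
    unfolding worth_def revenue_def
    by (intro sum_nonneg mult_nonneg_nonneg hit_nonneg) (use that SN price_nonneg in auto)
  \<comment> \<open>At \<open>i \<in> S\<close>, walking on and stopping in \<open>S\<close> is a mixture of the price of \<open>i\<close> (on return to \<open>i\<close>)
    and of what \<open>S - {i}\<close> earns from \<open>i\<close>, which is at most that price.\<close>
  have continue: "revenue r (choice (\<rho> i)) S \<le> worth r S (Some i)" if i: "i \<in> N" for i
  proof (cases "i \<in> S")
    case False
    then show ?thesis using worth_step[of i S r] i SN by simp
  next
    case True
    let ?A = "S - {i}"
    have A: "?A \<subseteq> S" "?A \<subseteq> N" using SN by auto
    have supp: "set_pmf (\<rho> i) \<subseteq> V" using transition_support[OF i] .
    let ?d = "r i - worth r ?A (Some i)"
    have "S - ?A = {i}" using True by auto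
    then have "revenue r (choice (\<rho> i)) S
        = worth r ?A (Some i) + choice (\<rho> i) i S * ?d"
      using revenue_diff[OF supp A(1) SN, of r] worth_step[of i ?A r] i A by simp
    also have "choice (\<rho> i) i S * ?d \<le> ?d"
      using choice_le_1[OF supp True SN] worth_remove[OF True] choice_nonneg[OF supp True SN]
      by (intro mult_left_le_one_le) auto
    finally show ?thesis using worth_stopped[OF True SN, of r] by simp
  qed
  have "worth r C y \<le> worth r S y" if C: "C \<subseteq> Y" and y: "y \<in> V" for C y
  proof -
    have CN: "C \<subseteq> N" using C Y by auto
    have supp: "set_pmf (return_pmf y) \<subseteq> V" using y by simp
    let ?\<mu> = "\<lambda>n. state (return_pmf y) C n"
    have step: "mean (markov_step \<rho> C z) (worth r S) \<le> worth r S z" if z: "z \<in> V" for z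
    proof (cases z)
      case None
      then show ?thesis using mean_return[of None "worth r S"] by (simp add: markov_step_def)
    next
      case (Some i)
      then have i: "i \<in> N" using z by auto
      show ?thesis
      proof (cases "i \<in> C")
        case True
        then show ?thesis using Some z by (simp add: step_stopped mean_return)
      next
        case False
        then have "markov_step \<rho> C z = \<rho> i" using Some by (simp add: markov_step_def)
        then show ?thesis
          using continue[OF i] revenue_mixture[OF transition_support[OF i] SN, of r] Some by simp
      qed
    qed
    have super: "mean (?\<mu> n) (worth r S) \<le> worth r S y" for n
    proof (induction n)
      case 0
      show ?case using mean_return[OF y, of "worth r S"] by simp
    next
      case (Suc n)
      have "mean (?\<mu> (Suc n)) (worth r S) \<le> mean (?\<mu> n) (worth r S)"
        unfolding markov_state.simps mean_bind[OF state_support[OF supp]]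
        by (rule mean_mono) (rule step)
      then show ?case using Suc by simp
    qed
    have "(\<lambda>n. \<Sum>c\<in>C. r c * pmf (?\<mu> n) (Some c)) \<longlonglongrightarrow> worth r C y"
      unfolding worth_def revenue_def hit_def
      by (intro tendsto_sum tendsto_mult_left choice_LIMSEQ supp CN)
    moreover have "(\<Sum>c\<in>C. r c * pmf (?\<mu> n) (Some c)) \<le> worth r S y" for n
    proof -
      have "(\<Sum>c\<in>C. r c * pmf (?\<mu> n) (Some c))
          \<le> (\<Sum>c\<in>C. pmf (?\<mu> n) (Some c) * worth r S (Some c))"
        by (intro sum_mono) (use price_le C in \<open>auto simp: mult.commute intro!: mult_right_mono\<close>)
      also have "\<dots> \<le> mean (?\<mu> n) (worth r S)"
        unfolding mean_if_Some[OF CN, symmetric] by (rule mean_mono) (use worth_nonneg in auto)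
      finally show ?thesis using super[of n] by linarith
    qed
    ultimately show ?thesis by (intro LIMSEQ_le_const2) auto
  qed
  with SY show thesis by (rule that)
qed

lemma ex_ideal:
  assumes lam: "set_pmf lam \<subseteq> V" and Y: "Y \<subseteq> N"
  shows "\<exists>S. optimal_unconstrained r (choice lam) Y S \<and> nonneg_marginals r (choice lam) Y S"
proof -
  obtain S where SY: "S \<subseteq> Y" and opt: "\<And>C y. C \<subseteq> Y \<Longrightarrow> y \<in> V \<Longrightarrow> worth r C y \<le> worth r S y"
    using ex_uniformly_optimal[OF Y, of r] by blast
  have SN: "S \<subseteq> N" using SY Y by auto
  have "optimal_unconstrained r (choice lam) Y S"
    unfolding optimal_unconstrained_def
  proof (intro conjI SY allI impI)
    fix X assume X: "X \<subseteq> Y"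
    then have XN: "X \<subseteq> N" using Y by auto
    show "revenue r (choice lam) X \<le> revenue r (choice lam) S"
      unfolding revenue_mixture[OF lam XN] revenue_mixture[OF lam SN]
      by (rule mean_mono) (rule opt[OF X])
  qed
  moreover have "nonneg_marginals r (choice lam) Y S"
    unfolding nonneg_marginals_def marginal_def
  proof (intro allI impI)
    fix A C assume A: "A \<subseteq> S" and C: "C \<subseteq> Y"
    have T: "C \<subseteq> A \<union> C" "A \<union> C \<subseteq> N" using A C SN Y by auto
    have "0 \<le> (\<Sum>x\<in>A \<union> C - C. choice lam x (A \<union> C) * (r x - worth r C (Some x)))"
    proof (intro sum_nonneg mult_nonneg_nonneg choice_nonneg lam T(2))
      fix x assume "x \<in> A \<union> C - C"
      then have x: "x \<in> S" "x \<in> N" using A SN by auto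
      then show "0 \<le> r x - worth r C (Some x)"
        using opt[OF C, of "Some x"] worth_stopped[OF x(1) SN, of r] by simp
    qed auto
    then show "0 \<le> revenue r (choice lam) (A \<union> C) - revenue r (choice lam) C"
      unfolding revenue_diff[OF lam T] .
  qed
  ultimately show ?thesis by blast
qed

end

lemma revenue_le_best:
  assumes "finite Z" "X \<subseteq> Z"
  shows "revenue r \<phi> X \<le> best_revenue r \<phi> Z"
  unfolding best_revenue_def by (rule Max_ge) (use assms in auto)

lemma best_revenue_attained:
  assumes "finite Z"
  obtains X where "X \<subseteq> Z" "best_revenue r \<phi> Z = revenue r \<phi> X"
proof -
  have "Max (revenue r \<phi> ` Pow Z) \<in> revenue r \<phi> ` Pow Z" using assms by (intro Max_in) auto
  then show thesis using that unfolding best_revenue_def by auto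
qed

lemma best_revenue_eq_revenue:
  assumes "finite D" "D \<subseteq> S" "S \<subseteq> Y" "nonneg_marginals r \<phi> Y S"
  shows "best_revenue r \<phi> D = revenue r \<phi> D"
proof -
  obtain X where X: "X \<subseteq> D" "best_revenue r \<phi> D = revenue r \<phi> X"
    using best_revenue_attained[OF assms(1)] by metis
  have "D \<union> X = D" using X by auto
  moreover have "X \<subseteq> Y" using X(1) assms(2,3) by auto
  then have "revenue r \<phi> X \<le> revenue r \<phi> (D \<union> X)"
    using assms(2,4) unfolding nonneg_marginals_def marginal_def by simp
  ultimately have "revenue r \<phi> X \<le> revenue r \<phi> D" by simp
  then show ?thesis using X(2) revenue_le_best[OF assms(1), of D r \<phi>] by auto
qed

context markov_chain
begin

text \<open>
  The marginal of \<open>{a}\<close> with respect to \<open>B\<close> is \<open>\<phi>(a, B \<union> {a}) * (r\<^sub>a - h\<^sub>B(a))\<close>. That it is nonnegative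
  bounds the price of \<open>a\<close> only if \<open>a\<close> is chosen with positive probability from \<open>B \<union> {a}\<close>, which is why
  the argument has to keep track of positive probabilities.
\<close>

lemma decreasing_marginals_choice:
  assumes lam: "set_pmf lam \<subseteq> V" and Y: "Y \<subseteq> N" and SY: "S \<subseteq> Y"
    and nonneg: "nonneg_marginals r (choice lam) Y S"
  shows "decreasing_marginals (best_revenue r (choice lam)) Y S"
  unfolding decreasing_marginals_def
proof (intro allI impI)
  fix A B C assume A: "A \<subseteq> S" and B: "B \<subseteq> A" and C: "C \<subseteq> Y"
  let ?R = "revenue r (choice lam)" and ?f = "best_revenue r (choice lam)"
  have finY: "finite Y" using Y finite_N finite_subset by auto
  have fin: "finite (C \<union> A)" "finite (C \<union> B)" "finite A" "finite B"
    by (rule finite_subset[OF _ finY], use A B C SY in blast)+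
  have AN: "A \<subseteq> N" "B \<subseteq> N" using A B SY Y by auto
  \<comment> \<open>A smallest set of additions to \<open>A\<close> that attains \<open>f(C \<union> A)\<close>: every proper subset is strictly worse.\<close>
  define X where "X = arg_min card (\<lambda>X. X \<subseteq> C - A \<and> ?R (A \<union> X) = ?f (C \<union> A))"
  have X: "X \<subseteq> C - A" "?R (A \<union> X) = ?f (C \<union> A)"
    and X_min: "\<And>X'. X' \<subset> X \<Longrightarrow> ?R (A \<union> X') < ?R (A \<union> X)"
  proof -
    obtain Z where Z: "Z \<subseteq> C \<union> A" "?f (C \<union> A) = ?R Z"
      using best_revenue_attained[OF fin(1)] by metis
    have "?R Z \<le> ?R (A \<union> Z)"
    proof -
      have "Z \<subseteq> Y" using Z(1) A C SY by auto
      then show ?thesis using nonneg A unfolding nonneg_marginals_def marginal_def by simp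
    qed
    moreover have "A \<union> Z \<subseteq> C \<union> A" using Z by auto
    ultimately have "?R (A \<union> Z) = ?f (C \<union> A)"
      using revenue_le_best[OF fin(1), of "A \<union> Z" r "choice lam"] Z(2) by simp
    then have ex: "Z - A \<subseteq> C - A \<and> ?R (A \<union> (Z - A)) = ?f (C \<union> A)" using Z(1) by auto
    have *: "X \<subseteq> C - A \<and> ?R (A \<union> X) = ?f (C \<union> A)"
      unfolding X_def by (rule arg_min_natI) (rule ex)
    then show "X \<subseteq> C - A" "?R (A \<union> X) = ?f (C \<union> A)" by auto
    fix X' assume X': "X' \<subset> X"
    have finX: "finite X" using * fin(1) finite_subset by blast
    have "\<not> ?R (A \<union> X') = ?f (C \<union> A)"
    proof
      assume "?R (A \<union> X') = ?f (C \<union> A)"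
      then have "card X \<le> card X'"
        unfolding X_def using * X' by (intro arg_min_nat_le) auto
      then show False using psubset_card_mono[OF finX X'] by simp
    qed
    moreover have "?R (A \<union> X') \<le> ?f (C \<union> A)"
      by (rule revenue_le_best[OF fin(1)]) (use X' * in auto)
    ultimately show "?R (A \<union> X') < ?R (A \<union> X)" using * by simp
  qed
  have AX: "A \<union> X \<subseteq> N" and BX: "B \<union> X \<subseteq> N" using X(1) AN C Y by auto
  \<comment> \<open>Otherwise let \<open>D\<close> be the set of all products of \<open>X\<close> that are cheaper than their worth under \<open>A\<close>.
    The products of \<open>X - D\<close> only raise that worth, so \<open>D\<close> could be removed without loss.\<close>
  have price_ge: "worth r A (Some x) \<le> r x" if "x \<in> X" for x
  proof (rule ccontr)
    assume c: "\<not> ?thesis"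
    define D where "D = {x \<in> X. r x < worth r A (Some x)}"
    let ?E = "A \<union> (X - D)"
    have E: "?E \<subseteq> A \<union> X" by auto
    have "A \<union> X - ?E = D" using X(1) unfolding D_def by auto
    then have "?R (A \<union> X) - ?R ?E = (\<Sum>x\<in>D. choice lam x (A \<union> X) * (r x - worth r ?E (Some x)))"
      using revenue_diff[OF lam E AX, of r] by simp
    also have "\<dots> \<le> 0"
    proof (intro sum_nonpos mult_nonneg_nonpos choice_nonneg lam AX)
      fix x assume x: "x \<in> D"
      then have "Some x \<in> V" using AX unfolding D_def by auto
      then have "worth r A (Some x) \<le> worth r ?E (Some x)"
        by (rule worth_mono_nonneg) (use AX in \<open>auto simp: D_def\<close>)
      then show "r x - worth r ?E (Some x) \<le> 0" using x unfolding D_def by simp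
    qed (auto simp: D_def)
    finally have "?R (A \<union> X) \<le> ?R ?E" by simp
    moreover have "x \<in> D" using that c unfolding D_def by auto
    then have "X - D \<subset> X" using that by auto
    ultimately show False using X_min[of "X - D"] by linarith
  qed
  have pos: "0 < choice lam x (A \<union> X)" if x: "x \<in> X" for x
  proof (rule ccontr)
    assume "\<not> ?thesis"
    then have 0: "choice lam x (A \<union> X) = 0" using choice_nonneg[OF lam _ AX, of x] x by force
    let ?E = "A \<union> (X - {x})"
    have E: "?E \<subseteq> A \<union> X" by auto
    have "A \<union> X - ?E = {x}" using X(1) x by auto
    then have "?R (A \<union> X) - ?R ?E = 0" using revenue_diff[OF lam E AX, of r] 0 by simp
    then show False using X_min[of "X - {x}"] x by auto
  qed
  \<comment> \<open>If \<open>a \<in> A - B\<close> is reached from \<open>x\<close>, it is chosen with positive probability from \<open>A\<close>, hence from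
    \<open>B \<union> {a}\<close>, and the nonnegative marginal of \<open>{a}\<close> with respect to \<open>B\<close> bounds its price from below.\<close>
  have worth_le: "worth r B (Some x) \<le> worth r A (Some x)" if x: "x \<in> X" for x
  proof -
    have xV: "Some x \<in> V" using x AX by auto
    have "0 \<le> (\<Sum>a\<in>A - B. hit (Some x) a A * (r a - worth r B (Some a)))"
    proof (rule sum_nonneg)
      fix a assume a: "a \<in> A - B"
      show "0 \<le> hit (Some x) a A * (r a - worth r B (Some a))"
      proof (cases "hit (Some x) a A = 0")
        case False
        then have "0 < hit (Some x) a A" using hit_nonneg[OF xV, of a A] a AN by force
        then have "0 < choice lam a A"
          using choice_pos_via[OF lam _ _ AX, of a A x] pos[OF x] x a by auto
        moreover have aB: "insert a B \<subseteq> A" "insert a B \<subseteq> N" using a B AN by auto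
        ultimately have "0 < choice lam a (insert a B)"
          using choice_antimono[OF lam _ aB(1) AN(1), of a] by simp
        moreover have "0 \<le> choice lam a (insert a B) * (r a - worth r B (Some a))"
        proof -
          have "insert a B - B = {a}" using a by auto
          moreover have "B \<subseteq> insert a B" by auto
          moreover have "0 \<le> ?R ({a} \<union> B) - ?R B"
          proof -
            have "{a} \<subseteq> S" "B \<subseteq> Y" using a A B SY by auto
            then have "0 \<le> marginal ?R {a} B" using nonneg unfolding nonneg_marginals_def by blast
            then show ?thesis by (simp add: marginal_def)
          qed
          ultimately show ?thesis using revenue_diff[OF lam _ aB(2), of B r] by simp
        qed
        ultimately have "0 \<le> r a - worth r B (Some a)" by (simp add: zero_le_mult_iff)
        then show ?thesis using \<open>0 < hit (Some x) a A\<close> by simp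
      qed simp
    qed
    then show ?thesis using worth_diff[OF xV B AN(1), of r] by simp
  qed
  have "A \<union> X - A = X" "B \<union> X - B = X" using X(1) B by auto
  then have diff: "?R (A \<union> X) - ?R A = (\<Sum>x\<in>X. choice lam x (A \<union> X) * (r x - worth r A (Some x)))"
      "?R (B \<union> X) - ?R B = (\<Sum>x\<in>X. choice lam x (B \<union> X) * (r x - worth r B (Some x)))"
    using revenue_diff[OF lam _ AX, of A r] revenue_diff[OF lam _ BX, of B r] by auto
  have "?R (A \<union> X) - ?R A \<le> ?R (B \<union> X) - ?R B"
    unfolding diff
  proof (rule sum_mono, rule mult_mono)
    fix x assume x: "x \<in> X"
    show "choice lam x (A \<union> X) \<le> choice lam x (B \<union> X)"
      by (rule choice_antimono[OF lam _ _ AX]) (use x B in auto)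
    show "r x - worth r A (Some x) \<le> r x - worth r B (Some x)" using worth_le[OF x] by simp
    show "0 \<le> choice lam x (B \<union> X)" by (rule choice_nonneg[OF lam _ BX]) (use x in auto)
    show "0 \<le> r x - worth r A (Some x)" using price_ge[OF x] by simp
  qed
  moreover have "?R (B \<union> X) \<le> ?f (C \<union> B)"
    by (rule revenue_le_best[OF fin(2)]) (use X(1) in auto)
  moreover have "?f A = ?R A" "?f B = ?R B"
    using A B fin SY nonneg by (auto intro!: best_revenue_eq_revenue[of _ S Y])
  ultimately show "marginal ?f C A \<le> marginal ?f C B"
    using X(2) unfolding marginal_def by simp
qed

end

theorem markov_compatible:
  assumes "finite N" "markov_parameters N lam \<rho>"
  shows "compatible N r (markov_choice lam \<rho>)"
proof -
  interpret markov_chain N \<rho>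
    using assms by unfold_locales (auto simp: markov_parameters_def)
  have lam: "set_pmf lam \<subseteq> V" using assms(2) by (simp add: markov_parameters_def)
  show ?thesis unfolding compatible_def
  proof (intro conjI allI impI choice_model_choice substitutable_choice ex_ideal lam)
    fix Y S
    assume "Y \<subseteq> N" and "optimal_unconstrained r (choice lam) Y S \<and> nonneg_marginals r (choice lam) Y S"
    then show "decreasing_marginals (best_revenue r (choice lam)) Y S"
      using decreasing_marginals_choice[OF lam] by (simp add: optimal_unconstrained_def)
  qed
qed

section \<open>Results and costs of timed computations\<close>

lemma result_bind [simp]: "result (bind_timed m k) = result (k (result m))"
  by (simp add: bind_timed_def)

lemma cost_bind [simp]: "cost (bind_timed m k) = cost m + cost (k (result m))"
  by (simp add: bind_timed_def)

lemma result_ret [simp]: "result (ret x) = x" and cost_ret [simp]: "cost (ret x) = 0"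
  by (simp_all add: ret_def)

lemma cost_charge [simp]: "cost (charge c) = c"
  by (simp add: charge_def)

lemma cost_set_ops [simp]: "cost (set_ops I) = card (products I) + 1"
  by (simp add: set_ops_def)

lemma result_query_f [simp]: "result (query_f I X) = f_oracle I X"
  and cost_query_f [simp]: "cost (query_f I X) = f_time I X"
  by (simp_all add: query_f_def)

lemma result_query_U [simp]: "result (query_U I X) = U_oracle I X"
  and cost_query_U [simp]: "cost (query_U I X) = U_time I X"
  by (simp_all add: query_U_def)

lemma result_query_marginal [simp]:
  "result (query_marginal I j S) = f_oracle I (insert j S) - f_oracle I S"
  by (simp add: query_marginal_def)

lemma cost_query_marginal [simp]:
  "cost (query_marginal I j S) = f_time I (insert j S) + f_time I S + (card (products I) + 1)"
  by (simp add: query_marginal_def)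

lemma result_fold_timed: "result (fold_timed g xs s) = fold (\<lambda>x s. result (g x s)) xs s"
  by (induction xs arbitrary: s) simp_all

lemma cost_map_timed: "cost (map_timed g xs) = (\<Sum>x\<leftarrow>xs. cost (g x))"
  by (induction xs) simp_all

section \<open>Ideal assortments\<close>

definition ideal :: "('a \<Rightarrow> real) \<Rightarrow> ('a \<Rightarrow> 'a set \<Rightarrow> real) \<Rightarrow> 'a set \<Rightarrow> 'a set \<Rightarrow> bool" where
  "ideal r \<phi> Y S \<longleftrightarrow> optimal_unconstrained r \<phi> Y S \<and> nonneg_marginals r \<phi> Y S"

lemma ideal_subset: "ideal r \<phi> Y S \<Longrightarrow> S \<subseteq> Y"
  by (simp add: ideal_def optimal_unconstrained_def)

text \<open>
  The products of \<open>M\<close> keep their nonnegative marginals in the smaller ground set, so adding them to an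
  optimal assortment does not lose revenue. This keeps the lists of the framework ideal although the
  oracle need not return the kept products again.
\<close>

lemma ideal_Un:
  assumes S: "ideal r \<phi> W S" and W': "W' \<subseteq> W" and M: "M \<subseteq> S" "M \<subseteq> W'" and U: "ideal r \<phi> W' U"
  shows "ideal r \<phi> W' (U \<union> M)"
proof -
  have gain: "revenue r \<phi> C \<le> revenue r \<phi> (A \<union> C)" if "A \<subseteq> M" "C \<subseteq> W'" for A C
  proof -
    have "A \<subseteq> S" "C \<subseteq> W" using that M W' by auto
    then have "0 \<le> marginal (revenue r \<phi>) A C"
      using S unfolding ideal_def nonneg_marginals_def by blast
    then show ?thesis by (simp add: marginal_def)
  qed
  have UW: "U \<subseteq> W'" and opt: "\<And>X. X \<subseteq> W' \<Longrightarrow> revenue r \<phi> X \<le> revenue r \<phi> U"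
    using U unfolding ideal_def optimal_unconstrained_def by auto
  have "revenue r \<phi> X \<le> revenue r \<phi> (U \<union> M)" if "X \<subseteq> W'" for X
    using opt[OF that] gain[of M U] UW by (simp add: Un_commute)
  moreover have "0 \<le> marginal (revenue r \<phi>) A C" if A: "A \<subseteq> U \<union> M" and C: "C \<subseteq> W'" for A C
  proof -
    have "0 \<le> marginal (revenue r \<phi>) (A \<inter> U) C"
      using U C unfolding ideal_def nonneg_marginals_def by blast
    moreover have "(A \<inter> U) \<union> C \<subseteq> W'" using UW C by auto
    then have "revenue r \<phi> ((A \<inter> U) \<union> C) \<le> revenue r \<phi> ((A - U) \<union> ((A \<inter> U) \<union> C))"
      using A by (intro gain) auto
    moreover have "(A - U) \<union> ((A \<inter> U) \<union> C) = A \<union> C" by auto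
    ultimately show ?thesis by (simp add: marginal_def)
  qed
  ultimately show ?thesis
    using UW M(2) unfolding ideal_def optimal_unconstrained_def nonneg_marginals_def by blast
qed

locale assortment_problem =
  fixes N :: "'a set" and r \<phi> and I :: "'a input"
  assumes compat: "compatible N r \<phi>" and input: "assortment_input N r \<phi> I"
begin

abbreviation f :: "'a set \<Rightarrow> real" where "f \<equiv> best_revenue r \<phi>"

lemma finite_N: "finite N"
  using compat by (simp add: compatible_def choice_model_def)

lemma finite_sub: "X \<subseteq> N \<Longrightarrow> finite X"
  using finite_N finite_subset by auto

lemma products_eq [simp]: "products I = N"
  using input by (simp add: assortment_input_def)

lemma f_oracle_eq: "X \<subseteq> N \<Longrightarrow> f_oracle I X = f X"
  using input by (simp add: assortment_input_def)

lemma ideal_U: "Y \<subseteq> N \<Longrightarrow> ideal r \<phi> Y (U_oracle I Y)"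
  using input by (simp add: assortment_input_def ideal_def)

lemma set_arrange: "finite X \<Longrightarrow> set (arrange I X) = X"
  and distinct_arrange: "finite X \<Longrightarrow> distinct (arrange I X)"
  using input by (simp_all add: assortment_input_def)

lemma pick_in: "finite X \<Longrightarrow> X \<noteq> {} \<Longrightarrow> pick I X \<in> X"
  using input by (simp add: assortment_input_def)

lemma length_arrange: "finite X \<Longrightarrow> length (arrange I X) = card X"
  using set_arrange distinct_arrange by (metis distinct_card)

lemma length_le_card: "distinct xs \<Longrightarrow> set xs \<subseteq> N \<Longrightarrow> length xs \<le> card N"
  using card_mono[OF finite_N] distinct_card by metis

lemma f_empty [simp]: "f {} = 0"
  by (simp add: best_revenue_def revenue_def)

lemma f_mono:
  assumes "X \<subseteq> Y" "Y \<subseteq> N"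
  shows "f X \<le> f Y"
proof -
  obtain Z where Z: "Z \<subseteq> X" "f X = revenue r \<phi> Z"
    using best_revenue_attained[of X r \<phi>] finite_sub assms by auto
  have "revenue r \<phi> Z \<le> f Y" by (intro revenue_le_best finite_sub assms) (use Z assms in auto)
  then show ?thesis using Z(2) by simp
qed

lemma f_nonneg: "X \<subseteq> N \<Longrightarrow> 0 \<le> f X"
  using f_mono[of "{}" X] by simp

lemma choice_antimono:
  assumes "i \<in> X" "X \<subseteq> Y" "Y \<subseteq> N"
  shows "\<phi> i Y \<le> \<phi> i X"
proof -
  have "\<phi> i (X \<union> D) \<le> \<phi> i X" if "finite D" "D \<subseteq> N - X" for D
    using that
  proof (induction D rule: finite_induct)
    case (insert x F)
    have *: "X \<union> F \<subseteq> N" "i \<in> X \<union> F" "x \<in> N - (X \<union> F)" using insert assms by auto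
    then have "\<phi> i (insert x (X \<union> F)) \<le> \<phi> i (X \<union> F)"
      using compat unfolding compatible_def substitutable_def by blast
    then show ?case using insert.IH insert.prems by simp
  qed simp
  from this[of "Y - X"] have "\<phi> i (X \<union> (Y - X)) \<le> \<phi> i X" using assms finite_sub by auto
  moreover have "X \<union> (Y - X) = Y" using assms by auto
  ultimately show ?thesis by simp
qed

text \<open>
  Split an optimal subset of \<open>A \<union> B\<close> into its part in \<open>A\<close> and the rest and drop the products of
  negative price: the others are chosen at least as often from each part alone.
\<close>

lemma f_subadditive:
  assumes A: "A \<subseteq> N" and B: "B \<subseteq> N"
  shows "f (A \<union> B) \<le> f A + f B"
proof -
  obtain X where X: "X \<subseteq> A \<union> B" "f (A \<union> B) = revenue r \<phi> X"
    using best_revenue_attained[of "A \<union> B" r \<phi>] finite_sub A B by auto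
  have XN: "X \<subseteq> N" using X(1) A B by auto
  then have finX: "finite X" by (rule finite_sub)
  have nn: "0 \<le> \<phi> i Z" if "i \<in> Z" "Z \<subseteq> N" for i Z
    using compat that by (simp add: compatible_def choice_model_def)
  let ?A = "{x \<in> X \<inter> A. 0 \<le> r x}" and ?B = "{x \<in> X - A. 0 \<le> r x}"
  have part: "(\<Sum>i\<in>Z. r i * \<phi> i X) \<le> revenue r \<phi> {x \<in> Z. 0 \<le> r x}" if Z: "Z \<subseteq> X" for Z
  proof -
    have finZ: "finite Z" using Z finX finite_subset by auto
    have "(\<Sum>i\<in>Z. r i * \<phi> i X) \<le> (\<Sum>i\<in>Z. if 0 \<le> r i then r i * \<phi> i X else 0)"
      by (rule sum_mono) (use Z nn[OF _ XN] in \<open>auto simp: mult_le_0_iff\<close>)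
    also have "\<dots> = (\<Sum>i\<in>{x \<in> Z. 0 \<le> r x}. r i * \<phi> i X)"
      by (simp add: sum.inter_filter finZ)
    also have "\<dots> \<le> revenue r \<phi> {x \<in> Z. 0 \<le> r x}"
      unfolding revenue_def
      by (intro sum_mono mult_left_mono choice_antimono) (use Z XN in auto)
    finally show ?thesis .
  qed
  have "X = (X \<inter> A) \<union> (X - A)" by auto
  then have "revenue r \<phi> X = (\<Sum>i\<in>X \<inter> A. r i * \<phi> i X) + (\<Sum>i\<in>X - A. r i * \<phi> i X)"
    unfolding revenue_def using finX by (metis sum.Int_Diff)
  also have "\<dots> \<le> revenue r \<phi> ?A + revenue r \<phi> ?B"
    by (intro add_mono part) auto
  also have "\<dots> \<le> f A + f B"
    by (intro add_mono revenue_le_best finite_sub A B) (use X(1) in auto)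
  finally show ?thesis using X(2) by simp
qed

lemma f_le_sum:
  assumes "X \<subseteq> N" "\<And>e. e \<in> X \<Longrightarrow> f {e} \<le> v"
  shows "f X \<le> real (card X) * v"
proof -
  have "finite X" using assms(1) finite_sub by auto
  then show ?thesis using assms
  proof (induction X rule: finite_induct)
    case (insert x F)
    have "f (insert x F) \<le> f {x} + f F" using f_subadditive[of "{x}" F] insert.prems by auto
    also have "\<dots> \<le> v + real (card F) * v" using insert by (intro add_mono) auto
    finally show ?case using insert.hyps by (simp add: algebra_simps)
  qed simp
qed

lemma ideal_decreasing:
  assumes "ideal r \<phi> Y S" "Y \<subseteq> N" "B \<subseteq> A" "A \<subseteq> S" "C \<subseteq> Y"
  shows "f (C \<union> A) - f A \<le> f (C \<union> B) - f B"
proof -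
  have "decreasing_marginals f Y S"
    using assms(1,2) compat unfolding compatible_def ideal_def by blast
  then show ?thesis using assms unfolding decreasing_marginals_def marginal_def by blast
qed

lemma ideal_value:
  assumes S: "ideal r \<phi> Y S" and "Y \<subseteq> N"
  shows "f S = f Y"
proof (rule antisym)
  show "f S \<le> f Y" using ideal_subset[OF S] assms(2) by (rule f_mono)
  obtain X where X: "X \<subseteq> Y" "f Y = revenue r \<phi> X"
    using best_revenue_attained[of Y r \<phi>] finite_sub assms(2) by auto
  have "revenue r \<phi> X \<le> revenue r \<phi> S"
    using S X(1) unfolding ideal_def optimal_unconstrained_def by simp
  also have "\<dots> \<le> f S" using revenue_le_best[of S S] finite_sub ideal_subset[OF S] assms(2) by auto
  finally show "f Y \<le> f S" using X(2) by simp
qed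

end

section \<open>The rounds of the framework as a single pass\<close>

text \<open>
  The start of the loop and at most \<open>n\<close> rounds, if a run costs at most \<open>c\<close> and a call of the oracle
  for unconstrained optima at most \<open>u\<close>.
\<close>

definition loop_cost :: "nat \<Rightarrow> nat \<Rightarrow> nat \<Rightarrow> nat" where
  "loop_cost n c u = (u + n + 1) + n * (2 * (n + 1) + c + u)"

text \<open>
  Abstract form of a run: the products are read one by one, and a product that does not enter
  \<open>S \<union> R\<close> leaves the state as it was. Nothing ever leaves \<open>S \<union> R\<close>.
\<close>

locale sieve = assortment_problem N r \<phi> I
  for N :: "'a set" and r \<phi> and I :: "'a input" +
  fixes step :: "'a \<Rightarrow> 's \<Rightarrow> 's" and init :: 's and inv :: "'s \<Rightarrow> bool"
    and sets :: "'s \<Rightarrow> 'a set \<times> 'a set" and rn :: "'a list \<Rightarrow> ('a set \<times> 'a set) timed"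
  assumes run_result: "result (rn xs) = sets (fold step xs init)"
    and sets_init: "sets init = ({}, {})"
    and inv_init: "inv init"
    and step_cases: "inv s \<Longrightarrow> j \<in> N \<Longrightarrow> j \<notin> fst (sets s) \<union> snd (sets s) \<Longrightarrow>
      inv (step j s) \<and> (step j s = s \<or>
        fst (sets (step j s)) \<union> snd (sets (step j s)) = insert j (fst (sets s) \<union> snd (sets s)))"
begin

definition state_after :: "'a list \<Rightarrow> 's" where
  "state_after xs = fold step xs init"

definition kept :: "'a list \<Rightarrow> 'a set" where
  "kept xs = fst (sets (state_after xs)) \<union> snd (sets (state_after xs))"

lemma state_after_Nil [simp]: "state_after [] = init"
  by (simp add: state_after_def)

lemma state_after_snoc [simp]: "state_after (xs @ [j]) = step j (state_after xs)"
  by (simp add: state_after_def)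

lemma kept_Nil [simp]: "kept [] = {}"
  by (simp add: kept_def sets_init)

lemma inv_kept:
  assumes "distinct xs" "set xs \<subseteq> N"
  shows "inv (state_after xs) \<and> kept xs \<subseteq> set xs"
  using assms
proof (induction xs rule: rev_induct)
  case Nil
  then show ?case by (simp add: inv_init)
next
  case (snoc j xs)
  then have IH: "inv (state_after xs)" "kept xs \<subseteq> set xs" by auto
  then have "j \<notin> fst (sets (state_after xs)) \<union> snd (sets (state_after xs))"
    using snoc.prems unfolding kept_def by auto
  from step_cases[OF IH(1) _ this] show ?case
    using snoc.prems IH(2) unfolding kept_def by auto
qed

lemma kept_snoc_cases:
  assumes "distinct (xs @ [j])" "set (xs @ [j]) \<subseteq> N"
  obtains "step j (state_after xs) = state_after xs" "kept (xs @ [j]) = kept xs" "j \<notin> kept (xs @ [j])"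
  | "kept (xs @ [j]) = insert j (kept xs)"
proof -
  have IH: "inv (state_after xs)" "kept xs \<subseteq> set xs" using inv_kept[of xs] assms by auto
  then have j: "j \<notin> fst (sets (state_after xs)) \<union> snd (sets (state_after xs))"
    using assms unfolding kept_def by auto
  have "step j (state_after xs) = state_after xs \<and> kept (xs @ [j]) = kept xs \<and> j \<notin> kept (xs @ [j])
      \<or> kept (xs @ [j]) = insert j (kept xs)"
    using step_cases[OF IH(1) _ j] assms j unfolding kept_def by auto
  then show thesis using that by blast
qed

lemma kept_append:
  assumes "distinct (xs @ ys)" "set (xs @ ys) \<subseteq> N"
  shows "kept xs \<subseteq> kept (xs @ ys) \<and> kept (xs @ ys) \<subseteq> kept xs \<union> set ys"
  using assms
proof (induction ys rule: rev_induct)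
  case (snoc j ys)
  then have IH: "kept xs \<subseteq> kept (xs @ ys)" "kept (xs @ ys) \<subseteq> kept xs \<union> set ys" by auto
  from snoc.prems have "distinct ((xs @ ys) @ [j])" "set ((xs @ ys) @ [j]) \<subseteq> N" by auto
  then show ?case by (cases rule: kept_snoc_cases) (use IH in auto)
qed simp

lemma kept_append_Int:
  assumes "distinct (xs @ ys)" "set (xs @ ys) \<subseteq> N"
  shows "kept (xs @ ys) \<inter> set xs = kept xs"
proof -
  have "kept xs \<subseteq> set xs" using inv_kept[of xs] assms by auto
  then show ?thesis using kept_append[OF assms] assms(1) by auto
qed

text \<open>
  A run over the kept products alone makes the same decisions. For this reason the framework can
  discard the other products and run the algorithm again from the start.
\<close>

lemma state_after_filter:
  assumes "distinct xs" "set xs \<subseteq> N"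
  shows "state_after (filter (\<lambda>j. j \<in> kept xs) xs) = state_after xs"
  using assms
proof (induction xs rule: rev_induct)
  case (snoc j xs)
  then have IH: "state_after (filter (\<lambda>j. j \<in> kept xs) xs) = state_after xs" by auto
  from snoc.prems show ?case
  proof (cases rule: kept_snoc_cases)
    case 1
    then show ?thesis using IH by simp
  next
    case 2
    have "filter (\<lambda>i. i \<in> insert j (kept xs)) xs = filter (\<lambda>i. i \<in> kept xs) xs"
      by (rule filter_cong) (use snoc.prems in auto)
    then show ?thesis using 2 IH by simp
  qed
qed simp

lemma state_after_append: "state_after (xs @ ys) = fold step ys (state_after xs)"
  by (simp add: state_after_def)

text \<open>
  When \<open>j\<close> is read, marginals decrease on the subsets of what is kept together with \<open>j\<close>, with
  respect to everything that has not been read before or is kept. The subsets that contain \<open>j\<close> are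
  included even if \<open>j\<close> is then rejected; the upper bound on the optimum needs them.
\<close>

definition decreasing_along :: "'a list \<Rightarrow> bool" where
  "decreasing_along \<pi> \<longleftrightarrow> (\<forall>p j q A B C. \<pi> = p @ j # q \<longrightarrow> B \<subseteq> A \<longrightarrow> A \<subseteq> insert j (kept p) \<longrightarrow>
     C \<subseteq> (N - set p) \<union> kept p \<longrightarrow> f (C \<union> A) - f A \<le> f (C \<union> B) - f B)"

text \<open>
  The list of all products read in the course of the loop; by the last condition, the products that
  were never read cannot improve on the kept ones.
\<close>

definition complete_pass :: "'a list \<Rightarrow> bool" where
  "complete_pass \<pi> \<longleftrightarrow> distinct \<pi> \<and> set \<pi> \<subseteq> N \<and> decreasing_along \<pi> \<and>
     f ((N - set \<pi>) \<union> kept \<pi>) = f (kept \<pi>)"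

definition gain :: "'a list \<Rightarrow> 'a \<Rightarrow> real" where
  "gain \<pi> j = (let Q = kept (takeWhile (\<lambda>i. i \<noteq> j) \<pi>) in f (insert j Q) - f Q)"

lemma gain_split:
  assumes "distinct (p @ j # q)"
  shows "gain (p @ j # q) j = f (insert j (kept p)) - f (kept p)"
proof -
  have "takeWhile (\<lambda>i. i \<noteq> j) (p @ j # q) = p @ takeWhile (\<lambda>i. i \<noteq> j) (j # q)"
    by (rule takeWhile_append2) (use assms in auto)
  then show ?thesis by (simp add: gain_def Let_def)
qed

lemma prefix_induct [consumes 2, case_names Nil snoc]:
  assumes "complete_pass \<pi>" and "\<exists>q. \<pi> = p @ q"
    and Nil: "P []"
    and snoc: "\<And>p j q. \<pi> = p @ j # q \<Longrightarrow> distinct (p @ [j]) \<Longrightarrow> set (p @ [j]) \<subseteq> N \<Longrightarrow>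
      P p \<Longrightarrow> P (p @ [j])"
  shows "P p"
  using assms(2)
proof (induction p rule: rev_induct)
  case (snoc j p)
  then obtain q where \<pi>: "\<pi> = p @ j # q" by auto
  have "distinct (p @ [j])" "set (p @ [j]) \<subseteq> N"
    using assms(1) unfolding \<pi> complete_pass_def by auto
  then show ?case using assms(4)[OF \<pi>] snoc.IH \<pi> by blast
qed (rule Nil)

text \<open>
  Add the products of \<open>T\<close> in the order in which they were read. Each of them is then added to a
  subset of what was kept when it was read, where its marginal value is at least its gain.
\<close>

lemma sum_gain_le:
  assumes \<pi>: "complete_pass \<pi>" and T: "T \<subseteq> kept \<pi>"
  shows "sum (gain \<pi>) T \<le> f T"
proof -
  have dist: "distinct \<pi>" and sub: "set \<pi> \<subseteq> N" and dec: "decreasing_along \<pi>"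
    using \<pi> by (auto simp: complete_pass_def)
  have "sum (gain \<pi>) (T \<inter> set p) \<le> f (T \<inter> set p)" if "\<exists>q. \<pi> = p @ q" for p
    using \<pi> that
  proof (induction rule: prefix_induct)
    case (snoc p j q)
    let ?T = "T \<inter> set p"
    show ?case
    proof (cases "j \<in> T")
      case True
      have "T \<inter> set p \<subseteq> kept p"
        using T kept_append_Int[of p "j # q"] dist sub snoc(1) by auto
      then have "f ({j} \<union> kept p) - f (kept p) \<le> f ({j} \<union> ?T) - f ?T"
        using dec[unfolded decreasing_along_def, rule_format, OF snoc(1), of ?T "kept p" "{j}"]
          snoc(2,3) by auto
      moreover have "gain \<pi> j = f (insert j (kept p)) - f (kept p)"
        using gain_split[of p j q] dist snoc(1) by simp
      moreover have "T \<inter> set (p @ [j]) = insert j ?T" using True by auto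
      moreover have "j \<notin> ?T" using snoc(2) by auto
      ultimately show ?thesis using snoc(4) by simp
    next
      case False
      then have "T \<inter> set (p @ [j]) = ?T" by auto
      then show ?thesis using snoc(4) by simp
    qed
  qed simp
  from this[of \<pi>] have "sum (gain \<pi>) (T \<inter> set \<pi>) \<le> f (T \<inter> set \<pi>)" by simp
  moreover have "T \<inter> set \<pi> = T" using T inv_kept[OF dist sub] by auto
  ultimately show ?thesis by simp
qed

lemma sum_gain_kept:
  assumes \<pi>: "complete_pass \<pi>"
  shows "f (kept \<pi>) = sum (gain \<pi>) (kept \<pi>)"
proof -
  have "f (kept p) = sum (gain \<pi>) (kept p)" if "\<exists>q. \<pi> = p @ q" for p
    using \<pi> that
  proof (induction rule: prefix_induct)
    case (snoc p j q)
    have dist: "distinct \<pi>" using \<pi> by (auto simp: complete_pass_def)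
    have kp: "kept p \<subseteq> set p" using inv_kept[of p] snoc(2,3) by auto
    from snoc(2,3) show ?case
    proof (cases rule: kept_snoc_cases)
      case 1
      then show ?thesis using snoc(4) by simp
    next
      case 2
      moreover have "gain \<pi> j = f (insert j (kept p)) - f (kept p)"
        using gain_split[of p j q] dist snoc(1) by simp
      moreover have "j \<notin> kept p" "finite (kept p)" using kp snoc(2) finite_subset by auto
      ultimately show ?thesis using snoc(4) by simp
    qed
  qed simp
  then show ?thesis by simp
qed

text \<open>
  Follow the value of what is kept so far together with all unread products of \<open>X\<close> and all unread
  products that will be kept. It starts above \<open>f(X)\<close>, it changes only when a product of \<open>X\<close> is
  rejected, and then it drops by at most the gain of that product.
\<close>

lemma f_le_kept_plus_gain:
  assumes \<pi>: "complete_pass \<pi>" and X: "X \<subseteq> N"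
  shows "f X \<le> f (kept \<pi>) + sum (gain \<pi>) (X \<inter> set \<pi> - kept \<pi>)"
proof -
  have dist: "distinct \<pi>" and sub: "set \<pi> \<subseteq> N" and dec: "decreasing_along \<pi>"
    and fin: "f ((N - set \<pi>) \<union> kept \<pi>) = f (kept \<pi>)"
    using \<pi> by (auto simp: complete_pass_def)
  let ?M = "kept \<pi>"
  have MN: "?M \<subseteq> N" using inv_kept[OF dist sub] sub by auto
  have "f (X \<union> ?M) \<le> f (kept p \<union> ((X \<union> ?M) - set p)) + sum (gain \<pi>) (X \<inter> set p - ?M)"
    if "\<exists>q. \<pi> = p @ q" for p
    using \<pi> that
  proof (induction rule: prefix_induct)
    case Nil
    then show ?case by simp
  next
    case (snoc p j q)
    let ?Q = "kept p" and ?F = "(X \<union> ?M) - set (p @ [j])"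
    have fw: "kept (p @ [j]) \<subseteq> ?M" "?M \<subseteq> kept (p @ [j]) \<union> set q"
      using kept_append[of "p @ [j]" q] dist sub snoc(1) by auto
    have kp: "?Q \<subseteq> set p" using inv_kept[of p] snoc(2,3) by auto
    have jq: "j \<notin> set q" "j \<notin> set p" using dist snoc(1) by auto
    show ?case
    proof (cases "j \<in> ?M")
      case True
      then have "j \<in> kept (p @ [j])" using fw(2) jq by auto
      with snoc(2,3) have "kept (p @ [j]) = insert j ?Q"
        by (cases rule: kept_snoc_cases) auto
      then have "kept (p @ [j]) \<union> ?F = ?Q \<union> ((X \<union> ?M) - set p)" using True jq(2) by auto
      moreover have "X \<inter> set (p @ [j]) - ?M = X \<inter> set p - ?M" using True by auto
      ultimately show ?thesis using snoc(4) by simp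
    next
      case False
      then have "j \<notin> kept (p @ [j])" using fw(1) by auto
      with snoc(2,3) have Q: "kept (p @ [j]) = ?Q"
        by (cases rule: kept_snoc_cases) auto
      show ?thesis
      proof (cases "j \<in> X")
        case True
        \<comment> \<open>The marginal value of the unread products decreases when \<open>j\<close> is added to what is kept.\<close>
        have "f (?F \<union> insert j ?Q) - f (insert j ?Q) \<le> f (?F \<union> ?Q) - f ?Q"
          by (rule dec[unfolded decreasing_along_def, rule_format, OF snoc(1)])
            (use X MN in auto)
        moreover have "gain \<pi> j = f (insert j ?Q) - f ?Q"
          using gain_split[of p j q] dist snoc(1) by simp
        moreover have "?Q \<union> ((X \<union> ?M) - set p) = ?F \<union> insert j ?Q" using True jq(2) by auto
        moreover have "X \<inter> set (p @ [j]) - ?M = insert j (X \<inter> set p - ?M)"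
          using True False by auto
        moreover have "j \<notin> X \<inter> set p - ?M" using jq by auto
        ultimately show ?thesis using snoc(4) Q by (simp add: Un_commute)
      next
        case F: False
        then have "?F = (X \<union> ?M) - set p" using False by auto
        moreover have "X \<inter> set (p @ [j]) - ?M = X \<inter> set p - ?M" using F by auto
        ultimately show ?thesis using snoc(4) Q by simp
      qed
    qed
  qed
  from this[of \<pi>]
  have "f (X \<union> ?M) \<le> f (?M \<union> ((X \<union> ?M) - set \<pi>)) + sum (gain \<pi>) (X \<inter> set \<pi> - ?M)" by simp
  moreover have "f X \<le> f (X \<union> ?M)" using X MN by (intro f_mono) auto
  moreover have "f (?M \<union> ((X \<union> ?M) - set \<pi>)) \<le> f ((N - set \<pi>) \<union> ?M)"
    by (rule f_mono) (use X MN in auto)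
  ultimately show ?thesis using fin by simp
qed

text \<open>
  With \<open>b\<close> as the cost of a product, \<open>\<tau>\<close> is a threshold on gain per unit of cost.
\<close>

lemma density_lower:
  assumes \<pi>: "complete_pass \<pi>" and S: "S \<subseteq> kept \<pi>" and dense: "\<And>j. j \<in> S \<Longrightarrow> \<tau> * b j \<le> gain \<pi> j"
  shows "\<tau> * sum b S \<le> f S"
proof -
  have "\<tau> * sum b S \<le> sum (gain \<pi>) S"
    unfolding sum_distrib_left by (rule sum_mono) (rule dense)
  also have "\<dots> \<le> f S" by (rule sum_gain_le[OF \<pi> S])
  finally show ?thesis .
qed

lemma density_upper:
  assumes \<pi>: "complete_pass \<pi>" and X: "X \<subseteq> N" and b: "\<And>j. j \<in> N \<Longrightarrow> 0 \<le> b j" and \<tau>: "0 \<le> \<tau>"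
    and sparse: "\<And>j. j \<in> X \<inter> set \<pi> - kept \<pi> \<Longrightarrow> gain \<pi> j \<le> \<tau> * b j"
  shows "f X \<le> f (kept \<pi>) + \<tau> * sum b X"
proof -
  let ?D = "X \<inter> set \<pi> - kept \<pi>"
  have "sum (gain \<pi>) ?D \<le> \<tau> * sum b ?D"
    unfolding sum_distrib_left by (rule sum_mono) (rule sparse)
  also have "\<dots> \<le> \<tau> * sum b X"
    using \<tau> finite_sub[OF X] X b by (intro mult_left_mono sum_mono2) auto
  finally show ?thesis using f_le_kept_plus_gain[OF \<pi> X] by linarith
qed

text \<open>
  In these states \<open>p\<close> lists the products read in earlier rounds and \<open>new\<close> those that the next run reads
  after the kept ones.
\<close>

definition loop_inv :: "'a set \<times> 'a list \<times> 'a set \<times> 'a set \<Rightarrow> bool" where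
  "loop_inv = (\<lambda>(W, xs, M, S). \<exists>p new. distinct (p @ new) \<and> set (p @ new) \<subseteq> N \<and> M = kept p \<and>
     S = fst (sets (state_after p)) \<and> xs = filter (\<lambda>j. j \<in> M) p @ new \<and>
     W = (N - set p) \<union> M \<and> ideal r \<phi> W (set xs) \<and> decreasing_along p)"

text \<open>
  After a round, the kept products are part of a list that was ideal for the larger set \<open>W\<close>; by
  \<open>ideal_Un\<close>, the next list is ideal for the smaller one. The marginals decrease when one of the new
  products is read because the current list is ideal and contains everything kept so far.
\<close>

lemma loop_inv_body:
  assumes inv: "loop_inv (W, xs, M, S)" and continue: "set xs - M \<noteq> {}"
  shows "distinct xs" "set xs \<subseteq> N"
    "loop_inv (result (framework_body I rn (W, xs, M, S)))"
    "(case result (framework_body I rn (W, xs, M, S)) of (W', xs', M', S') \<Rightarrow> card (W' - M'))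
      < card (W - M)"
    "\<exists>W'\<subseteq>N. cost (framework_body I rn (W, xs, M, S)) = cost (rn xs) + U_time I W' + (card N + 1)"
proof -
  from inv obtain p new where dist: "distinct (p @ new)" and sub: "set (p @ new) \<subseteq> N"
    and M: "M = kept p" and S: "S = fst (sets (state_after p))"
    and xs: "xs = filter (\<lambda>j. j \<in> M) p @ new" and W: "W = (N - set p) \<union> M"
    and ideal: "ideal r \<phi> W (set xs)" and dec: "decreasing_along p"
    unfolding loop_inv_def by auto
  have kp: "M \<subseteq> set p" using inv_kept[of p] dist sub M by auto
  have set_xs: "set xs = M \<union> set new" using xs kp by auto
  show dx: "distinct xs" and xsN: "set xs \<subseteq> N" using xs dist sub by auto
  have WN: "W \<subseteq> N" using W kp sub by auto
  define S' R' where "S' = fst (sets (state_after (p @ new)))" and "R' = snd (sets (state_after (p @ new)))"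
  have run: "result (rn xs) = (S', R')"
  proof -
    have "state_after xs = state_after (p @ new)"
      unfolding xs state_after_append M using state_after_filter[of p] dist sub by simp
    then show ?thesis by (simp add: run_result state_after_def S'_def R'_def)
  qed
  define M' where "M' = kept (p @ new)"
  have M'_eq: "S' \<union> R' = M'" by (simp add: M'_def kept_def S'_def R'_def)
  define W' where "W' = (N - set (p @ new)) \<union> M'"
  define X where "X = U_oracle I W'"
  define new' where "new' = arrange I (X - M')"
  have M': "M \<subseteq> M'" "M' \<subseteq> M \<union> set new" using kept_append[OF dist sub] M M'_def by auto
  have W'_eq: "W - set xs \<union> M' = W'" unfolding W'_def W set_xs using dist kp by auto
  have W'W: "W' \<subseteq> W" unfolding W'_def W using M' sub kp dist by auto
  have X: "ideal r \<phi> W' X" unfolding X_def using ideal_U W'W WN by auto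
  then have XW: "X \<subseteq> W'" by (rule ideal_subset)
  have finX: "finite (X - M')" using XW W'W WN finite_sub[of "X - M'"] by auto
  have set_new': "set new' = X - M'" and dist_new': "distinct new'"
    unfolding new'_def using set_arrange[OF finX] distinct_arrange[OF finX] by auto
  have flt: "filter (\<lambda>j. j \<in> M') xs = filter (\<lambda>j. j \<in> M') (p @ new)"
  proof -
    have "filter (\<lambda>j. j \<in> M') (filter (\<lambda>j. j \<in> M) p) = filter (\<lambda>j. j \<in> M') p"
      unfolding filter_filter by (rule filter_cong) (use M' dist in auto)
    then show ?thesis unfolding xs by simp
  qed
  let ?xs' = "filter (\<lambda>j. j \<in> M') (p @ new) @ new'"
  have body: "result (framework_body I rn (W, xs, M, S)) =
      (W', ?xs', M', S')"
    unfolding framework_body_def prod.case Let_def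
    by (simp only: result_bind result_ret result_query_U run prod.case M'_eq W'_eq flt
        X_def[symmetric] new'_def[symmetric])
  have M'_sub: "M' \<subseteq> set (p @ new)" using M' kp by auto
  have set_xs': "set ?xs' = X \<union> M'" using set_new' M'_sub by auto
  have ideal': "ideal r \<phi> W' (set ?xs')"
    unfolding set_xs' by (rule ideal_Un[OF ideal W'W _ _ X]) (use M' set_xs W'_def in auto)
  have dec': "decreasing_along (p @ new)"
    unfolding decreasing_along_def
  proof (intro allI impI)
    fix p1 j q A B C
    assume split: "p @ new = p1 @ j # q" and B: "B \<subseteq> A" and A: "A \<subseteq> insert j (kept p1)"
      and C: "C \<subseteq> (N - set p1) \<union> kept p1"
    \<comment> \<open>The position of \<open>j\<close> is in an earlier round or in this one, where the whole list is ideal for \<open>W\<close>.\<close>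
    from split obtain us where "p = p1 @ us \<and> us @ new = j # q \<or> p @ us = p1 \<and> new = us @ j # q"
      unfolding append_eq_append_conv2 by blast
    then consider q' where "p = p1 @ j # q'" | n1 where "p1 = p @ n1" "new = n1 @ j # q"
      by (cases us) auto
    then show "f (C \<union> A) - f A \<le> f (C \<union> B) - f B"
    proof cases
      case 1
      show ?thesis by (rule dec[unfolded decreasing_along_def, rule_format, OF 1 B A C])
    next
      case 2
      have "distinct (p @ n1)" "set (p @ n1) \<subseteq> N" using dist sub 2 by auto
      then have "kept p1 \<subseteq> M \<union> set n1" using kept_append[of p n1] 2 M by simp
      then have "A \<subseteq> set xs" "C \<subseteq> W" using A C 2 set_xs W dist sub by auto
      then show ?thesis using ideal_decreasing[OF ideal WN B] by simp
    qed
  qed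
  have dist': "distinct ((p @ new) @ new')" and sub': "set ((p @ new) @ new') \<subseteq> N"
    using dist dist_new' set_new' XW W'_def sub by auto
  show "loop_inv (result (framework_body I rn (W, xs, M, S)))"
    unfolding body loop_inv_def prod.case
    by (rule exI[of _ "p @ new"], rule exI[of _ new'])
      (use dist' sub' ideal' dec' W'_def M'_def S'_def in simp)
  have "new \<noteq> []" using continue set_xs by auto
  then obtain x where "x \<in> set new" by (cases new) auto
  moreover have "W' - M' = N - set (p @ new)" "W - M = N - set p"
    unfolding W'_def W using M'_sub kp by auto
  ultimately have "W' - M' \<subset> W - M" using dist sub by auto
  then have "card (W' - M') < card (W - M)"
    using finite_sub[of "W - M"] WN by (intro psubset_card_mono) auto
  then show "(case result (framework_body I rn (W, xs, M, S)) of (W', xs', M', S') \<Rightarrow> card (W' - M'))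
      < card (W - M)" unfolding body by simp
  show "\<exists>W'\<subseteq>N. cost (framework_body I rn (W, xs, M, S)) = cost (rn xs) + U_time I W' + (card N + 1)"
  proof (intro exI conjI)
    show "W' \<subseteq> N" using W'W WN by auto
    show "cost (framework_body I rn (W, xs, M, S)) = cost (rn xs) + U_time I W' + (card N + 1)"
      unfolding framework_body_def prod.case Let_def
      by (simp add: run M'_eq W'_eq)
  qed
qed

theorem framework_loop_complete_pass:
  "\<exists>t \<pi>. framework_loop I rn = Some t \<and> complete_pass \<pi> \<and>
     result t = fst (sets (state_after \<pi>)) \<and>
     ((\<forall>xs. distinct xs \<and> set xs \<subseteq> N \<longrightarrow> cost (rn xs) \<le> c) \<and> (\<forall>Y\<subseteq>N. U_time I Y \<le> u) \<longrightarrow>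
       cost t \<le> loop_cost (card N) c u)"
proof -
  define cheap where "cheap \<longleftrightarrow>
    (\<forall>xs. distinct xs \<and> set xs \<subseteq> N \<longrightarrow> cost (rn xs) \<le> c) \<and> (\<forall>Y\<subseteq>N. U_time I Y \<le> u)"
  let ?K = "2 * (card N + 1) + c + u"
  let ?rest = "\<lambda>(W, xs :: 'a list, M :: 'a set, S :: 'a set). card (W - M)"
  \<comment> \<open>\<open>W - M\<close> is the set of products that have not been read. It shrinks in every round, and the
    cost already incurred plus \<open>?K\<close> for each unread product never grows.\<close>
  define P where "P t \<longleftrightarrow> loop_inv (result t) \<and> ?rest (result t) \<le> card N \<and>
    (cheap \<longrightarrow> cost t + ?K * ?rest (result t) \<le> loop_cost (card N) c u)" for t
  let ?b = "\<lambda>t. case result t of (W, xs, M, S :: 'a set) \<Rightarrow> set xs - M \<noteq> {}"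
  let ?c = "\<lambda>t. bind_timed t (\<lambda>s. bind_timed (set_ops I) (\<lambda>_. framework_body I rn s))"
  let ?t0 = "bind_timed (query_U I (products I)) (\<lambda>X. bind_timed (set_ops I)
     (\<lambda>_. ret (products I, arrange I X, {}, {})))"
  have idl: "ideal r \<phi> N (U_oracle I N)" by (rule ideal_U) simp
  have UN: "U_oracle I N \<subseteq> N" using ideal_subset[OF idl] .
  have "loop_inv (N, arrange I (U_oracle I N), {}, {})"
    unfolding loop_inv_def prod.case
    by (rule exI[of _ "[]"], rule exI[of _ "arrange I (U_oracle I N)"])
      (use UN idl set_arrange distinct_arrange finite_sub[OF UN] in
        \<open>auto simp: sets_init decreasing_along_def\<close>)
  then have P0: "P ?t0"
    unfolding P_def cheap_def loop_cost_def by (auto simp: algebra_simps)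
  have step: "P (?c t) \<and> ?rest (result (?c t)) < ?rest (result t)" if Pt: "P t" and b: "?b t" for t
  proof -
    obtain W xs M S where s: "result t = (W, xs, M, S)" by (cases "result t") auto
    have inv: "loop_inv (W, xs, M, S)" and cont: "set xs - M \<noteq> {}"
      using Pt b unfolding P_def s by auto
    note body = loop_inv_body[OF inv cont]
    let ?s' = "result (framework_body I rn (W, xs, M, S))"
    have lt: "?rest ?s' < card (W - M)" using body(4) by (simp add: case_prod_unfold)
    have "cost (?c t) + ?K * ?rest ?s' \<le> loop_cost (card N) c u" if cheap
    proof -
      obtain W' where "W' \<subseteq> N"
        "cost (framework_body I rn (W, xs, M, S)) = cost (rn xs) + U_time I W' + (card N + 1)"
        using body(5) by blast
      then have "cost (?c t) \<le> cost t + ?K"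
        using that body(1,2) unfolding cheap_def s cost_bind by (simp add: s add_mono)
      moreover have "?K * Suc (?rest ?s') \<le> ?K * card (W - M)"
        using lt by (intro mult_le_mono2) simp
      moreover have "cost t + ?K * card (W - M) \<le> loop_cost (card N) c u"
        using Pt that unfolding P_def s by simp
      ultimately show ?thesis by simp
    qed
    moreover have "?rest ?s' \<le> card N" using lt Pt unfolding P_def s by simp
    ultimately show ?thesis using body(3) lt unfolding P_def by (simp add: s)
  qed
  have "\<exists>t. while_option ?b ?c ?t0 = Some t"
    by (rule measure_while_option_Some[where P = P and f = "\<lambda>t. ?rest (result t)"])
      (fact step, fact P0)
  then obtain t where t1: "while_option ?b ?c ?t0 = Some t" ..
  have t2: "P t" by (rule while_option_rule[OF _ t1, where P = P]) (use step P0 in simp_all)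
  have t3: "\<not> ?b t" using while_option_stop[OF t1] .
  obtain W xs M S where s: "result t = (W, xs, M, S)" by (cases "result t") auto
  have "set xs \<subseteq> M" using t3 s by auto
  moreover have "loop_inv (W, xs, M, S)" using t2 s unfolding P_def by simp
  then obtain p new where p: "distinct (p @ new)" "set (p @ new) \<subseteq> N" "M = kept p"
     "S = fst (sets (state_after p))" "xs = filter (\<lambda>j. j \<in> M) p @ new"
     "W = (N - set p) \<union> M" "ideal r \<phi> W (set xs)" "decreasing_along p"
    unfolding loop_inv_def by auto
  moreover have kp: "M \<subseteq> set p" using inv_kept[of p] p by auto
  ultimately have "set xs = M" by auto
  moreover have "W \<subseteq> N" using p(2,6) kp by auto
  ultimately have "f W = f M" using ideal_value[OF p(7)] by simp
  then have "complete_pass p" using p unfolding complete_pass_def by auto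
  moreover have "framework_loop I rn = Some (bind_timed t (\<lambda>(W, xs, M, S). ret S))"
    unfolding framework_loop_def using t1 by simp
  moreover have "cheap \<longrightarrow> cost t \<le> loop_cost (card N) c u" using t2 unfolding P_def by auto
  ultimately show ?thesis using p(4) s unfolding cheap_def
    by (intro exI[of _ "bind_timed t (\<lambda>(W, xs, M, S). ret S)"] exI[of _ p]) auto
qed

end

section \<open>Polynomial bounds\<close>

text \<open>
  Running time bounds are built as functions on the natural numbers and only then turned into
  polynomials.
\<close>

definition polynomial :: "(nat \<Rightarrow> nat) \<Rightarrow> bool" where
  "polynomial g \<longleftrightarrow> (\<exists>p. \<forall>m. poly p m = g m)"

lemma polynomial_const: "polynomial (\<lambda>_. c)"
  unfolding polynomial_def by (intro exI[of _ "[:c:]"]) simp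

lemma polynomial_id: "polynomial (\<lambda>m. m)"
  unfolding polynomial_def by (intro exI[of _ "[:0, 1:]"]) simp

lemma polynomial_poly: "polynomial (poly q)"
  unfolding polynomial_def by auto

lemma polynomial_add: "polynomial g \<Longrightarrow> polynomial h \<Longrightarrow> polynomial (\<lambda>m. g m + h m)"
  unfolding polynomial_def by (metis poly_add)

lemma polynomial_mult: "polynomial g \<Longrightarrow> polynomial h \<Longrightarrow> polynomial (\<lambda>m. g m * h m)"
  unfolding polynomial_def by (metis poly_mult)

lemma polynomial_Suc: "polynomial g \<Longrightarrow> polynomial (\<lambda>m. Suc (g m))"
  using polynomial_add[OF _ polynomial_const[of 1]] by simp

lemma polynomial_power: "polynomial g \<Longrightarrow> polynomial (\<lambda>m. g m ^ k)"
  unfolding polynomial_def by (metis poly_power)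

lemmas polynomial_intros = polynomial_const polynomial_id polynomial_poly polynomial_add
  polynomial_mult polynomial_Suc polynomial_power

lemma poly_mono_nat:
  fixes q :: "nat poly"
  shows "m \<le> n \<Longrightarrow> poly q m \<le> poly q n"
  by (induction q) (auto intro: add_mono mult_mono)

lemma cost_fold_timed_le:
  assumes "P s" and "\<And>x s. x \<in> set xs \<Longrightarrow> P s \<Longrightarrow> P (result (g x s)) \<and> cost (g x s) \<le> c"
  shows "cost (fold_timed g xs s) \<le> length xs * c"
  using assms
proof (induction xs arbitrary: s)
  case (Cons x xs)
  have "P (result (g x s))" "cost (g x s) \<le> c" using Cons.prems by auto
  moreover have "cost (fold_timed g xs (result (g x s))) \<le> length xs * c"
    by (rule Cons.IH) (use Cons.prems calculation in auto)
  ultimately show ?case by simp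
qed simp

lemma one_minus_times_le:
  fixes \<epsilon> :: real
  assumes "\<epsilon> < 1" "0 \<le> z" "y \<le> (1 + \<epsilon>) * z"
  shows "(1 - \<epsilon>) * y \<le> z"
proof -
  have "(1 - \<epsilon>) * y \<le> (1 - \<epsilon>) * ((1 + \<epsilon>) * z)" using assms by (intro mult_left_mono) auto
  also have "\<dots> = z - \<epsilon>^2 * z" by (simp add: algebra_simps power2_eq_square)
  also have "\<dots> \<le> z" using assms(2) by simp
  finally show ?thesis .
qed

lemma sum_list_le_length:
  fixes g :: "'b \<Rightarrow> nat"
  assumes "\<And>x. x \<in> set xs \<Longrightarrow> g x \<le> c"
  shows "(\<Sum>x\<leftarrow>xs. g x) \<le> length xs * c"
  using assms by (induction xs) (auto intro!: add_mono)

lemma those_map_Some: "those (map (\<lambda>x. Some (t x)) xs) = Some (map t xs)"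
  by (induction xs) auto

lemma arg_max_on_finite:
  fixes g :: "'b \<Rightarrow> real"
  assumes "finite A" "A \<noteq> {}"
  shows "arg_max_on g A \<in> A \<and> (\<forall>y\<in>A. g y \<le> g (arg_max_on g A))"
proof -
  obtain x where x: "x \<in> A" "\<And>y. y \<in> A \<Longrightarrow> g y \<le> g x"
    using finite_maximizer[OF assms, of g] by blast
  show ?thesis unfolding arg_max_on_def
    by (rule arg_maxI[where x = x]) (use x in \<open>auto simp: not_less\<close>)
qed

section \<open>From single runs to the output of the framework\<close>

context assortment_problem
begin

lemma cost_fold_products_le:
  assumes "distinct xs" "set xs \<subseteq> N" "P s"
    and "\<And>j s. j \<in> N \<Longrightarrow> P s \<Longrightarrow> P (result (g j s)) \<and> cost (g j s) \<le> c"
  shows "cost (fold_timed g xs s) \<le> card N * c"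
proof -
  have "cost (fold_timed g xs s) \<le> length xs * c"
    by (rule cost_fold_timed_le[where P = P]) (use assms in auto)
  also have "\<dots> \<le> card N * c" by (intro mult_le_mono1 length_le_card assms(1,2))
  finally show ?thesis .
qed

text \<open>
  Here \<open>good \<gamma> S\<close> is what the analysis of the loop guarantees for the set \<open>S\<close> found with the setting
  \<open>\<gamma>\<close>, and \<open>cheap\<close> is the assumption on the oracles under which costs are bounded. A competitor of
  value zero imposes no condition on the candidates, since all values are nonnegative.
\<close>

lemma framework_guarantee:
  assumes loops: "\<And>\<gamma>. \<gamma> \<in> set (result (settings \<A>)) \<Longrightarrow>
      \<exists>t. framework_loop I (run \<A> \<gamma>) = Some t \<and> good \<gamma> (result t) \<and> (cheap \<longrightarrow> cost t \<le> L)"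
    and cands: "\<And>Ss. (\<forall>\<gamma>\<in>set (result (settings \<A>)). \<exists>S\<in>set Ss. good \<gamma> S) \<Longrightarrow>
      (\<forall>S\<in>set Ss. \<exists>\<gamma>\<in>set (result (settings \<A>)). good \<gamma> S) \<Longrightarrow>
      length Ss = length (result (settings \<A>)) \<Longrightarrow>
      set (result (candidates \<A> Ss)) \<subseteq> \<F> \<and> result (candidates \<A> Ss) \<noteq> [] \<and>
      (\<forall>X\<in>\<F>. 0 < f X \<longrightarrow> (\<exists>C\<in>set (result (candidates \<A> Ss)). \<alpha> * f X \<le> f C)) \<and>
      (cheap \<longrightarrow> cost (candidates \<A> Ss) \<le> cc \<and> length (result (candidates \<A> Ss)) \<le> lc)"
    and settings_cost: "cheap \<Longrightarrow> cost (settings \<A>) \<le> sc \<and> length (result (settings \<A>)) \<le> sl"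
    and f_cost: "\<And>Y. cheap \<Longrightarrow> Y \<subseteq> N \<Longrightarrow> f_time I Y \<le> u"
    and \<F>: "\<F> \<subseteq> Pow N"
  shows "\<exists>out. framework \<A> I = Some out \<and> approximate_solution \<alpha> \<F> f (result out) \<and>
     (cheap \<longrightarrow> cost out \<le> sc + sl * L + cc + lc * (u + 1))"
proof -
  let ?\<Gamma> = "result (settings \<A>)"
  obtain t where t: "\<And>\<gamma>. \<gamma> \<in> set ?\<Gamma> \<Longrightarrow> framework_loop I (run \<A> \<gamma>) = Some (t \<gamma>)"
    "\<And>\<gamma>. \<gamma> \<in> set ?\<Gamma> \<Longrightarrow> good \<gamma> (result (t \<gamma>))"
    "\<And>\<gamma>. \<gamma> \<in> set ?\<Gamma> \<Longrightarrow> cheap \<Longrightarrow> cost (t \<gamma>) \<le> L"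
    using loops by metis
  define Ss where "Ss = map (\<lambda>\<gamma>. result (t \<gamma>)) ?\<Gamma>"
  let ?Cs = "result (candidates \<A> Ss)"
  have c: "set ?Cs \<subseteq> \<F>" "?Cs \<noteq> []" "\<forall>X\<in>\<F>. 0 < f X \<longrightarrow> (\<exists>C\<in>set ?Cs. \<alpha> * f X \<le> f C)"
    "cheap \<longrightarrow> cost (candidates \<A> Ss) \<le> cc \<and> length ?Cs \<le> lc"
    using cands[of Ss] t(2) unfolding Ss_def by auto
  have "map (\<lambda>\<gamma>. framework_loop I (run \<A> \<gamma>)) ?\<Gamma> = map (\<lambda>\<gamma>. Some (t \<gamma>)) ?\<Gamma>"
    using t(1) by (intro map_cong) auto
  then have those: "those (map (\<lambda>\<gamma>. framework_loop I (run \<A> \<gamma>)) ?\<Gamma>) = Some (map t ?\<Gamma>)"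
    by (simp only: those_map_Some)
  obtain out where out: "framework \<A> I = Some out"
    and res: "result out = arg_max_on (f_oracle I) (set ?Cs)"
    and cst: "cost out = cost (settings \<A>) + (\<Sum>\<gamma>\<leftarrow>?\<Gamma>. cost (t \<gamma>)) + cost (candidates \<A> Ss)
      + (\<Sum>C\<leftarrow>?Cs. f_time I C) + length ?Cs"
    unfolding framework_def those select_best_def Ss_def
    by (simp add: result_map_timed cost_map_timed comp_def)
  have CN: "C \<subseteq> N" if "C \<in> set ?Cs" for C using that c(1) \<F> by auto
  have am: "result out \<in> set ?Cs" "\<And>C. C \<in> set ?Cs \<Longrightarrow> f C \<le> f (result out)"
    using arg_max_on_finite[of "set ?Cs" "f_oracle I"] c(2) CN f_oracle_eq unfolding res by auto
  have "approximate_solution \<alpha> \<F> f (result out)"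
  proof -
    have "finite \<F>" using \<F> finite_N by (simp add: finite_subset)
    moreover have "\<F> \<noteq> {}" using am(1) c(1) by auto
    ultimately have "Max (f ` \<F>) \<in> f ` \<F>" by (intro Max_in) auto
    then obtain X where X: "X \<in> \<F>" "Max (f ` \<F>) = f X" by auto
    have "\<alpha> * f X \<le> f (result out)"
    proof (cases "0 < f X")
      case True
      then obtain C where "C \<in> set ?Cs" "\<alpha> * f X \<le> f C" using c(3) X(1) by blast
      then show ?thesis using am(2) by fastforce
    next
      case False
      then have "f X = 0" using f_nonneg[of X] X(1) \<F> by force
      then show ?thesis using f_nonneg CN am(1) by simp
    qed
    then show ?thesis unfolding approximate_solution_def X(2) using am(1) c(1) by auto
  qed
  moreover have "cost out \<le> sc + sl * L + cc + lc * (u + 1)" if cheap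
  proof -
    have "(\<Sum>\<gamma>\<leftarrow>?\<Gamma>. cost (t \<gamma>)) \<le> length ?\<Gamma> * L"
      by (rule sum_list_le_length) (use t(3) that in auto)
    also have "\<dots> \<le> sl * L" using settings_cost that by simp
    finally have "(\<Sum>\<gamma>\<leftarrow>?\<Gamma>. cost (t \<gamma>)) \<le> sl * L" .
    moreover have "(\<Sum>C\<leftarrow>?Cs. f_time I C) \<le> length ?Cs * u"
      by (rule sum_list_le_length) (use f_cost that CN in auto)
    moreover have "length ?Cs * (u + 1) \<le> lc * (u + 1)" using c(4) that by (intro mult_le_mono1) simp
    ultimately show ?thesis using settings_cost[OF that] c(4) that unfolding cst by simp
  qed
  ultimately show ?thesis using out by blast
qed

section \<open>Thresholds\<close>

definition number_of_thresholds :: "real \<Rightarrow> nat \<Rightarrow> nat" where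
  "number_of_thresholds \<epsilon> m = max 1 (nat \<lceil>log (1 + \<epsilon>) (real m)\<rceil>)"

lemma number_of_thresholds_upper:
  assumes "0 < \<epsilon>"
  shows "real m \<le> (1 + \<epsilon>) ^ number_of_thresholds \<epsilon> m"
proof (cases "m = 0")
  case False
  have "log (1 + \<epsilon>) (real m) \<le> real (number_of_thresholds \<epsilon> m)"
    unfolding number_of_thresholds_def by linarith
  then have "real m \<le> (1 + \<epsilon>) powr real (number_of_thresholds \<epsilon> m)"
    using assms False by (simp add: le_powr_iff)
  then show ?thesis using assms by (simp add: powr_realpow)
qed (use assms in simp)

lemma number_of_thresholds_lower:
  assumes "0 < \<epsilon>" "1 \<le> m"
  shows "(1 + \<epsilon>) ^ (number_of_thresholds \<epsilon> m - 1) \<le> real m"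
proof (cases "number_of_thresholds \<epsilon> m = 1")
  case False
  then have "real (number_of_thresholds \<epsilon> m - 1) \<le> log (1 + \<epsilon>) (real m)"
    unfolding number_of_thresholds_def max_def by (auto split: if_splits) linarith+
  then have "(1 + \<epsilon>) powr real (number_of_thresholds \<epsilon> m - 1) \<le> real m"
    using assms by (simp add: powr_le_iff)
  then show ?thesis using assms by (simp add: powr_realpow)
qed (use assms in simp)

lemma number_of_thresholds_pos: "1 \<le> number_of_thresholds \<epsilon> m"
  by (simp add: number_of_thresholds_def)

text \<open>
  For a bound by a polynomial in the number of products, \<open>ln m \<le> m\<close> is enough.
\<close>

lemma number_of_thresholds_linear:
  assumes "0 < \<epsilon>"
  shows "number_of_thresholds \<epsilon> m \<le> 1 + nat \<lceil>1 / ln (1 + \<epsilon>)\<rceil> * m"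
proof (cases "m = 0")
  case True
  then show ?thesis by (simp add: number_of_thresholds_def log_def)
next
  case False
  have l: "0 < ln (1 + \<epsilon>)" using assms by simp
  have "ln (real m) \<le> real m" using ln_le_minus_one[of "real m"] False by simp
  then have "log (1 + \<epsilon>) (real m) \<le> real m * (1 / ln (1 + \<epsilon>))"
    unfolding log_def using l by (simp add: divide_right_mono)
  also have "\<dots> \<le> real m * real (nat \<lceil>1 / ln (1 + \<epsilon>)\<rceil>)"
    by (intro mult_left_mono) (linarith, simp)
  finally have "log (1 + \<epsilon>) (real m) \<le> real (nat \<lceil>1 / ln (1 + \<epsilon>)\<rceil> * m)"
    by (simp only: of_nat_mult mult.commute)
  then have "nat \<lceil>log (1 + \<epsilon>) (real m)\<rceil> \<le> nat \<lceil>1 / ln (1 + \<epsilon>)\<rceil> * m"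
    by (simp only: nat_le_iff ceiling_le_iff of_int_of_nat_eq)
  then show ?thesis unfolding number_of_thresholds_def by simp
qed

lemma number_of_thresholds_log:
  assumes "0 < \<epsilon>" "1 \<le> k"
  shows "number_of_thresholds \<epsilon> k \<le> 1 + nat \<lceil>log (1 + \<epsilon>) 2\<rceil> * nat \<lceil>log 2 (real k)\<rceil>"
proof -
  have "log (1 + \<epsilon>) (real k) = log 2 (real k) * log (1 + \<epsilon>) 2"
    using assms by (simp add: log_def)
  also have "\<dots> \<le> real (nat \<lceil>log 2 (real k)\<rceil>) * real (nat \<lceil>log (1 + \<epsilon>) 2\<rceil>)"
    by (rule mult_mono[OF real_nat_ceiling_ge real_nat_ceiling_ge of_nat_0_le_iff]) (use assms in simp)
  finally have "log (1 + \<epsilon>) (real k) \<le> real (nat \<lceil>log (1 + \<epsilon>) 2\<rceil> * nat \<lceil>log 2 (real k)\<rceil>)"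
    by (simp only: of_nat_mult mult.commute)
  then have "nat \<lceil>log (1 + \<epsilon>) (real k)\<rceil> \<le> nat \<lceil>log (1 + \<epsilon>) 2\<rceil> * nat \<lceil>log 2 (real k)\<rceil>"
    by (simp only: nat_le_iff ceiling_le_iff of_int_of_nat_eq)
  then show ?thesis unfolding number_of_thresholds_def by simp
qed

definition best_singleton :: "'a set \<Rightarrow> real" where
  "best_singleton E = Max ((\<lambda>e. f_oracle I {e}) ` E)"

lemma best_singleton_ge:
  assumes "E \<subseteq> N" "e \<in> E"
  shows "f {e} \<le> best_singleton E"
proof -
  have "f_oracle I {e} \<le> best_singleton E"
    unfolding best_singleton_def by (rule Max_ge) (use assms finite_sub in auto)
  then show ?thesis using f_oracle_eq[of "{e}"] assms by auto
qed

lemma best_singleton_attained: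
  assumes "E \<subseteq> N" "E \<noteq> {}"
  obtains e where "e \<in> E" "f {e} = best_singleton E"
proof -
  have "best_singleton E \<in> (\<lambda>e. f_oracle I {e}) ` E"
    unfolding best_singleton_def by (rule Max_in) (use assms finite_sub in auto)
  then obtain e where "e \<in> E" "best_singleton E = f_oracle I {e}" by auto
  moreover from this have "{e} \<subseteq> N" using assms by auto
  ultimately show thesis using that f_oracle_eq by simp
qed

lemma best_singleton_pos:
  assumes E: "E \<subseteq> N" and X: "X \<subseteq> E" "0 < f X"
  shows "0 < best_singleton E" and "f X \<le> real (card X) * best_singleton E" and "E \<noteq> {}"
proof -
  show le: "f X \<le> real (card X) * best_singleton E"
    by (rule f_le_sum) (use E X best_singleton_ge in auto)
  show "0 < best_singleton E"
  proof (rule ccontr)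
    assume "\<not> ?thesis"
    then have "real (card X) * best_singleton E \<le> 0" by (simp add: mult_nonneg_nonpos)
    then show False using le X by simp
  qed
  show "E \<noteq> {}" using X by auto
qed

lemma set_thresholds:
  "set (result (thresholds I \<epsilon> E c m)) =
    (\<lambda>i. (1 + \<epsilon>) ^ i * (1 / c) * best_singleton E) ` {..<number_of_thresholds \<epsilon> m}"
proof -
  have "(\<lambda>i. (1 + \<epsilon>) ^ (i - 1) * (1 / c) * best_singleton E) ` {1..<l + 1} =
      (\<lambda>i. (1 + \<epsilon>) ^ i * (1 / c) * best_singleton E) ` {..<l}" for l
  proof -
    have "{1..<l + 1} = Suc ` {..<l}" by (simp add: lessThan_atLeast0)
    then show ?thesis by (simp only: image_image diff_Suc_1)
  qed
  then show ?thesis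
    unfolding thresholds_def number_of_thresholds_def best_singleton_def Let_def
    by (simp only: result_bind result_ret set_map set_upt)
qed

lemma length_thresholds: "length (result (thresholds I \<epsilon> E c m)) = number_of_thresholds \<epsilon> m"
  unfolding thresholds_def number_of_thresholds_def Let_def by simp

lemma cost_thresholds_le:
  assumes "E \<subseteq> N" and "\<And>Y. Y \<subseteq> N \<Longrightarrow> f_time I Y \<le> u"
  shows "cost (thresholds I \<epsilon> E c m) \<le> card N * u + (card N + 1) + number_of_thresholds \<epsilon> m"
proof -
  have fin: "finite E" using assms(1) finite_sub by auto
  have "(\<Sum>e\<leftarrow>arrange I E. f_time I {e}) \<le> length (arrange I E) * u"
    by (rule sum_list_le_length) (use assms set_arrange[OF fin] in auto)
  also have "\<dots> \<le> card N * u"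
    using length_arrange[OF fin] card_mono[OF finite_N assms(1)] by simp
  finally show ?thesis
    unfolding thresholds_def number_of_thresholds_def Let_def
    by (simp add: cost_map_timed)
qed

text \<open>
  The thresholds form a geometric sequence, which starts at \<open>v / c\<close> for the best value \<open>v\<close> of a single
  product and would pass \<open>m * v / c\<close> with one more element; by subadditivity, \<open>f(X) \<le> |X| * v\<close>.
\<close>

lemma threshold_near:
  assumes \<epsilon>: "0 < \<epsilon>" and c: "0 < c" and v: "0 < best_singleton E"
    and lo: "best_singleton E / c \<le> x" and hi: "x \<le> real m * best_singleton E / c"
  obtains \<tau> where "\<tau> \<in> set (result (thresholds I \<epsilon> E c m))" "0 < \<tau>" "\<tau> \<le> x" "x \<le> (1 + \<epsilon>) * \<tau>"
proof -
  let ?v = "best_singleton E" and ?l = "number_of_thresholds \<epsilon> m"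
  let ?\<tau> = "\<lambda>i. (1 + \<epsilon>) ^ i * (1 / c) * ?v"
  have "real m * ?v / c \<le> ?\<tau> ?l"
    using number_of_thresholds_upper[OF \<epsilon>, of m] c v
    by (simp add: divide_right_mono mult_right_mono)
  then have top: "x \<le> ?\<tau> ?l" using hi by simp
  define i where "i = (LEAST i. x \<le> ?\<tau> (Suc i))"
  have ex: "x \<le> ?\<tau> (Suc (?l - 1))" using top number_of_thresholds_pos[of \<epsilon> m] by simp
  have i: "x \<le> ?\<tau> (Suc i)" unfolding i_def by (rule LeastI[where P = "\<lambda>i. x \<le> ?\<tau> (Suc i)", OF ex])
  have "i \<le> ?l - 1" unfolding i_def by (rule Least_le[where P = "\<lambda>i. x \<le> ?\<tau> (Suc i)", OF ex])
  then have "i < ?l" using number_of_thresholds_pos[of \<epsilon> m] by simp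
  moreover have "?\<tau> i \<le> x"
  proof (cases i)
    case 0
    then show ?thesis using lo by simp
  next
    case (Suc j)
    then have "\<not> x \<le> ?\<tau> (Suc j)" using not_less_Least[of j "\<lambda>i. x \<le> ?\<tau> (Suc i)"] i_def by auto
    then show ?thesis using Suc by simp
  qed
  moreover have "0 < ?\<tau> i" using \<epsilon> c v by simp
  ultimately show thesis using i by (intro that[of "?\<tau> i"]) (auto simp: set_thresholds mult.assoc)
qed

lemma thresholds_nonempty: "result (thresholds I \<epsilon> E c m) \<noteq> []"
  using number_of_thresholds_pos[of \<epsilon> m] length_thresholds[of \<epsilon> E c m] by fastforce

end

section \<open>Threshold-Cardinality\<close>

context assortment_problem
begin

text \<open>
  If the run does not fill up, it has rejected products for small gains only. The first alternative
  stands for the case that \<open>X\<close> contains no rejected product; in the second one the inequality is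
  strict, which matters if nothing was kept and \<open>\<tau>\<close> is the value of the best single product.
\<close>

definition cardinality_good :: "nat \<Rightarrow> real \<Rightarrow> 'a set \<Rightarrow> bool" where
  "cardinality_good k \<tau> S \<longleftrightarrow> S \<subseteq> N \<and> card S \<le> k \<and> real (card S) * \<tau> \<le> f S \<and>
     (0 \<le> \<tau> \<and> card S < k \<longrightarrow> (\<forall>X\<subseteq>N. f X \<le> f S \<or> f X < f S + real (card X) * \<tau>))"

lemma cardinality_loop:
  "\<exists>t. framework_loop I (run (threshold_cardinality I \<epsilon> k) \<tau>) = Some t \<and> cardinality_good k \<tau> (result t) \<and>
    ((\<forall>Y\<subseteq>N. f_time I Y \<le> u) \<and> (\<forall>Y\<subseteq>N. U_time I Y \<le> u) \<longrightarrow>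
       cost t \<le> loop_cost (card N) (card N * (2 * (card N + 1) + 2 * u)) u)"
proof -
  define st where "st = (\<lambda>j S. result (cardinality_step I k \<tau> j S))"
  let ?rn = "run (threshold_cardinality I \<epsilon> k) \<tau>"
  have step: "st j S =
      (if card S < k \<and> \<tau> \<le> f_oracle I (insert j S) - f_oracle I S then insert j S else S)" for j S
    by (simp add: st_def cardinality_step_def)
  have run: "result (?rn xs) = (fold st xs {}, {})" for xs
    by (simp add: threshold_cardinality_def result_fold_timed st_def)
  interpret sieve N r \<phi> I st "{}" "\<lambda>_. True" "\<lambda>S. (S, {})" ?rn
    by unfold_locales (auto simp: run step)
  let ?c = "card N * (2 * (card N + 1) + 2 * u)"
  have run_cost: "cost (?rn xs) \<le> ?c" if u: "\<forall>Y\<subseteq>N. f_time I Y \<le> u" and xs: "distinct xs" "set xs \<subseteq> N" for xs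
  proof -
    have "cost (fold_timed (cardinality_step I k \<tau>) xs {}) \<le> ?c"
    proof (rule cost_fold_products_le[OF xs, where P = "\<lambda>S. S \<subseteq> N"])
      fix j S assume "j \<in> N" "S \<subseteq> N"
      then show "result (cardinality_step I k \<tau> j S) \<subseteq> N \<and>
          cost (cardinality_step I k \<tau> j S) \<le> 2 * (card N + 1) + 2 * u"
        using u[rule_format, of S] u[rule_format, of "insert j S"] by (simp add: cardinality_step_def)
    qed simp
    then show ?thesis by (simp add: threshold_cardinality_def)
  qed
  obtain t \<pi> where t: "framework_loop I ?rn = Some t" and \<pi>: "complete_pass \<pi>"
    and res: "result t = state_after \<pi>"
    and cst: "(\<forall>xs. distinct xs \<and> set xs \<subseteq> N \<longrightarrow> cost (?rn xs) \<le> ?c) \<and> (\<forall>Y\<subseteq>N. U_time I Y \<le> u) \<longrightarrow>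
       cost t \<le> loop_cost (card N) ?c u"
    using framework_loop_complete_pass[of ?c u] by auto
  have kept: "kept p = state_after p" for p by (simp add: kept_def)
  have dist: "distinct \<pi>" "set \<pi> \<subseteq> N" using \<pi> by (auto simp: complete_pass_def)
  have inv: "card (state_after p) \<le> k \<and> (\<forall>j\<in>state_after p. \<tau> \<le> gain \<pi> j) \<and>
      (card (state_after p) < k \<longrightarrow> (\<forall>j\<in>set p - state_after p. gain \<pi> j < \<tau>))"
    if "\<exists>q. \<pi> = p @ q" for p
    using \<pi> that
  proof (induction rule: prefix_induct)
    case (snoc p j q)
    let ?S = "state_after p"
    have S: "?S \<subseteq> set p" using inv_kept[of p] snoc(2,3) kept by auto
    then have j: "j \<notin> ?S" "finite ?S" "insert j ?S \<subseteq> N" "?S \<subseteq> N"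
      using snoc(2,3) finite_subset by auto
    have "gain \<pi> j = f (insert j ?S) - f ?S"
      using gain_split[of p j q] dist(1) snoc(1) kept by simp
    then have "state_after (p @ [j]) = (if card ?S < k \<and> \<tau> \<le> gain \<pi> j then insert j ?S else ?S)"
      using j f_oracle_eq by (simp add: step)
    then show ?case using snoc(4) j S snoc(2) by auto
  qed simp
  let ?S = "state_after \<pi>"
  have SN: "?S \<subseteq> N" using inv_kept[OF dist] dist kept by auto
  have low: "real (card ?S) * \<tau> \<le> f ?S"
    using density_lower[OF \<pi>, of ?S \<tau> "\<lambda>_. 1"] inv[of \<pi>] kept by (simp add: mult.commute)
  have up: "f X \<le> f ?S \<or> f X < f ?S + real (card X) * \<tau>"
    if "0 \<le> \<tau>" "card ?S < k" "X \<subseteq> N" for X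
  proof (cases "X \<inter> set \<pi> - ?S = {}")
    case True
    then have "sum (gain \<pi>) (X \<inter> set \<pi> - ?S) = 0" by (simp only: sum.empty)
    then show ?thesis using f_le_kept_plus_gain[OF \<pi> that(3)] kept by simp
  next
    case False
    let ?D = "X \<inter> set \<pi> - ?S"
    have finX: "finite X" using that finite_sub by auto
    have "sum (gain \<pi>) ?D < (\<Sum>j\<in>?D. \<tau>)"
      using inv[of \<pi>] that False finX by (intro sum_strict_mono) auto
    also have "\<dots> \<le> real (card X) * \<tau>"
      using that(1) finX by (auto intro!: mult_right_mono card_mono)
    finally show ?thesis using f_le_kept_plus_gain[OF \<pi> that(3)] kept by simp
  qed
  show ?thesis
    using t res SN inv[of \<pi>] low up cst run_cost unfolding cardinality_good_def
    by (intro exI[of _ t]) (auto simp: less_le_not_le)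
qed

text \<open>
  Let \<open>v\<close> be the best value of a single product. If \<open>f(X) > 2 * v\<close>, some threshold \<open>\<tau>\<close> is within a
  factor of \<open>1 + \<epsilon>\<close> below \<open>f(X) / (2 * k)\<close>; then \<open>k\<close> kept products are worth \<open>k * \<tau>\<close>, and with fewer
  products \<open>f(X) - f(S) \<le> k * \<tau> \<le> f(X) / 2\<close>. If
  \<open>f(X) \<le> 2 * v\<close>, that value can lie below the smallest threshold; then the largest threshold is used,
  which is at least \<open>v / (1 + \<epsilon>)\<close>, so that the first product kept is worth enough.
\<close>

lemma cardinality_guarantee:
  assumes \<epsilon>: "0 < \<epsilon>" "\<epsilon> < 1" and k: "1 \<le> k"
    and cheap: "cheap \<Longrightarrow> (\<forall>Y\<subseteq>N. f_time I Y \<le> u) \<and> (\<forall>Y\<subseteq>N. U_time I Y \<le> u)"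
  shows "\<exists>out. framework (threshold_cardinality I \<epsilon> k) I = Some out \<and>
     approximate_solution ((1 - \<epsilon>) * 0.5) {S. S \<subseteq> N \<and> card S \<le> k} f (result out) \<and>
     (cheap \<longrightarrow> cost out \<le> (card N * u + (card N + 1) + number_of_thresholds \<epsilon> k)
       + number_of_thresholds \<epsilon> k * (loop_cost (card N) (card N * (2 * (card N + 1) + 2 * u)) u)
       + 0 + number_of_thresholds \<epsilon> k * (u + 1))"
proof (rule framework_guarantee[where good = "cardinality_good k"])
  let ?A = "threshold_cardinality I \<epsilon> k"
  have settings: "settings ?A = thresholds I \<epsilon> N (real k) k"
    and cand: "candidates ?A = ret" by (simp_all add: threshold_cardinality_def)
  show "\<exists>t. framework_loop I (run ?A \<tau>) = Some t \<and> cardinality_good k \<tau> (result t) \<and>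
     (cheap \<longrightarrow> cost t \<le> loop_cost (card N) (card N * (2 * (card N + 1) + 2 * u)) u)" for \<tau>
    using cardinality_loop[of \<epsilon> k \<tau> u] cheap by blast
  show "cheap \<Longrightarrow> cost (settings ?A) \<le> card N * u + (card N + 1) + number_of_thresholds \<epsilon> k \<and>
      length (result (settings ?A)) \<le> number_of_thresholds \<epsilon> k"
    unfolding settings using cost_thresholds_le[of N u] cheap length_thresholds by auto
  show "cheap \<Longrightarrow> Y \<subseteq> N \<Longrightarrow> f_time I Y \<le> u" for Y using cheap by auto
  show "{S. S \<subseteq> N \<and> card S \<le> k} \<subseteq> Pow N" by auto
  fix Ss assume ex: "\<forall>\<tau>\<in>set (result (settings ?A)). \<exists>S\<in>set Ss. cardinality_good k \<tau> S"
    and all: "\<forall>S\<in>set Ss. \<exists>\<tau>\<in>set (result (settings ?A)). cardinality_good k \<tau> S"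
    and len: "length Ss = length (result (settings ?A))"
  have ne: "Ss \<noteq> []" using len thresholds_nonempty[of \<epsilon> N "real k" k] unfolding settings by auto
  have "\<exists>C\<in>set Ss. (1 - \<epsilon>) * 0.5 * f X \<le> f C" if X: "X \<subseteq> N" "card X \<le> k" and pos: "0 < f X" for X
  proof -
    let ?v = "best_singleton N"
    have v: "0 < ?v" and fX: "f X \<le> real (card X) * ?v" and "N \<noteq> {}"
      using best_singleton_pos[of N X] X pos by auto
    then obtain e where e: "e \<in> N" "f {e} = ?v" using best_singleton_attained[of N] by auto
    have fXk: "f X \<le> real k * ?v"
      using fX X(2) v by (meson mult_right_mono less_imp_le of_nat_mono order_trans)
    show ?thesis
    proof (cases "f X \<le> 2 * ?v")
      case True
      let ?l = "number_of_thresholds \<epsilon> k"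
      define \<tau> where "\<tau> = (1 + \<epsilon>) ^ (?l - 1) * (1 / real k) * ?v"
      have "?l - 1 < ?l" using number_of_thresholds_pos[of \<epsilon> k] by simp
      then have "\<tau> \<in> set (result (settings ?A))" unfolding \<tau>_def settings set_thresholds by blast
      then obtain S where S: "S \<in> set Ss" "cardinality_good k \<tau> S" using ex by blast
      have "\<tau> \<le> ?v"
        unfolding \<tau>_def using number_of_thresholds_lower[OF \<epsilon>(1) k] v k by (simp add: field_simps)
      have "?v \<le> (1 + \<epsilon>) ^ ?l * (1 / real k) * ?v"
        using number_of_thresholds_upper[OF \<epsilon>(1), of k] v k by (simp add: field_simps)
      also have "\<dots> = (1 + \<epsilon>) * \<tau>"
        unfolding \<tau>_def using number_of_thresholds_pos[of \<epsilon> k] by (cases ?l) auto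
      finally have 1: "?v \<le> (1 + \<epsilon>) * \<tau>" .
      have \<tau>0: "0 < \<tau>" unfolding \<tau>_def using \<epsilon> k v by simp
      have "S \<noteq> {}"
      proof
        assume "S = {}"
        then have "f {e} \<le> f S \<or> f {e} < f S + real (card {e}) * \<tau>"
          using S(2) \<tau>0 k e(1) unfolding cardinality_good_def by auto
        then show False using \<open>\<tau> \<le> ?v\<close> e(2) v \<open>S = {}\<close> by auto
      qed
      then have "1 \<le> card S" using S(2) finite_sub unfolding cardinality_good_def by (simp add: Suc_le_eq card_gt_0_iff)
      then have "\<tau> \<le> real (card S) * \<tau>" using \<tau>0 by simp
      then have "\<tau> \<le> f S" using S(2) unfolding cardinality_good_def by linarith
      moreover have "(1 - \<epsilon>) * ?v \<le> \<tau>" using one_minus_times_le[OF \<epsilon>(2) _ 1] \<tau>0 by simp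
      moreover have "(1 - \<epsilon>) * f X \<le> (1 - \<epsilon>) * (2 * ?v)"
        using True \<epsilon> by (intro mult_left_mono) auto
      ultimately have "(1 - \<epsilon>) * 0.5 * f X \<le> f S" by argo
      then show ?thesis using S(1) by blast
    next
      case F: False
      let ?x = "f X / (2 * real k)"
      have "?v / real k \<le> ?x" using F k by (simp add: field_simps)
      moreover have "f X \<le> 2 * real k * ?v" using fXk v k by (simp add: mult.assoc) (use pos in linarith)
      then have "?x \<le> real k * ?v / real k" using k by (simp add: field_simps)
      ultimately obtain \<tau> where \<tau>: "\<tau> \<in> set (result (settings ?A))" "0 < \<tau>" "\<tau> \<le> ?x" "?x \<le> (1 + \<epsilon>) * \<tau>"
        using threshold_near[OF \<epsilon>(1) _ v, of "real k" ?x k] k unfolding settings by auto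
      then obtain S where S: "S \<in> set Ss" "cardinality_good k \<tau> S" using ex by blast
      have up: "real k * \<tau> \<le> f X / 2" using \<tau>(3) k by (simp add: field_simps)
      have lo: "(1 - \<epsilon>) * (f X / 2) \<le> real k * \<tau>"
        by (rule one_minus_times_le[OF \<epsilon>(2)]) (use \<tau>(2,4) k in \<open>simp_all add: field_simps\<close>)
      have "(1 - \<epsilon>) * 0.5 * f X \<le> f S"
      proof (cases "card S = k")
        case True
        then show ?thesis using S(2) lo by (simp add: cardinality_good_def)
      next
        case False
        then have "f X \<le> f S \<or> f X < f S + real (card X) * \<tau>" using S(2) \<tau>(2) X(1) unfolding cardinality_good_def by auto
        moreover have "real (card X) * \<tau> \<le> real k * \<tau>" using X(2) \<tau>(2) by (intro mult_right_mono) auto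
        moreover have "0 \<le> real k * \<tau>" using \<tau>(2) by simp
        ultimately have "f X / 2 \<le> f S" using up by linarith
        moreover have "0 \<le> \<epsilon> * f X" using \<epsilon> pos by simp
        ultimately show ?thesis by (simp add: algebra_simps)
      qed
      then show ?thesis using S(1) by blast
    qed
  qed
  then show "set (result (candidates ?A Ss)) \<subseteq> {S. S \<subseteq> N \<and> card S \<le> k} \<and> result (candidates ?A Ss) \<noteq> [] \<and>
      (\<forall>X\<in>{S. S \<subseteq> N \<and> card S \<le> k}. 0 < f X \<longrightarrow> (\<exists>C\<in>set (result (candidates ?A Ss)). (1 - \<epsilon>) * 0.5 * f X \<le> f C)) \<and>
      (cheap \<longrightarrow> cost (candidates ?A Ss) \<le> 0 \<and> length (result (candidates ?A Ss)) \<le> number_of_thresholds \<epsilon> k)"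
    using all ne len length_thresholds unfolding cand settings cardinality_good_def by auto
qed

end

section \<open>Threshold-Budget\<close>

context assortment_problem
begin

text \<open>
  In the first case some product \<open>j\<close> that is worth its cost did not fit: with \<open>j\<close>, the run would have
  spent the budget at a density of at least \<open>\<tau>\<close>.
\<close>

definition budget_good :: "('a \<Rightarrow> real) \<Rightarrow> real \<Rightarrow> real \<Rightarrow> 'a set \<Rightarrow> bool" where
  "budget_good b B \<tau> S \<longleftrightarrow> S \<subseteq> N \<and> sum b S \<le> B \<and>
     (0 \<le> \<tau> \<longrightarrow> (\<exists>j\<in>N. b j \<le> B \<and> \<tau> * B \<le> f S + f {j}) \<or>
       (\<forall>X\<subseteq>N. sum b X \<le> B \<longrightarrow> f X \<le> f S + \<tau> * B))"

lemma budget_loop: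
  assumes b: "\<forall>i\<in>N. 0 < b i" and B: "0 < B"
  shows "\<exists>t. framework_loop I (run (threshold_budget I \<epsilon> b B) \<tau>) = Some t \<and> budget_good b B \<tau> (result t) \<and>
    ((\<forall>Y\<subseteq>N. f_time I Y \<le> u) \<and> (\<forall>Y\<subseteq>N. U_time I Y \<le> u) \<longrightarrow>
       cost t \<le> loop_cost (card N) (card N * (2 * (card N + 1) + 2 * u)) u)"
proof -
  define st where "st = (\<lambda>j S. result (budget_step I b B \<tau> j S))"
  let ?rn = "run (threshold_budget I \<epsilon> b B) \<tau>"
  have step: "st j S = (if b j \<le> B \<and> sum b S < B \<and> b j < B - sum b S \<and>
      \<tau> \<le> (f_oracle I (insert j S) - f_oracle I S) / b j then insert j S else S)" for j S
    by (simp add: st_def budget_step_def)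
  have run: "result (?rn xs) = (fold st xs {}, {})" for xs
    by (simp add: threshold_budget_def result_fold_timed st_def)
  interpret sieve N r \<phi> I st "{}" "\<lambda>_. True" "\<lambda>S. (S, {})" ?rn
    by unfold_locales (auto simp: run step)
  let ?c = "card N * (2 * (card N + 1) + 2 * u)"
  have run_cost: "cost (?rn xs) \<le> ?c" if u: "\<forall>Y\<subseteq>N. f_time I Y \<le> u" and xs: "distinct xs" "set xs \<subseteq> N" for xs
  proof -
    have "cost (fold_timed (budget_step I b B \<tau>) xs {}) \<le> ?c"
    proof (rule cost_fold_products_le[OF xs, where P = "\<lambda>S. S \<subseteq> N"])
      fix j S assume "j \<in> N" "S \<subseteq> N"
      then show "result (budget_step I b B \<tau> j S) \<subseteq> N \<and>
          cost (budget_step I b B \<tau> j S) \<le> 2 * (card N + 1) + 2 * u"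
        using u[rule_format, of S] u[rule_format, of "insert j S"] by (simp add: budget_step_def)
    qed simp
    then show ?thesis by (simp add: threshold_budget_def)
  qed
  obtain t \<pi> where t: "framework_loop I ?rn = Some t" and \<pi>: "complete_pass \<pi>"
    and res: "result t = state_after \<pi>"
    and cst: "(\<forall>xs. distinct xs \<and> set xs \<subseteq> N \<longrightarrow> cost (?rn xs) \<le> ?c) \<and> (\<forall>Y\<subseteq>N. U_time I Y \<le> u) \<longrightarrow>
       cost t \<le> loop_cost (card N) ?c u"
    using framework_loop_complete_pass[of ?c u] by auto
  have kept: "kept p = state_after p" for p by (simp add: kept_def)
  have dist: "distinct \<pi>" "set \<pi> \<subseteq> N" using \<pi> by (auto simp: complete_pass_def)
  let ?S = "state_after \<pi>"
  have SN: "?S \<subseteq> N" using inv_kept[OF dist] dist kept by auto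
  have inv: "sum b (state_after p) \<le> B \<and> (\<forall>j\<in>state_after p. \<tau> * b j \<le> gain \<pi> j) \<and>
      (0 \<le> \<tau> \<longrightarrow> (\<forall>j\<in>set p - state_after p.
         b j > B \<or> gain \<pi> j < \<tau> * b j \<or> \<tau> * B \<le> f ?S + f {j}))"
    if "\<exists>q. \<pi> = p @ q" for p
    using \<pi> that
  proof (induction rule: prefix_induct)
    case Nil
    then show ?case using B by simp
  next
    case (snoc p j q)
    let ?Q = "state_after p"
    have Q: "?Q \<subseteq> set p" using inv_kept[of p] snoc(2,3) kept by auto
    then have j: "j \<notin> ?Q" "finite ?Q" "insert j ?Q \<subseteq> N" "?Q \<subseteq> N" "j \<in> N"
      using snoc(2,3) finite_subset by auto
    have bj: "0 < b j" using b j by auto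
    have g: "gain \<pi> j = f (insert j ?Q) - f ?Q"
      using gain_split[of p j q] dist(1) snoc(1) kept by simp
    have new: "state_after (p @ [j]) = (if b j \<le> B \<and> sum b ?Q < B \<and> b j < B - sum b ?Q \<and>
        \<tau> * b j \<le> gain \<pi> j then insert j ?Q else ?Q)"
      using j g f_oracle_eq bj by (simp add: step pos_le_divide_eq)
    \<comment> \<open>The products kept so far and \<open>j\<close> cost at least \<open>B\<close> together.\<close>
    have "\<tau> * B \<le> f ?S + f {j}"
      if full: "B - sum b ?Q \<le> b j" and ge: "\<tau> * b j \<le> gain \<pi> j" and \<tau>: "0 \<le> \<tau>"
    proof -
      have QS: "?Q \<subseteq> ?S" using kept_append[of p "j # q"] dist snoc(1) kept by auto
      have "\<tau> * sum b ?Q \<le> f ?Q" by (rule density_lower[OF \<pi>]) (use snoc(4) QS kept in auto)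
      then have "\<tau> * (sum b ?Q + b j) \<le> f (insert j ?Q)" using ge g by (simp add: algebra_simps)
      moreover have "\<tau> * B \<le> \<tau> * (sum b ?Q + b j)" using full \<tau> by (intro mult_left_mono) auto
      moreover have "f (insert j ?Q) \<le> f {j} + f ?Q" using f_subadditive[of "{j}" ?Q] j by simp
      moreover have "f ?Q \<le> f ?S" using QS SN by (rule f_mono)
      ultimately show ?thesis by linarith
    qed
    note full = this
    have rejected: "b j > B \<or> gain \<pi> j < \<tau> * b j \<or> \<tau> * B \<le> f ?S + f {j}"
      if "state_after (p @ [j]) = ?Q" "0 \<le> \<tau>"
    proof (rule ccontr)
      assume "\<not> ?thesis"
      then have *: "b j \<le> B" "\<tau> * b j \<le> gain \<pi> j" "\<not> \<tau> * B \<le> f ?S + f {j}" by auto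
      then have "b j < B - sum b ?Q" using full that(2) by linarith
      then have "state_after (p @ [j]) = insert j ?Q" using new * bj by simp
      then show False using that(1) j(1) by auto
    qed
    show ?case
    proof (cases "state_after (p @ [j]) = ?Q")
      case True
      then show ?thesis using snoc(4) rejected by auto
    next
      case False
      then show ?thesis using snoc(4) new j Q snoc(2) by (auto split: if_splits)
    qed
  qed
  have up: "f X \<le> f ?S + \<tau> * B"
    if \<tau>: "0 \<le> \<tau>" and no: "\<not> (\<exists>j\<in>N. b j \<le> B \<and> \<tau> * B \<le> f ?S + f {j})"
      and X: "X \<subseteq> N" "sum b X \<le> B" for X
  proof -
    have finX: "finite X" using X finite_sub by auto
    have small: "b j \<le> B" if "j \<in> X" for j
      using member_le_sum[of j X b] that X b finX by force
    have "f X \<le> f (kept \<pi>) + \<tau> * sum b X"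
    proof (rule density_upper[OF \<pi> X(1) _ \<tau>])
      fix j assume "j \<in> X \<inter> set \<pi> - kept \<pi>"
      then show "gain \<pi> j \<le> \<tau> * b j" using inv[of \<pi>] \<tau> no small[of j] X kept by force
    qed (use b in \<open>auto intro: less_imp_le\<close>)
    moreover have "\<tau> * sum b X \<le> \<tau> * B" using \<tau> X(2) by (intro mult_left_mono) auto
    ultimately show ?thesis using kept by simp
  qed
  show ?thesis
    using t res SN inv[of \<pi>] up cst run_cost unfolding budget_good_def
    by (intro exI[of _ t]) auto
qed

text \<open>
  With \<open>\<tau> * B\<close> just below \<open>2 * f(X) / 3\<close>, either \<open>S\<close> or the product that did not fit is worth half of
  \<open>\<tau> * B\<close>, or \<open>f(S) \<ge> f(X) - \<tau> * B \<ge> f(X) / 3\<close>. If no threshold is that small, a single product is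
  worth \<open>2 * f(X) / 3\<close>.
\<close>

lemma budget_guarantee:
  assumes \<epsilon>: "0 < \<epsilon>" "\<epsilon> < 1" and B: "0 < B" and b: "\<forall>i\<in>N. 0 < b i"
    and cheap: "cheap \<Longrightarrow> (\<forall>Y\<subseteq>N. f_time I Y \<le> u) \<and> (\<forall>Y\<subseteq>N. U_time I Y \<le> u)"
  shows "\<exists>out. framework (threshold_budget I \<epsilon> b B) I = Some out \<and>
     approximate_solution ((1 - \<epsilon>) / 3) {S. S \<subseteq> N \<and> sum b S \<le> B} f (result out) \<and>
     (cheap \<longrightarrow> cost out \<le> (card N * u + (card N + 1) + number_of_thresholds \<epsilon> (card N))
       + number_of_thresholds \<epsilon> (card N) * loop_cost (card N) (card N * (2 * (card N + 1) + 2 * u)) u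
       + (card N + 1) + (number_of_thresholds \<epsilon> (card N) + card N) * (u + 1))"
proof -
  let ?A = "threshold_budget I \<epsilon> b B" and ?E = "{e \<in> N. b e \<le> B}"
  let ?F = "{S. S \<subseteq> N \<and> sum b S \<le> B}" and ?L = "number_of_thresholds \<epsilon> (card N)"
  have settings: "settings ?A = thresholds I \<epsilon> ?E B (card N)"
    by (simp add: threshold_budget_def)
  have EN: "?E \<subseteq> N" by auto
  have finE: "finite ?E" using finite_N by simp
  have cand: "result (candidates ?A Ss) = Ss @ map (\<lambda>e. {e}) (arrange I ?E)"
    "cost (candidates ?A Ss) = card N + 1" for Ss
    by (simp_all add: threshold_budget_def)
  have lenE: "length (arrange I ?E) \<le> card N"
    using length_arrange[OF finE] card_mono[OF finite_N EN] by simp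
  show ?thesis
  proof (rule framework_guarantee[where good = "budget_good b B"])
    show "\<exists>t. framework_loop I (run ?A \<tau>) = Some t \<and> budget_good b B \<tau> (result t) \<and>
       (cheap \<longrightarrow> cost t \<le> loop_cost (card N) (card N * (2 * (card N + 1) + 2 * u)) u)" for \<tau>
      using budget_loop[OF b B, of \<epsilon> \<tau> u] cheap by blast
    show "cheap \<Longrightarrow> cost (settings ?A) \<le> card N * u + (card N + 1) + ?L \<and>
        length (result (settings ?A)) \<le> ?L"
      unfolding settings using cost_thresholds_le[OF EN, of u] cheap length_thresholds by auto
    show "cheap \<Longrightarrow> Y \<subseteq> N \<Longrightarrow> f_time I Y \<le> u" for Y using cheap by auto
    show "?F \<subseteq> Pow N" by auto
    fix Ss assume ex: "\<forall>\<tau>\<in>set (result (settings ?A)). \<exists>S\<in>set Ss. budget_good b B \<tau> S"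
      and all: "\<forall>S\<in>set Ss. \<exists>\<tau>\<in>set (result (settings ?A)). budget_good b B \<tau> S"
      and len: "length Ss = length (result (settings ?A))"
    have ne: "Ss \<noteq> []" using len thresholds_nonempty unfolding settings by auto
    let ?Cs = "set Ss \<union> (\<lambda>e. {e}) ` ?E"
    have "\<exists>C\<in>?Cs. (1 - \<epsilon>) / 3 * f X \<le> f C" if X: "X \<subseteq> N" "sum b X \<le> B" and pos: "0 < f X" for X
    proof -
      let ?v = "best_singleton ?E"
      have finX: "finite X" using X finite_sub by auto
      have "b j \<le> B" if "j \<in> X" for j
        using member_le_sum[of j X b] that X b finX by force
      then have XE: "X \<subseteq> ?E" using X by auto
      have v: "0 < ?v" and fX: "f X \<le> real (card X) * ?v" and "?E \<noteq> {}"
        using best_singleton_pos[OF EN XE] pos by auto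
      then obtain e where e: "e \<in> ?E" "f {e} = ?v" using best_singleton_attained[OF EN] by metis
      have fXn: "f X \<le> real (card N) * ?v"
      proof -
        have "real (card X) * ?v \<le> real (card N) * ?v"
          using v card_mono[OF finite_N X(1)] by (intro mult_right_mono) auto
        then show ?thesis using fX by simp
      qed
      have shrink: "(1 - \<epsilon>) / 3 * f X \<le> f X / 3"
        using \<epsilon> pos by (simp add: algebra_simps)
      show ?thesis
      proof (cases "2 / 3 * f X < ?v")
        case True
        then have "(1 - \<epsilon>) / 3 * f X \<le> f {e}" using shrink e(2) pos by linarith
        then show ?thesis using e(1) by blast
      next
        case F: False
        let ?x = "2 / 3 * f X / B"
        have x1: "?v / B \<le> ?x" using F B by (intro divide_right_mono) auto
        have x2: "?x \<le> real (card N) * ?v / B"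
          using fXn pos B by (intro divide_right_mono) auto
        obtain \<tau> where \<tau>: "\<tau> \<in> set (result (thresholds I \<epsilon> ?E B (card N)))" "0 < \<tau>" "\<tau> \<le> ?x" "?x \<le> (1 + \<epsilon>) * \<tau>"
          by (rule threshold_near[OF \<epsilon>(1) B v x1 x2])
        obtain S where S: "S \<in> set Ss" "budget_good b B \<tau> S"
          by (rule bexE[OF bspec[OF ex[unfolded settings] \<tau>(1)]]) (rule that)
        have up: "\<tau> * B \<le> 2 / 3 * f X" using \<tau>(3) B by (simp add: field_simps)
        have lo: "(1 - \<epsilon>) * (2 / 3 * f X) \<le> \<tau> * B"
          by (rule one_minus_times_le[OF \<epsilon>(2)]) (use \<tau>(2,4) B in \<open>simp_all add: field_simps\<close>)
        from S(2) \<tau>(2) consider j where "j \<in> N" "b j \<le> B" "\<tau> * B \<le> f S + f {j}"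
          | "f X \<le> f S + \<tau> * B" using X unfolding budget_good_def by fastforce
        then show ?thesis
        proof cases
          case 1
          then have "(1 - \<epsilon>) / 3 * f X \<le> f S \<or> (1 - \<epsilon>) / 3 * f X \<le> f {j}" using lo by argo
          then show ?thesis using 1 S(1) by blast
        next
          case 2
          then have "(1 - \<epsilon>) / 3 * f X \<le> f S" using up shrink by linarith
          then show ?thesis using S(1) by blast
        qed
      qed
    qed
    moreover have "?Cs \<subseteq> ?F" using all unfolding budget_good_def by force
    moreover have "set (result (candidates ?A Ss)) = ?Cs"
      unfolding cand using set_arrange[OF finE] by simp
    ultimately show "set (result (candidates ?A Ss)) \<subseteq> ?F \<and> result (candidates ?A Ss) \<noteq> [] \<and>
        (\<forall>X\<in>?F. 0 < f X \<longrightarrow> (\<exists>C\<in>set (result (candidates ?A Ss)). (1 - \<epsilon>) / 3 * f X \<le> f C)) \<and>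
        (cheap \<longrightarrow> cost (candidates ?A Ss) \<le> card N + 1 \<and>
          length (result (candidates ?A Ss)) \<le> ?L + card N)"
      using ne len length_thresholds lenE unfolding cand settings by simp
  qed
qed

end

section \<open>Enumerate-Budget\<close>

lemma set_small_subsets:
  "distinct xs \<Longrightarrow> set (result (small_subsets m xs)) = {X. X \<subseteq> set xs \<and> card X \<le> m}"
proof (induction m xs rule: small_subsets.induct)
  case (1 xs)
  have "X = {}" if "X \<subseteq> set xs" "card X = 0" for X
    using that finite_subset[OF that(1)] by simp
  then show ?case by auto
next
  case (2 m)
  then show ?case by auto
next
  case (3 m x xs)
  let ?A = "set xs"
  have IH: "set (result (small_subsets m xs)) = {X. X \<subseteq> ?A \<and> card X \<le> m}"
    "set (result (small_subsets (Suc m) xs)) = {X. X \<subseteq> ?A \<and> card X \<le> Suc m}"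
    using 3 by simp_all
  have x: "x \<notin> ?A" using 3 by simp
  let ?L = "{X. X \<subseteq> ?A \<and> card X \<le> m}" and ?R = "{X. X \<subseteq> insert x ?A \<and> card X \<le> Suc m}"
  have "insert x ` ?L \<union> {X. X \<subseteq> ?A \<and> card X \<le> Suc m} = ?R"
  proof (intro equalityI subsetI)
    fix X assume "X \<in> insert x ` ?L \<union> {X. X \<subseteq> ?A \<and> card X \<le> Suc m}"
    then show "X \<in> ?R"
    proof
      assume "X \<in> insert x ` ?L"
      then obtain Y where Y: "Y \<subseteq> ?A" "card Y \<le> m" "X = insert x Y" by blast
      then have "card X \<le> Suc m" using card_insert_le_m1[of "Suc m" Y x] by simp
      then show ?thesis using Y by auto
    qed auto
  next
    fix X assume X: "X \<in> ?R"
    show "X \<in> insert x ` ?L \<union> {X. X \<subseteq> ?A \<and> card X \<le> Suc m}"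
    proof (cases "x \<in> X")
      case True
      have "finite X" using X finite_subset[of X "insert x ?A"] by simp
      then have "X - {x} \<in> ?L" using X True by auto
      moreover have "X = insert x (X - {x})" using True by auto
      ultimately show ?thesis by (intro UnI1) (rule image_eqI)
    next
      case False
      then show ?thesis using X by auto
    qed
  qed
  then show ?case using IH by simp
qed

text \<open>
  This bound and the next one follow the recursion, with \<open>n ^ m + n ^ (m + 1) \<le> (n + 1) ^ (m + 1)\<close>. Two
  more factors pay for the charge that each call makes for the sets that it returns.
\<close>

lemma length_small_subsets: "length (result (small_subsets m xs)) \<le> (length xs + 1) ^ m"
proof (induction m xs rule: small_subsets.induct)
  case (3 m x xs)
  let ?n = "length xs + 1"
  have "length (result (small_subsets (Suc m) (x # xs))) \<le> ?n ^ m + ?n ^ Suc m"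
    using 3 by simp
  also have "\<dots> = (?n + 1) * ?n ^ m" by simp
  also have "\<dots> \<le> (?n + 1) * (?n + 1) ^ m" by (intro mult_le_mono2 power_mono) auto
  finally show ?case by simp
qed simp_all

lemma cost_small_subsets: "cost (small_subsets m xs) \<le> (length xs + 1) ^ (m + 2)"
proof (induction m xs rule: small_subsets.induct)
  case (3 m x xs)
  let ?n = "length xs + 1"
  have 1: "?n ^ Suc m + ?n ^ m \<le> (?n + 1) ^ Suc m" for m
  proof -
    have "?n ^ Suc m + ?n ^ m = (?n + 1) * ?n ^ m" by simp
    also have "\<dots> \<le> (?n + 1) * (?n + 1) ^ m" by (intro mult_le_mono2 power_mono) auto
    finally show ?thesis by simp
  qed
  have 2: "length xs * (length (result (small_subsets m xs)) + length (result (small_subsets (Suc m) xs)))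
      \<le> length xs * (?n + 1) ^ Suc m"
    using length_small_subsets[of m xs] length_small_subsets[of "Suc m" xs] 1[of m]
    by (intro mult_le_mono2) linarith
  have 3: "cost (small_subsets m xs) \<le> ?n ^ (m + 2)"
    "cost (small_subsets (Suc m) xs) \<le> ?n ^ (Suc m + 2)"
    using 3 by simp_all
  have "cost (small_subsets (Suc m) (x # xs))
      \<le> ?n ^ (m + 2) + ?n ^ (Suc m + 2) + (1 + length xs * (?n + 1) ^ Suc m)"
  proof -
    have "cost (small_subsets (Suc m) (x # xs)) = cost (small_subsets m xs) + cost (small_subsets (Suc m) xs)
      + (1 + length xs * (length (result (small_subsets m xs)) + length (result (small_subsets (Suc m) xs))))"
      by simp
    also have "\<dots> \<le> ?n ^ (m + 2) + ?n ^ (Suc m + 2) + (1 + length xs * (?n + 1) ^ Suc m)"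
      by (rule add_mono[OF add_mono[OF 3] add_left_mono[OF 2]])
    finally show ?thesis .
  qed
  also have "\<dots> = (?n + 1) * ?n ^ (m + 2) + (1 + length xs * (?n + 1) ^ Suc m)" by simp
  also have "\<dots> \<le> (?n + 1) * ?n ^ (m + 2) + (?n + 1) * (?n + 1) ^ Suc m"
  proof -
    have "1 \<le> (?n + 1) ^ Suc m" by (rule one_le_power) simp
    then have "1 + length xs * (?n + 1) ^ Suc m \<le> (?n + 1) ^ Suc m + length xs * (?n + 1) ^ Suc m"
      by (rule add_right_mono)
    also have "\<dots> = ?n * (?n + 1) ^ Suc m" by (simp only: add_mult_distrib mult_1 add.commute)
    also have "\<dots> \<le> (?n + 1) * (?n + 1) ^ Suc m" by (rule mult_le_mono1) simp
    finally show ?thesis by (rule add_left_mono)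
  qed
  also have "\<dots> = (?n + 1) * (?n ^ Suc (Suc m) + (?n + 1) ^ Suc m)"
    by (simp only: add_mult_distrib2 add_2_eq_Suc')
  also have "\<dots> \<le> (?n + 1) * (?n + 1) ^ Suc (Suc m)"
  proof (rule mult_le_mono2)
    have "?n * ?n ^ Suc m \<le> ?n * (?n + 1) ^ Suc m" by (intro mult_le_mono2 power_mono) auto
    then show "?n ^ Suc (Suc m) + (?n + 1) ^ Suc m \<le> (?n + 1) ^ Suc (Suc m)" by simp
  qed
  also have "\<dots> = (length (x # xs) + 1) ^ (Suc m + 2)" by simp
  finally show ?case .
qed simp_all

text \<open>
  The products of largest cost in an optimal set are what the enumeration guesses.
\<close>

lemma top_subset:
  fixes b :: "'b \<Rightarrow> real"
  assumes "finite A" "m \<le> card A"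
  shows "\<exists>T\<subseteq>A. card T = m \<and> (\<forall>x\<in>T. \<forall>y\<in>A - T. b y \<le> b x)"
  using assms(2)
proof (induction m)
  case 0
  then show ?case by (intro exI[of _ "{}"]) simp
next
  case (Suc m)
  then obtain T where T: "T \<subseteq> A" "card T = m" "\<forall>x\<in>T. \<forall>y\<in>A - T. b y \<le> b x" by auto
  have "A - T \<noteq> {}"
  proof
    assume "A - T = {}"
    then have "A = T" using T(1) by auto
    then show False using Suc.prems T(2) by simp
  qed
  then obtain z where z: "z \<in> A - T" "\<And>y. y \<in> A - T \<Longrightarrow> b y \<le> b z"
    using finite_maximizer[of "A - T" b] assms(1) by blast
  have "finite T" using T(1) assms(1) finite_subset by auto
  then show ?case using T z by (intro exI[of _ "insert z T"]) auto
qed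

context assortment_problem
begin

text \<open>
  Removals stop as soon as the budget is met. As each of them gives back less than \<open>\<epsilon> * B\<close>, more than
  \<open>(1 - \<epsilon>) * B\<close> remains in use. The number of iterations allows for the removal of all elements.
\<close>

lemma final_add_result:
  assumes "finite S" and \<epsilon>: "0 < \<epsilon>" and B: "0 < B"
  shows "result (final_add I \<epsilon> b B S) \<subseteq> S"
    and "B < sum b S \<Longrightarrow> (1 - \<epsilon>) * B < sum b (result (final_add I \<epsilon> b B S)) \<and>
      (sum b (result (final_add I \<epsilon> b B S)) \<le> B \<or>
       {i \<in> result (final_add I \<epsilon> b B S). b i < \<epsilon> * B} = {})"
proof -
  define T where "T n = fold (\<lambda>_. final_add_step I \<epsilon> b B) [0..<n] S" for n
  have T_0: "T 0 = S" and T_Suc: "T (Suc n) = final_add_step I \<epsilon> b B (T n)" for n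
    by (simp_all add: T_def)
  have sub: "T n \<subseteq> S" for n
  proof (induction n)
    case (Suc n)
    then show ?case unfolding T_Suc final_add_step_def by auto
  qed (simp add: T_0)
  have fin: "finite (T n)" for n using sub assms(1) finite_subset by blast
  have inv: "(1 - \<epsilon>) * B < sum b (T n) \<and>
      (sum b (T n) \<le> B \<or> {i \<in> T n. b i < \<epsilon> * B} = {} \<or> card (T n) + n \<le> card S)"
    if "B < sum b S" for n
  proof (induction n)
    case 0
    have "0 < \<epsilon> * B" using \<epsilon> B by simp
    then show ?case using that by (simp add: T_0 algebra_simps)
  next
    case (Suc n)
    show ?case
    proof (cases "B < sum b (T n) \<and> {i \<in> T n. b i < \<epsilon> * B} \<noteq> {}")
      case True
      define i where "i = pick I {i \<in> T n. b i < \<epsilon> * B}"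
      have "i \<in> {i \<in> T n. b i < \<epsilon> * B}"
        unfolding i_def by (rule pick_in) (use True fin in auto)
      then have i: "i \<in> T n" "b i < \<epsilon> * B" by auto
      have eq: "T (Suc n) = T n - {i}" unfolding T_Suc final_add_step_def i_def using True by simp
      have "sum b (T n - {i}) = sum b (T n) - b i" "card (T n - {i}) + 1 = card (T n)"
        using i(1) fin card_Suc_Diff1[of "T n" i] by (simp_all add: sum_diff1)
      moreover have "(1 - \<epsilon>) * B = B - \<epsilon> * B" by (simp add: algebra_simps)
      moreover have "card (T n) + n \<le> card S" using Suc True by linarith
      ultimately have "(1 - \<epsilon>) * B < sum b (T n - {i})" "card (T n - {i}) + Suc n \<le> card S"
        using True i(2) by linarith+
      then show ?thesis unfolding eq by blast
    next
      case False
      then have "T (Suc n) = T n" unfolding T_Suc final_add_step_def by auto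
      then show ?thesis using Suc False by auto
    qed
  qed
  have res: "result (final_add I \<epsilon> b B S) = T (card S)"
    by (simp add: final_add_def result_fold_timed T_def)
  show "result (final_add I \<epsilon> b B S) \<subseteq> S" unfolding res by (rule sub)
  assume "B < sum b S"
  note inv = inv[OF this, of "card S"]
  have "{i \<in> T (card S). b i < \<epsilon> * B} = {}" if "card (T (card S)) + card S \<le> card S"
    using that fin by simp
  then show "(1 - \<epsilon>) * B < sum b (result (final_add I \<epsilon> b B S)) \<and>
      (sum b (result (final_add I \<epsilon> b B S)) \<le> B \<or>
       {i \<in> result (final_add I \<epsilon> b B S). b i < \<epsilon> * B} = {})"
    unfolding res using inv by blast
qed

lemma cost_final_add: "cost (final_add I \<epsilon> b B S) = card S * (card N + 1)"
proof -
  have "cost (fold_timed (\<lambda>_ T. bind_timed (set_ops I) (\<lambda>_. ret (g T))) xs S) = length xs * (card N + 1)"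
    for g :: "'a set \<Rightarrow> 'a set" and xs :: "nat list" and S
    by (induction xs arbitrary: S) simp_all
  then show ?thesis unfolding final_add_def by simp
qed

lemma restricted_products_sub: "restricted_products N b X \<subseteq> N"
  by (auto simp: restricted_products_def)

text \<open>
  Final-Add can get stuck with a set over the budget that has no small element left. This case is
  excluded only later, by the choice of \<open>X\<close>.
\<close>

definition enumerate_good :: "real \<Rightarrow> ('a \<Rightarrow> real) \<Rightarrow> real \<Rightarrow> 'a set \<times> real \<Rightarrow> 'a set \<Rightarrow> bool" where
  "enumerate_good \<epsilon> b B = (\<lambda>(X, \<tau>) S. S \<subseteq> restricted_products N b X \<and> (0 \<le> \<tau> \<longrightarrow>
       (sum b S \<le> B \<and> (\<tau> * ((1 - \<epsilon>) * B) \<le> f S \<or>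
          (\<forall>Z\<subseteq>restricted_products N b X. sum b Z \<le> B \<longrightarrow> f Z \<le> f S + \<tau> * sum b Z))) \<or>
       (B < sum b S \<and> {i \<in> S. b i < \<epsilon> * B} = {})))"

lemma enumerate_loop:
  assumes b: "\<forall>i\<in>N. 0 < b i" and B: "0 < B" and \<epsilon>: "0 < \<epsilon>"
  shows "\<exists>t. framework_loop I (run (enumerate_budget I \<epsilon> b B) (X, \<tau>)) = Some t \<and>
    enumerate_good \<epsilon> b B (X, \<tau>) (result t) \<and>
    ((\<forall>Y\<subseteq>N. f_time I Y \<le> u) \<and> (\<forall>Y\<subseteq>N. U_time I Y \<le> u) \<longrightarrow>
       cost t \<le> loop_cost (card N) (card N * (2 * (card N + 1) + 2 * u + card N * (card N + 1))) u)"
proof -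
  define E where "E = restricted_products N b X"
  define st where "st = (\<lambda>j s. result (enumerate_step I \<epsilon> b B (X, \<tau>) j s))"
  let ?rn = "run (enumerate_budget I \<epsilon> b B) (X, \<tau>)"
  let ?sets = "\<lambda>(S, R, stopped :: bool). (S, R)"
  let ?inv = "\<lambda>(S, R, stopped). S \<subseteq> N \<and> (\<not> stopped \<longrightarrow> R = {})"
  let ?T = "\<lambda>S. result (final_add I \<epsilon> b B S)"
  have EN: "E \<subseteq> N" unfolding E_def by (rule restricted_products_sub)
  have step: "st j (S, R, stopped) =
      (if \<not> stopped \<and> j \<in> E \<and> sum b S < B
       then if \<tau> \<le> (f_oracle I (insert j S) - f_oracle I S) / b j
            then if b j + sum b S \<le> B then (insert j S, R, False)
                 else (?T (insert j S), insert j S - ?T (insert j S), True)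
            else (S, R, False)
       else (S, R, stopped))" for j S R stopped
    by (simp add: st_def enumerate_step_def E_def)
  have run: "result (?rn xs) = ?sets (fold st xs ({}, {}, False))" for xs
    by (simp add: enumerate_budget_def result_fold_timed st_def split: prod.splits)
  have T_sub: "?T S \<subseteq> S" if "S \<subseteq> N" for S
    using final_add_result(1)[OF finite_sub[OF that] \<epsilon> B] .
  interpret sieve N r \<phi> I st "({}, {}, False)" ?inv ?sets ?rn
  proof
    show "result (?rn xs) = ?sets (fold st xs ({}, {}, False))" for xs by (rule run)
    fix s j
    assume inv: "?inv s" and j: "j \<in> N" "j \<notin> fst (?sets s) \<union> snd (?sets s)"
    obtain S R stopped where s: "s = (S, R, stopped)" by (cases s) auto
    have jS: "insert j S \<subseteq> N" using inv j s by auto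
    show "?inv (st j s) \<and> (st j s = s \<or>
        fst (?sets (st j s)) \<union> snd (?sets (st j s)) = insert j (fst (?sets s) \<union> snd (?sets s)))"
      unfolding s step using inv[unfolded s] T_sub[OF jS] jS by auto
  qed auto
  let ?c1 = "2 * (card N + 1) + 2 * u + card N * (card N + 1)"
  let ?c = "card N * ?c1"
  have run_cost: "cost (?rn xs) \<le> ?c" if u: "\<forall>Y\<subseteq>N. f_time I Y \<le> u" and xs: "distinct xs" "set xs \<subseteq> N" for xs
  proof -
    have "cost (fold_timed (enumerate_step I \<epsilon> b B (X, \<tau>)) xs ({}, {}, False)) \<le> ?c"
    proof (rule cost_fold_products_le[OF xs, where P = "\<lambda>s :: 'a set \<times> 'a set \<times> bool. fst s \<subseteq> N"])
      fix j and s :: "'a set \<times> 'a set \<times> bool"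
      assume j: "j \<in> N" and s: "fst s \<subseteq> N"
      obtain S R stopped where s': "s = (S, R, stopped)" by (cases s) auto
      have S: "S \<subseteq> N" "insert j S \<subseteq> N" using j s s' by auto
      then have 1: "f_time I S \<le> u" "f_time I (insert j S) \<le> u" using u by auto
      have 2: "cost (final_add I \<epsilon> b B (insert j S)) \<le> card N * (card N + 1)"
        unfolding cost_final_add using card_mono[OF finite_N S(2)] by (rule mult_le_mono1)
      have "fst (st j s) \<subseteq> N" unfolding s' step using S T_sub[OF S(2)] by auto
      moreover have "cost (enumerate_step I \<epsilon> b B (X, \<tau>) j s) \<le> ?c1"
        unfolding s' enumerate_step_def using 1 2 by (auto split: if_splits)
      ultimately show "fst (result (enumerate_step I \<epsilon> b B (X, \<tau>) j s)) \<subseteq> N \<and>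
          cost (enumerate_step I \<epsilon> b B (X, \<tau>) j s) \<le> ?c1" by (simp add: st_def)
    qed simp
    then show ?thesis by (simp add: enumerate_budget_def split: prod.splits)
  qed
  obtain t \<pi> where t: "framework_loop I ?rn = Some t" and \<pi>: "complete_pass \<pi>"
    and res: "result t = fst (?sets (state_after \<pi>))"
    and cst: "(\<forall>xs. distinct xs \<and> set xs \<subseteq> N \<longrightarrow> cost (?rn xs) \<le> ?c) \<and> (\<forall>Y\<subseteq>N. U_time I Y \<le> u) \<longrightarrow>
       cost t \<le> loop_cost (card N) ?c u"
    using framework_loop_complete_pass[of ?c u] by blast
  have dist: "distinct \<pi>" "set \<pi> \<subseteq> N" using \<pi> by (auto simp: complete_pass_def)
  \<comment> \<open>Products that Final-Add removes stay in \<open>R\<close>. The gains of those that remain in \<open>S\<close> were measured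
    while the removed ones were still present; without them, the marginal values are no smaller.\<close>
  define P where "P p = (\<lambda>(S, R, stopped). S \<union> R \<subseteq> set p \<and> S \<subseteq> E \<and> (\<forall>j\<in>S \<union> R. \<tau> * b j \<le> gain \<pi> j) \<and>
     (if stopped then (1 - \<epsilon>) * B < sum b S \<and> (sum b S \<le> B \<or> {i \<in> S. b i < \<epsilon> * B} = {})
      else R = {} \<and> sum b S \<le> B \<and> (sum b S < B \<longrightarrow> (\<forall>j\<in>set p \<inter> E - S. gain \<pi> j < \<tau> * b j))))" for p
  have inv: "P p (state_after p)" if "\<exists>q. \<pi> = p @ q" for p
    using \<pi> that
  proof (induction rule: prefix_induct)
    case Nil
    then show ?case using B by (simp add: P_def)
  next
    case (snoc p j q)
    obtain S R stopped where s: "state_after p = (S, R, stopped)" by (cases "state_after p") auto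
    have IH: "P p (S, R, stopped)" using snoc(4) s by simp
    have Sp: "S \<subseteq> set p" "R \<subseteq> set p" "S \<subseteq> E" using IH by (auto simp: P_def)
    have j: "j \<notin> S" "insert j S \<subseteq> N" "S \<subseteq> N" "j \<in> N" "j \<notin> set p"
      using snoc(2,3) Sp by auto
    have finS: "finite S" using finite_sub[OF j(3)] .
    have bj: "0 < b j" using b j by auto
    show ?case
    proof (cases "\<not> stopped \<and> j \<in> E \<and> sum b S < B")
      case False
      have "state_after (p @ [j]) = (S, R, stopped)"
        unfolding state_after_snoc s step by (rule if_not_P[OF False])
      then show ?thesis using IH False unfolding P_def by auto
    next
      case True
      then have R: "R = {}" using IH by (simp add: P_def)
      have "gain \<pi> j = f (insert j (kept p)) - f (kept p)"
        using gain_split[of p j q] dist(1) snoc(1) by simp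
      then have g: "gain \<pi> j = f (insert j S) - f S" by (simp add: kept_def s R)
      have new: "state_after (p @ [j]) = (if \<tau> * b j \<le> gain \<pi> j
          then if b j + sum b S \<le> B then (insert j S, {}, False)
               else (?T (insert j S), insert j S - ?T (insert j S), True)
          else (S, {}, False))"
        using True j g f_oracle_eq bj R by (simp add: s step pos_le_divide_eq)
      consider "\<not> \<tau> * b j \<le> gain \<pi> j" | "\<tau> * b j \<le> gain \<pi> j" "b j + sum b S \<le> B"
        | "\<tau> * b j \<le> gain \<pi> j" "B < sum b (insert j S)" using j finS by fastforce
      then show ?thesis
      proof cases
        case 1
        then have "state_after (p @ [j]) = (S, {}, False)" using new by simp
        then show ?thesis using IH True 1 unfolding P_def by auto
      next
        case 2
        then have "state_after (p @ [j]) = (insert j S, {}, False)" using new by simp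
        then show ?thesis using IH True 2 j finS R unfolding P_def by auto
      next
        case 3
        then have "state_after (p @ [j]) = (?T (insert j S), insert j S - ?T (insert j S), True)"
          using new j finS by simp
        moreover have "finite (insert j S)" using finS by simp
        ultimately show ?thesis
          using IH True R 3(1) T_sub[OF j(2)] final_add_result(2)[OF _ \<epsilon> B 3(2)]
          unfolding P_def by auto
      qed
    qed
  qed
  obtain S R stopped where s: "state_after \<pi> = (S, R, stopped)" by (cases "state_after \<pi>") auto
  have P: "P \<pi> (S, R, stopped)" using inv[of \<pi>] s by simp
  have kept: "kept \<pi> = S \<union> R" by (simp add: kept_def s)
  have SE: "S \<subseteq> E" and high: "\<forall>j\<in>S. \<tau> * b j \<le> gain \<pi> j" using P by (auto simp: P_def)
  have SN: "S \<subseteq> N" using SE EN by auto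
  have "\<tau> * sum b S \<le> f S" by (rule density_lower[OF \<pi>]) (use high kept in auto)
  then have low: "\<tau> * ((1 - \<epsilon>) * B) \<le> f S" if "0 \<le> \<tau>" "(1 - \<epsilon>) * B \<le> sum b S"
    using mult_left_mono[OF that(2,1)] by linarith
  have "(sum b S \<le> B \<and> (\<tau> * ((1 - \<epsilon>) * B) \<le> f S \<or> (\<forall>Z\<subseteq>E. sum b Z \<le> B \<longrightarrow> f Z \<le> f S + \<tau> * sum b Z))) \<or>
      (B < sum b S \<and> {i \<in> S. b i < \<epsilon> * B} = {})" if \<tau>: "0 \<le> \<tau>"
  proof (cases stopped)
    case True
    then show ?thesis using P low[OF \<tau>] by (auto simp: P_def)
  next
    case False
    then have R: "R = {}" and SB: "sum b S \<le> B" using P by (auto simp: P_def)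
    show ?thesis
    proof (cases "sum b S < B")
      case F: False
      have "0 < \<epsilon> * B" using \<epsilon> B by simp
      then have "(1 - \<epsilon>) * B \<le> sum b S" using F by (simp add: algebra_simps)
      then show ?thesis using low[OF \<tau>] SB by auto
    next
      case True
      have "f Z \<le> f S + \<tau> * sum b Z" if Z: "Z \<subseteq> E" for Z
      proof -
        have "f Z \<le> f (kept \<pi>) + \<tau> * sum b Z"
          by (rule density_upper[OF \<pi> _ _ \<tau>])
            (use P False True Z EN b kept in \<open>auto simp: P_def intro: less_imp_le\<close>)
        then show ?thesis using kept R by simp
      qed
      then show ?thesis using SB by auto
    qed
  qed
  then show ?thesis
    using t res SE cst run_cost s unfolding enumerate_good_def prod.case E_def[symmetric] by (intro exI[of _ t]) auto
qed

text \<open>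
  On the subsets of an ideal set, \<open>f\<close> is submodular: removing \<open>i\<close> from all of \<open>S\<close> loses at most what
  removing \<open>i\<close> loses after other products have been removed.
\<close>

lemma sum_losses_le:
  assumes "ideal r \<phi> Y S" "Y \<subseteq> N" "T \<subseteq> S"
  shows "(\<Sum>i\<in>T. f S - f (S - {i})) \<le> f S - f (S - T)"
proof -
  have SN: "S \<subseteq> N" using ideal_subset[OF assms(1)] assms(2) by auto
  have "finite T" using assms(3) SN finite_sub by auto
  then show ?thesis using assms(3)
  proof (induction T rule: finite_induct)
    case (insert x F)
    have "f ({x} \<union> (S - {x})) - f (S - {x}) \<le> f ({x} \<union> (S - insert x F)) - f (S - insert x F)"
      by (rule ideal_decreasing[OF assms(1,2)]) (use insert.prems ideal_subset[OF assms(1)] in auto)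
    moreover have "{x} \<union> (S - {x}) = S" "{x} \<union> (S - insert x F) = S - F"
      using insert.prems insert.hyps by auto
    ultimately show ?case using insert by simp
  qed simp
qed

lemma enumerated_sets_bounds:
  shows "set (result (enumerated_sets I \<epsilon> b B)) = {X. X \<subseteq> N \<and> card X \<le> nat \<lfloor>1 / \<epsilon>\<rfloor> \<and> sum b X \<le> B}"
    and "length (result (enumerated_sets I \<epsilon> b B)) \<le> (card N + 1) ^ nat \<lfloor>1 / \<epsilon>\<rfloor>"
    and "cost (enumerated_sets I \<epsilon> b B) \<le>
      (card N + 1) ^ (nat \<lfloor>1 / \<epsilon>\<rfloor> + 2) + (card N + 1) ^ nat \<lfloor>1 / \<epsilon>\<rfloor> * (card N + 1)"
proof -
  let ?m = "nat \<lfloor>1 / \<epsilon>\<rfloor>" and ?xs = "arrange I N"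
  have xs: "set ?xs = N" "distinct ?xs" "length ?xs = card N"
    using set_arrange distinct_arrange length_arrange finite_N by auto
  show "set (result (enumerated_sets I \<epsilon> b B)) = {X. X \<subseteq> N \<and> card X \<le> ?m \<and> sum b X \<le> B}"
    unfolding enumerated_sets_def using set_small_subsets[OF xs(2), of ?m] xs(1) by auto
  have len: "length (result (small_subsets ?m ?xs)) \<le> (card N + 1) ^ ?m"
    using length_small_subsets[of ?m ?xs] xs(3) by simp
  then show "length (result (enumerated_sets I \<epsilon> b B)) \<le> (card N + 1) ^ ?m"
    unfolding enumerated_sets_def by (simp add: le_trans[OF length_filter_le])
  have "(\<Sum>X\<leftarrow>result (small_subsets ?m ?xs). card N + 1) \<le> (card N + 1) ^ ?m * (card N + 1)"
    using mult_le_mono1[OF len, of "card N + 1"] by (simp add: sum_list_triv del: mult_Suc_right)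
  then show "cost (enumerated_sets I \<epsilon> b B) \<le> (card N + 1) ^ (?m + 2) + (card N + 1) ^ ?m * (card N + 1)"
    unfolding enumerated_sets_def using cost_small_subsets[of ?m ?xs] xs(3)
    by (simp add: cost_map_timed)
qed

lemma enumerate_settings_bounds:
  fixes \<epsilon> :: real
  defines "K \<equiv> (card N + 1) ^ nat \<lfloor>1 / \<epsilon>\<rfloor>" and "L \<equiv> 1 + nat \<lceil>1 / ln (1 + \<epsilon>)\<rceil> * card N"
  assumes \<epsilon>: "0 < \<epsilon>"
  shows "set (result (enumerate_settings I \<epsilon> b B)) =
      (\<Union>X\<in>set (result (enumerated_sets I \<epsilon> b B)).
        Pair X ` set (result (thresholds I \<epsilon> (restricted_products N b X) B (card (restricted_products N b X)))))"
    and "length (result (enumerate_settings I \<epsilon> b B)) \<le> K * L"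
    and "\<forall>Y\<subseteq>N. f_time I Y \<le> u \<Longrightarrow> cost (enumerate_settings I \<epsilon> b B) \<le>
      (card N + 1) ^ (nat \<lfloor>1 / \<epsilon>\<rfloor> + 2) + K * (card N + 1)
       + K * (2 * (card N + 1) + card N * u + 2 * L) + K * L"
proof -
  let ?Xs = "result (enumerated_sets I \<epsilon> b B)"
  let ?E = "restricted_products N b"
  let ?ts = "\<lambda>X. thresholds I \<epsilon> (?E X) B (card (?E X))"
  have res: "result (enumerate_settings I \<epsilon> b B) = concat (map (\<lambda>X. map (Pair X) (result (?ts X))) ?Xs)"
    unfolding enumerate_settings_def by (simp add: result_map_timed Let_def)
  show "set (result (enumerate_settings I \<epsilon> b B)) = (\<Union>X\<in>set ?Xs. Pair X ` set (result (?ts X)))"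
    unfolding res by simp
  have E: "?E X \<subseteq> N" for X by (rule restricted_products_sub)
  have L: "length (result (?ts X)) \<le> L" for X
  proof -
    have "nat \<lceil>1 / ln (1 + \<epsilon>)\<rceil> * card (?E X) \<le> nat \<lceil>1 / ln (1 + \<epsilon>)\<rceil> * card N"
      by (intro mult_le_mono2 card_mono finite_N E)
    then show ?thesis
      unfolding length_thresholds L_def using number_of_thresholds_linear[OF \<epsilon>, of "card (?E X)"] by linarith
  qed
  have "length (result (enumerate_settings I \<epsilon> b B)) = (\<Sum>X\<leftarrow>?Xs. length (result (?ts X)))"
    unfolding res by (simp add: length_concat comp_def)
  also have "\<dots> \<le> length ?Xs * L" by (rule sum_list_le_length) (rule L)
  also have "\<dots> \<le> K * L" unfolding K_def by (rule mult_le_mono1) (rule enumerated_sets_bounds)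
  finally show len: "length (result (enumerate_settings I \<epsilon> b B)) \<le> K * L" .
  assume u: "\<forall>Y\<subseteq>N. f_time I Y \<le> u"
  let ?c = "2 * (card N + 1) + card N * u + 2 * L"
  have per: "card N + 1 + (cost (?ts X) + length (result (?ts X))) \<le> ?c" for X
    using cost_thresholds_le[OF E[of X], of u \<epsilon> B "card (?E X)"] u L[of X]
    by (simp add: length_thresholds)
  have "(\<Sum>X\<leftarrow>?Xs. card N + 1 + (cost (?ts X) + length (result (?ts X)))) \<le> length ?Xs * ?c"
    by (rule sum_list_le_length) (rule per)
  also have "\<dots> \<le> K * ?c" unfolding K_def by (rule mult_le_mono1) (rule enumerated_sets_bounds)
  finally have "(\<Sum>X\<leftarrow>?Xs. card N + 1 + (cost (?ts X) + length (result (?ts X)))) \<le> K * ?c" .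
  moreover have "cost (enumerate_settings I \<epsilon> b B) = cost (enumerated_sets I \<epsilon> b B)
      + (\<Sum>X\<leftarrow>?Xs. card N + 1 + (cost (?ts X) + length (result (?ts X))))
      + length (result (enumerate_settings I \<epsilon> b B))"
    unfolding res unfolding enumerate_settings_def
    by (simp add: result_map_timed cost_map_timed Let_def)
  ultimately show "cost (enumerate_settings I \<epsilon> b B) \<le>
      (card N + 1) ^ (nat \<lfloor>1 / \<epsilon>\<rfloor> + 2) + K * (card N + 1) + K * ?c + K * L"
    using enumerated_sets_bounds(3)[of \<epsilon> b B] len unfolding K_def by linarith
qed

text \<open>
  If \<open>X\<close> contains a product cheaper than \<open>\<epsilon> * B\<close>, all products of the restricted ground set outside \<open>X\<close>
  are that cheap, so a stuck set would be a subset of \<open>X\<close> and within the budget. A run with threshold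
  \<open>\<tau>\<close> then yields \<open>(1 - \<epsilon>) * \<tau> * B\<close> or \<open>f(Z) - \<tau> * \<beta> * B\<close>; the factor \<open>1 / (1 - \<epsilon> + \<beta>)\<close> balances
  the two. If the balanced threshold is below the smallest one, a single product is good enough.
\<close>

lemma enumerate_value:
  assumes \<epsilon>: "0 < \<epsilon>" "\<epsilon> < 1" and B: "0 < B" and b: "\<forall>i\<in>N. 0 < b i"
    and X: "X \<noteq> {}" "X \<subseteq> N" "card X \<le> nat \<lfloor>1 / \<epsilon>\<rfloor>" "sum b X \<le> B" and small: "Min (b ` X) < \<epsilon> * B"
    and Z: "Z \<subseteq> restricted_products N b X" "sum b Z \<le> \<beta> * B" and pos: "0 < f Z" and \<beta>: "\<epsilon> \<le> \<beta>" "\<beta> \<le> 1"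
    and ex: "\<forall>\<gamma>\<in>set (result (enumerate_settings I \<epsilon> b B)). \<exists>S\<in>set Ss. enumerate_good \<epsilon> b B \<gamma> S"
  shows "\<exists>C\<in>{S \<in> set Ss. sum b S \<le> B} \<union> set (result (enumerated_sets I \<epsilon> b B)).
    (1 - \<epsilon>) / ((1 - \<epsilon> + \<beta>) * (1 + \<epsilon>)) * f Z \<le> f C"
proof -
  let ?E = "restricted_products N b X" and ?d = "1 - \<epsilon> + \<beta>"
  let ?v = "best_singleton ?E"
  have EN: "?E \<subseteq> N" by (rule restricted_products_sub)
  have finX: "finite X" using X finite_sub by auto
  have outside: "b e \<le> Min (b ` X)" if "e \<in> ?E" "e \<notin> X" for e
    using that X(1) by (auto simp: restricted_products_def split: if_splits)
  have bX: "b e \<le> B" if "e \<in> X" for e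
    using member_le_sum[of e X b] that X b finX by force
  have MinB: "Min (b ` X) \<le> B"
  proof -
    have "Min (b ` X) \<in> b ` X" using finX X(1) by (intro Min_in) auto
    then show ?thesis using bX by auto
  qed
  have bE: "b e \<le> B" if "e \<in> ?E" for e
    using bX[of e] outside[OF that] MinB by force
  have d: "1 \<le> ?d" using \<beta> by simp
  have v: "0 < ?v" and fZ: "f Z \<le> real (card Z) * ?v" and "?E \<noteq> {}"
    using best_singleton_pos[OF EN Z(1)] pos by auto
  then obtain e where e: "e \<in> ?E" "f {e} = ?v" using best_singleton_attained[OF EN] by metis
  have fZE: "f Z \<le> real (card ?E) * ?v"
  proof -
    have "real (card Z) * ?v \<le> real (card ?E) * ?v"
      using v card_mono[OF finite_sub[OF EN] Z(1)] by (intro mult_right_mono) auto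
    then show ?thesis using fZ by simp
  qed
  define y where "y = f Z / ?d"
  have y: "0 \<le> y" "y \<le> f Z" unfolding y_def using pos d by (simp_all add: divide_le_eq mult_le_cancel_left1)
  have goal_eq: "(1 - \<epsilon>) / (?d * (1 + \<epsilon>)) * f Z = (1 - \<epsilon>) * (y / (1 + \<epsilon>))"
    by (simp add: y_def)
  have y': "y / (1 + \<epsilon>) \<le> y" using y \<epsilon> by (simp add: divide_le_eq mult_le_cancel_left1)
  have y'0: "0 \<le> y / (1 + \<epsilon>)" using y \<epsilon> by simp
  have goal_le: "(1 - \<epsilon>) * (y / (1 + \<epsilon>)) \<le> y / (1 + \<epsilon>)"
    by (rule mult_left_le_one_le) (use y'0 \<epsilon> in auto)
  show ?thesis
  proof (cases "y < ?v")
    case True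
    have "1 \<le> nat \<lfloor>1 / \<epsilon>\<rfloor>"
      using X(1,3) finX by (metis One_nat_def Suc_leI card_gt_0_iff le_trans)
    then have "{e} \<in> set (result (enumerated_sets I \<epsilon> b B))"
      using enumerated_sets_bounds(1)[of \<epsilon> b B] e(1) EN bE by auto
    moreover have "(1 - \<epsilon>) / (?d * (1 + \<epsilon>)) * f Z \<le> f {e}"
      unfolding goal_eq e(2) using True goal_le y' by linarith
    ultimately show ?thesis by blast
  next
    case F: False
    let ?x = "y / B"
    have x1: "?v / B \<le> ?x" using F B by (intro divide_right_mono) auto
    have x2: "?x \<le> real (card ?E) * ?v / B"
      using fZE y B by (intro divide_right_mono) auto
    obtain \<tau> where \<tau>: "\<tau> \<in> set (result (thresholds I \<epsilon> ?E B (card ?E)))" "0 < \<tau>" "\<tau> \<le> ?x" "?x \<le> (1 + \<epsilon>) * \<tau>"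
      by (rule threshold_near[OF \<epsilon>(1) B v x1 x2])
    have "X \<in> set (result (enumerated_sets I \<epsilon> b B))" using X enumerated_sets_bounds(1) by auto
    then have "(X, \<tau>) \<in> set (result (enumerate_settings I \<epsilon> b B))"
      unfolding enumerate_settings_bounds(1)[OF \<epsilon>(1)] using \<tau>(1) by blast
    then obtain S where S: "S \<in> set Ss" "enumerate_good \<epsilon> b B (X, \<tau>) S" using ex by blast
    have up: "\<tau> * B \<le> y" using \<tau>(3) B by (simp only: pos_le_divide_eq)
    have lo: "y / (1 + \<epsilon>) \<le> \<tau> * B"
    proof -
      have "y \<le> ((1 + \<epsilon>) * \<tau>) * B" using \<tau>(4) B by (simp only: pos_divide_le_eq)
      then have "y \<le> (\<tau> * B) * (1 + \<epsilon>)" by (simp only: mult_ac)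
      then show ?thesis using \<epsilon> by (subst pos_divide_le_eq) simp_all
    qed
    have SE: "S \<subseteq> ?E" using S(2) by (simp add: enumerate_good_def)
    have "\<not> (B < sum b S \<and> {i \<in> S. b i < \<epsilon> * B} = {})"
    proof
      assume stuck: "B < sum b S \<and> {i \<in> S. b i < \<epsilon> * B} = {}"
      have "S \<subseteq> X"
      proof
        fix i assume i: "i \<in> S"
        then have "\<not> b i < \<epsilon> * B" using stuck by auto
        then show "i \<in> X" using outside[of i] small i SE by force
      qed
      then have "sum b S \<le> sum b X" using finX X(2) b by (intro sum_mono2) (auto intro: less_imp_le)
      then show False using stuck X(4) by simp
    qed
    then have SB: "sum b S \<le> B"
      and alt: "\<tau> * ((1 - \<epsilon>) * B) \<le> f S \<or> (\<forall>Z\<subseteq>?E. sum b Z \<le> B \<longrightarrow> f Z \<le> f S + \<tau> * sum b Z)"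
      using S(2) \<tau>(2) unfolding enumerate_good_def by auto
    from alt have "(1 - \<epsilon>) * (y / (1 + \<epsilon>)) \<le> f S"
    proof
      assume "\<tau> * ((1 - \<epsilon>) * B) \<le> f S"
      moreover have "(1 - \<epsilon>) * (y / (1 + \<epsilon>)) \<le> (1 - \<epsilon>) * (\<tau> * B)"
        using lo \<epsilon> by (intro mult_left_mono) auto
      ultimately show ?thesis by (simp add: mult_ac)
    next
      assume all: "\<forall>Z\<subseteq>?E. sum b Z \<le> B \<longrightarrow> f Z \<le> f S + \<tau> * sum b Z"
      have "\<beta> * B \<le> B" using \<beta>(2) B by simp
      then have "f Z \<le> f S + \<tau> * sum b Z" using all Z by auto
      moreover have "\<tau> * sum b Z \<le> \<tau> * (\<beta> * B)" using Z(2) \<tau>(2) by (intro mult_left_mono) auto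
      moreover have "\<tau> * (\<beta> * B) = \<beta> * (\<tau> * B)" by simp
      moreover have "\<beta> * (\<tau> * B) \<le> \<beta> * y" using up \<beta> \<epsilon> by (intro mult_left_mono) auto
      moreover have "f Z = ?d * y" using d by (simp add: y_def)
      moreover have "?d * y - \<beta> * y = (1 - \<epsilon>) * y" by (simp only: left_diff_distrib[symmetric]) simp
      moreover have "(1 - \<epsilon>) * (y / (1 + \<epsilon>)) \<le> (1 - \<epsilon>) * y"
        using y' \<epsilon> by (intro mult_left_mono) auto
      ultimately show ?thesis by linarith
    qed
    then show ?thesis unfolding goal_eq using S(1) SB by blast
  qed
qed

lemma enumerate_ratio_1:
  assumes "0 < \<epsilon>" "\<epsilon> < (0.5::real)"
  shows "0.5 - \<epsilon> \<le> (1 - \<epsilon>) / ((1 - \<epsilon> + 1) * (1 + \<epsilon>))"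
proof -
  have "(0.5 - \<epsilon>) * ((1 - \<epsilon> + 1) * (1 + \<epsilon>)) = (1 - \<epsilon>) - \<epsilon> * (0.5 + 1.5 * \<epsilon> - \<epsilon>^2)"
    by (simp add: algebra_simps power2_eq_square power3_eq_cube)
  moreover have "\<epsilon>^2 \<le> \<epsilon>" using assms by (simp add: power2_eq_square mult_left_le_one_le)
  then have "0 \<le> \<epsilon> * (0.5 + 1.5 * \<epsilon> - \<epsilon>^2)" using assms by (intro mult_nonneg_nonneg) auto
  ultimately have "(0.5 - \<epsilon>) * ((1 - \<epsilon> + 1) * (1 + \<epsilon>)) \<le> 1 - \<epsilon>" by linarith
  moreover have "0 < (1 - \<epsilon> + 1) * (1 + \<epsilon>)" using assms by simp
  ultimately show ?thesis by (simp add: pos_le_divide_eq)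
qed

lemma enumerate_ratio_2:
  assumes \<epsilon>: "0 < \<epsilon>" "\<epsilon> < (0.5::real)" and m: "0 < m" "1 < \<epsilon> * (m + 1)"
  shows "0.5 - \<epsilon> \<le> (1 - \<epsilon>) / ((1 - \<epsilon> + (1 - \<epsilon>)) * (1 + \<epsilon>)) * (1 - 1 / m)"
proof -
  have me: "1 - \<epsilon> \<le> m * \<epsilon>" using m by (simp add: algebra_simps)
  have "1 \<le> (1 - \<epsilon>) + 2 * \<epsilon> * (1 - \<epsilon>)"
  proof -
    have "0 \<le> \<epsilon> * (1 - 2 * \<epsilon>)" using \<epsilon> by (intro mult_nonneg_nonneg) auto
    then show ?thesis by (simp add: algebra_simps)
  qed
  also have "\<dots> \<le> m * \<epsilon> + 2 * \<epsilon> * (m * \<epsilon>)" using me \<epsilon> by (intro add_mono mult_left_mono) auto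
  also have "\<dots> = m * (\<epsilon> + 2 * \<epsilon>^2)" by (simp add: algebra_simps power2_eq_square)
  finally have "1 / m \<le> \<epsilon> + 2 * \<epsilon>^2" using m by (simp add: pos_divide_le_eq mult.commute)
  then have "(0.5 - \<epsilon>) * (2 * (1 + \<epsilon>)) \<le> 1 - 1 / m" by (simp add: algebra_simps power2_eq_square)
  then have "0.5 - \<epsilon> \<le> (1 - 1 / m) / (2 * (1 + \<epsilon>))" using \<epsilon> by (subst pos_le_divide_eq) simp_all
  moreover have "(1 - \<epsilon>) / ((1 - \<epsilon> + (1 - \<epsilon>)) * (1 + \<epsilon>)) = 1 / (2 * (1 + \<epsilon>))"
  proof -
    have "(1 - \<epsilon> + (1 - \<epsilon>)) * (1 + \<epsilon>) = (1 - \<epsilon>) * (2 * (1 + \<epsilon>))" by (simp add: algebra_simps)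
    then show ?thesis using \<epsilon> by simp
  qed
  ultimately show ?thesis by simp
qed

text \<open>
  Replace the competitor by an ideal subset \<open>Z\<close> of the same value. If \<open>Z\<close> has at most \<open>m = \<lfloor>1 / \<epsilon>\<rfloor>\<close>
  products, it is itself enumerated. Otherwise let \<open>T\<close> be its \<open>m\<close> most costly products. If one of them
  costs less than \<open>\<epsilon> * B\<close>, the setting with \<open>X = T\<close> works. This can fail if \<open>1 / \<epsilon>\<close> is not an integer:
  then all products of \<open>T\<close> can cost at least \<open>\<epsilon> * B\<close>. In this case drop the product \<open>i \<in> T\<close> of smallest
  loss, which by submodularity is at most \<open>f(Z) / m\<close>, and guess the next product \<open>z\<close> in its place. Since
  \<open>m + 1 > 1 / \<epsilon>\<close> products of \<open>Z\<close> cost at least as much as \<open>z\<close>, it is cheaper than \<open>\<epsilon> * B\<close>. The budget that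
  \<open>i\<close> frees makes up for the loss, by \<open>enumerate_ratio_2\<close>.
\<close>

lemma enumerate_covers:
  assumes \<epsilon>: "0 < \<epsilon>" "\<epsilon> < 0.5" and B: "0 < B" and b: "\<forall>i\<in>N. 0 < b i"
    and Z0: "Z0 \<subseteq> N" "sum b Z0 \<le> B" and pos: "0 < f Z0"
    and ex: "\<forall>\<gamma>\<in>set (result (enumerate_settings I \<epsilon> b B)). \<exists>S\<in>set Ss. enumerate_good \<epsilon> b B \<gamma> S"
  shows "\<exists>C\<in>{S \<in> set Ss. sum b S \<le> B} \<union> set (result (enumerated_sets I \<epsilon> b B)).
    (0.5 - \<epsilon>) * f Z0 \<le> f C"
proof -
  let ?Cs = "{S \<in> set Ss. sum b S \<le> B} \<union> set (result (enumerated_sets I \<epsilon> b B))"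
  let ?m = "nat \<lfloor>1 / \<epsilon>\<rfloor>"
  define Z where "Z = U_oracle I Z0"
  have ideal: "ideal r \<phi> Z0 Z" unfolding Z_def using Z0(1) by (rule ideal_U)
  have ZZ0: "Z \<subseteq> Z0" using ideal_subset[OF ideal] .
  then have ZN: "Z \<subseteq> N" using Z0 by auto
  have finZ: "finite Z" using finite_sub[OF ZN] .
  have fZ: "f Z0 = f Z" using ideal_value[OF ideal Z0(1)] by simp
  have f1: "0 < f Z" using fZ pos by simp
  then have f0: "0 \<le> f Z" by simp
  have mono_b: "sum b A \<le> sum b A'" if "A \<subseteq> A'" "A' \<subseteq> N" for A A'
    using that b finite_sub by (intro sum_mono2) (auto intro: less_imp_le)
  have ZB: "sum b Z \<le> B" using mono_b[OF ZZ0 Z0(1)] Z0(2) by simp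
  have m2: "2 \<le> ?m"
  proof -
    have "2 \<le> 1 / \<epsilon>" using \<epsilon> by (simp add: field_simps)
    then have "2 \<le> \<lfloor>1 / \<epsilon>\<rfloor>" by linarith
    then show ?thesis by linarith
  qed
  have m1: "1 < \<epsilon> * (real ?m + 1)"
  proof -
    have "1 / \<epsilon> < real ?m + 1" using m2 by linarith
    then show ?thesis using \<epsilon> by (simp add: field_simps)
  qed
  show ?thesis
  proof (cases "card Z \<le> ?m")
    case True
    then have "Z \<in> ?Cs" using ZN ZB enumerated_sets_bounds(1) by auto
    moreover have "(0.5 - \<epsilon>) * f Z \<le> 1 * f Z" using f0 \<epsilon> by (intro mult_right_mono) auto
    ultimately show ?thesis using fZ by auto
  next
    case False
    then obtain T where T: "T \<subseteq> Z" "card T = ?m" and top: "\<forall>x\<in>T. \<forall>y\<in>Z - T. b y \<le> b x"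
      using top_subset[OF finZ, of ?m b] by auto
    have finT: "finite T" using T finZ finite_subset by auto
    have T0: "T \<noteq> {}" using T(2) m2 by auto
    show ?thesis
    proof (cases "Min (b ` T) < \<epsilon> * B")
      case True
      have "b y \<le> Min (b ` T)" if "y \<in> Z - T" for y
        using top that T0 finT by simp
      then have "y \<in> T \<or> \<not> Min (b ` T) < b y" if "y \<in> Z" for y
        using that by force
      then have "Z \<subseteq> restricted_products N b T"
        unfolding restricted_products_def using T0 ZN by auto
      moreover have "sum b T \<le> B" using mono_b[OF T(1) ZN] ZB by simp
      ultimately obtain C where C: "C \<in> ?Cs" "(1 - \<epsilon>) / ((1 - \<epsilon> + 1) * (1 + \<epsilon>)) * f Z \<le> f C"
        using enumerate_value[OF \<epsilon>(1) _ B b T0 _ _ _ True, of Z 1 Ss] T ZN ZB f1 \<epsilon> ex by auto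
      have "(0.5 - \<epsilon>) * f Z \<le> (1 - \<epsilon>) / ((1 - \<epsilon> + 1) * (1 + \<epsilon>)) * f Z"
        using enumerate_ratio_1[OF \<epsilon>] f0 by (rule mult_right_mono)
      then show ?thesis using C fZ by (intro bexI[OF _ C(1)]) simp
    next
      case F: False
      have large: "\<epsilon> * B \<le> b x" if "x \<in> T" for x
      proof -
        have "Min (b ` T) \<le> b x" by (rule Min_le) (use that finT in auto)
        then show ?thesis using F by linarith
      qed
      have "Z - T \<noteq> {}"
      proof
        assume "Z - T = {}"
        then have "Z = T" using T(1) by auto
        then show False using False T(2) by simp
      qed
      then obtain z where z: "z \<in> Z - T" "\<And>y. y \<in> Z - T \<Longrightarrow> b y \<le> b z"
        using finite_maximizer[of "Z - T" b] finZ by blast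
      have "\<exists>i\<in>T. f Z - f (Z - {i}) \<le> f Z / real ?m"
      proof (rule ccontr)
        assume "\<not> ?thesis"
        then have "(\<Sum>i\<in>T. f Z / real ?m) < (\<Sum>i\<in>T. f Z - f (Z - {i}))"
          using finT T0 by (intro sum_strict_mono) auto
        moreover have "(\<Sum>i\<in>T. f Z / real ?m) = f Z"
        proof -
          have "real ?m \<noteq> 0" using m2 by linarith
          then show ?thesis
            unfolding sum_constant T(2) times_divide_eq_right by (rule nonzero_mult_div_cancel_left)
        qed
        moreover have "0 \<le> f (Z - T)" using ZN by (intro f_nonneg) auto
        ultimately show False using sum_losses_le[OF ideal Z0(1) T(1)] by simp
      qed
      then obtain i where i: "i \<in> T" "f Z - f (Z - {i}) \<le> f Z / real ?m" by blast
      define X where "X = insert z (T - {i})"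
      have X: "X \<noteq> {}" "X \<subseteq> N" "card X \<le> ?m" "sum b X \<le> B"
      proof -
        show "X \<noteq> {}" by (simp add: X_def)
        have XZ: "X \<subseteq> Z" using z T by (auto simp: X_def)
        then show "X \<subseteq> N" using ZN by auto
        show "card X \<le> ?m" using T(2) i(1) z(1) finT m2 by (simp add: X_def)
        show "sum b X \<le> B" using mono_b[OF XZ ZN] ZB by simp
      qed
      have bz: "b z < \<epsilon> * B"
      proof -
        have "real ?m * b z \<le> sum b T"
          using sum_bounded_below[of T "b z" b] top z(1) T(2) by auto
        moreover have "sum b (insert z T) \<le> sum b Z" using z T by (intro mono_b ZN) auto
        then have "b z + sum b T \<le> B" using z(1) finT ZB by simp
        ultimately have 1: "(real ?m + 1) * b z \<le> B" by (simp add: algebra_simps)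
        have "B < \<epsilon> * (real ?m + 1) * B" using m1 B by simp
        also have "\<epsilon> * (real ?m + 1) * B = (real ?m + 1) * (\<epsilon> * B)" by (simp only: mult_ac)
        finally have "(real ?m + 1) * b z < (real ?m + 1) * (\<epsilon> * B)" using 1 by linarith
        then show ?thesis by (rule mult_left_less_imp_less) linarith
      qed
      have small: "Min (b ` X) < \<epsilon> * B"
      proof -
        have "Min (b ` X) \<le> b z" by (rule Min_le) (use finite_sub[OF X(2)] in \<open>auto simp: X_def\<close>)
        then show ?thesis using bz by linarith
      qed
      let ?Z = "Z - {i}"
      have "?Z \<subseteq> restricted_products N b X"
      proof
        fix y assume y: "y \<in> ?Z"
        have "b y \<le> b x" if "y \<notin> X" "x \<in> X" for x
          using that y z(2) top by (auto simp: X_def)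
        then have "b y \<le> Min (b ` X)" if "y \<notin> X"
          using that X(1) finite_sub[OF X(2)] by simp
        then show "y \<in> restricted_products N b X"
          unfolding restricted_products_def using y ZN X(1) by (auto simp: not_less)
      qed
      moreover have "sum b ?Z \<le> (1 - \<epsilon>) * B"
        using large[OF i(1)] ZB i(1) T(1) finZ by (auto simp: sum_diff1 algebra_simps)
      moreover have "0 < f ?Z"
      proof -
        have "x / y < x" if "0 < x" "1 < y" for x y :: real using that by (simp add: divide_less_eq)
        from this[OF f1, of "real ?m"] have "f Z / real ?m < f Z" using m2 by linarith
        from le_less_trans[OF i(2) this] show ?thesis by simp
      qed
      ultimately obtain C where C: "C \<in> ?Cs"
          "(1 - \<epsilon>) / ((1 - \<epsilon> + (1 - \<epsilon>)) * (1 + \<epsilon>)) * f ?Z \<le> f C"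
        using enumerate_value[OF \<epsilon>(1) _ B b X small, of ?Z "1 - \<epsilon>" Ss] \<epsilon> ex by auto
      let ?q = "(1 - \<epsilon>) / ((1 - \<epsilon> + (1 - \<epsilon>)) * (1 + \<epsilon>))"
      have "(0.5 - \<epsilon>) * f Z \<le> (?q * (1 - 1 / real ?m)) * f Z"
        by (rule mult_right_mono[OF enumerate_ratio_2[OF \<epsilon> _ m1] f0]) (use m2 in linarith)
      also have "\<dots> = ?q * (f Z - f Z / real ?m)" by (simp only: mult.assoc left_diff_distrib) simp
      also have "\<dots> \<le> ?q * f ?Z" using i(2) \<epsilon> by (intro mult_left_mono) auto
      finally show ?thesis using C fZ by (intro bexI[OF _ C(1)]) simp
    qed
  qed
qed

lemma enumerate_guarantee:
  fixes \<epsilon> :: real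
  defines "K \<equiv> (card N + 1) ^ nat \<lfloor>1 / \<epsilon>\<rfloor>" and "L \<equiv> 1 + nat \<lceil>1 / ln (1 + \<epsilon>)\<rceil> * card N"
    and "K' \<equiv> (card N + 1) ^ (nat \<lfloor>1 / \<epsilon>\<rfloor> + 2)"
  assumes \<epsilon>: "0 < \<epsilon>" "\<epsilon> < 0.5" and B: "0 < B" and b: "\<forall>i\<in>N. 0 < b i"
    and cheap: "cheap \<Longrightarrow> (\<forall>Y\<subseteq>N. f_time I Y \<le> u) \<and> (\<forall>Y\<subseteq>N. U_time I Y \<le> u)"
  shows "\<exists>out. framework (enumerate_budget I \<epsilon> b B) I = Some out \<and>
     approximate_solution (0.5 - \<epsilon>) {S. S \<subseteq> N \<and> sum b S \<le> B} f (result out) \<and>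
     (cheap \<longrightarrow> cost out \<le> (K' + K * (card N + 1) + K * (2 * (card N + 1) + card N * u + 2 * L) + K * L)
       + K * L * loop_cost (card N) (card N * (2 * (card N + 1) + 2 * u + card N * (card N + 1))) u
       + (K * L * (card N + 1) + (K' + K * (card N + 1))) + (K * L + K) * (u + 1))"
proof -
  let ?A = "enumerate_budget I \<epsilon> b B" and ?F = "{S. S \<subseteq> N \<and> sum b S \<le> B}"
  let ?Xs = "result (enumerated_sets I \<epsilon> b B)"
  have settings: "settings ?A = enumerate_settings I \<epsilon> b B" by (simp add: enumerate_budget_def)
  have cand: "result (candidates ?A Ss) = filter (\<lambda>S. sum b S \<le> B) Ss @ ?Xs"
    "cost (candidates ?A Ss) = length Ss * (card N + 1) + cost (enumerated_sets I \<epsilon> b B)" for Ss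
    by (simp_all add: enumerate_budget_def cost_map_timed sum_list_triv)
  show ?thesis
  proof (rule framework_guarantee[where good = "enumerate_good \<epsilon> b B"])
    fix \<gamma> :: "'a set \<times> real"
    obtain X \<tau> where \<gamma>: "\<gamma> = (X, \<tau>)" by (cases \<gamma>) auto
    show "\<exists>t. framework_loop I (run ?A \<gamma>) = Some t \<and> enumerate_good \<epsilon> b B \<gamma> (result t) \<and>
       (cheap \<longrightarrow> cost t \<le> loop_cost (card N) (card N * (2 * (card N + 1) + 2 * u + card N * (card N + 1))) u)"
      using enumerate_loop[OF b B \<epsilon>(1), of X \<tau> u] cheap unfolding \<gamma> by blast
  next
    show "cheap \<Longrightarrow> cost (settings ?A) \<le>
          K' + K * (card N + 1) + K * (2 * (card N + 1) + card N * u + 2 * L) + K * L \<and>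
        length (result (settings ?A)) \<le> K * L"
      unfolding settings K_def L_def K'_def
      using enumerate_settings_bounds(2,3)[OF \<epsilon>(1), where b = b and B = B] cheap by blast
    show "cheap \<Longrightarrow> Y \<subseteq> N \<Longrightarrow> f_time I Y \<le> u" for Y using cheap by auto
    show "?F \<subseteq> Pow N" by auto
    fix Ss assume ex: "\<forall>\<gamma>\<in>set (result (settings ?A)). \<exists>S\<in>set Ss. enumerate_good \<epsilon> b B \<gamma> S"
      and all: "\<forall>S\<in>set Ss. \<exists>\<gamma>\<in>set (result (settings ?A)). enumerate_good \<epsilon> b B \<gamma> S"
      and len: "length Ss = length (result (settings ?A))"
    have Cs: "set (result (candidates ?A Ss)) = {S \<in> set Ss. sum b S \<le> B} \<union> set ?Xs"
      unfolding cand by auto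
    have "S \<subseteq> N" if "S \<in> set Ss" for S
      using all that restricted_products_sub unfolding enumerate_good_def by fastforce
    then have c1: "set (result (candidates ?A Ss)) \<subseteq> ?F"
      unfolding Cs enumerated_sets_bounds(1) by auto
    have "{} \<in> set ?Xs" unfolding enumerated_sets_bounds(1) using B by auto
    then have c2: "result (candidates ?A Ss) \<noteq> []" unfolding cand by auto
    have c3: "\<exists>C\<in>set (result (candidates ?A Ss)). (0.5 - \<epsilon>) * f X \<le> f C" if "X \<in> ?F" "0 < f X" for X
      unfolding Cs using that by (intro enumerate_covers[OF \<epsilon> B b _ _ _ ex[unfolded settings]]) auto
    have lenS: "length Ss \<le> K * L"
      unfolding len settings K_def L_def by (rule enumerate_settings_bounds(2)[OF \<epsilon>(1)])
    have c4: "cost (candidates ?A Ss) \<le> K * L * (card N + 1) + (K' + K * (card N + 1))"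
      unfolding cand(2) K'_def
      by (rule add_mono[OF mult_le_mono1[OF lenS] enumerated_sets_bounds(3)[of \<epsilon> b B, folded K_def]])
    have c5: "length (result (candidates ?A Ss)) \<le> K * L + K"
      unfolding cand(1) length_append
      by (rule add_mono[OF le_trans[OF length_filter_le lenS] enumerated_sets_bounds(2)[of \<epsilon> b B, folded K_def]])
    show "set (result (candidates ?A Ss)) \<subseteq> ?F \<and> result (candidates ?A Ss) \<noteq> [] \<and>
        (\<forall>X\<in>?F. 0 < f X \<longrightarrow> (\<exists>C\<in>set (result (candidates ?A Ss)). (0.5 - \<epsilon>) * f X \<le> f C)) \<and>
        (cheap \<longrightarrow> cost (candidates ?A Ss) \<le> K * L * (card N + 1) + (K' + K * (card N + 1)) \<and>
          length (result (candidates ?A Ss)) \<le> K * L + K)"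
      by (intro conjI impI ballI c1 c2 c3 c4 c5)
  qed
qed

end

section \<open>Matroid-Swap\<close>

text \<open>
  A finite form of integration over levels: match an element of largest \<open>g\<close> with some element
  where \<open>h\<close> is at least as large, remove both, and repeat.
\<close>

lemma sum_le_of_level_counts:
  fixes g :: "'b \<Rightarrow> real" and h :: "'c \<Rightarrow> real"
  assumes "finite A" "finite B" "\<And>i. i \<in> B \<Longrightarrow> 0 \<le> h i"
    and "\<And>\<theta>. card {a \<in> A. \<theta> \<le> g a} \<le> card {i \<in> B. \<theta> \<le> h i}"
  shows "sum g A \<le> sum h B"
  using assms
proof (induction "card A" arbitrary: A B)
  case 0
  then show ?case by (simp add: sum_nonneg)
next
  case (Suc n)
  then have "A \<noteq> {}" by auto
  then obtain a where a: "a \<in> A" "\<And>x. x \<in> A \<Longrightarrow> g x \<le> g a"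
    using finite_maximizer[OF Suc.prems(1), of g] by blast
  have "a \<in> {x \<in> A. g a \<le> g x}" using a by simp
  then have "0 < card {x \<in> A. g a \<le> g x}" using Suc.prems(1) by (simp add: card_gt_0_iff) blast
  then have "0 < card {i \<in> B. g a \<le> h i}" using Suc.prems(4)[of "g a"] by linarith
  then have "{i \<in> B. g a \<le> h i} \<noteq> {}" by (metis card.empty less_irrefl)
  then obtain i where i: "i \<in> B" "g a \<le> h i" by auto
  have "sum g (A - {a}) \<le> sum h (B - {i})"
  proof (rule Suc.hyps(1))
    show "n = card (A - {a})" using Suc.hyps(2) Suc.prems(1) a(1) by simp
    show "card {x \<in> A - {a}. \<theta> \<le> g x} \<le> card {x \<in> B - {i}. \<theta> \<le> h x}" for \<theta>
    proof (cases "\<theta> \<le> g a")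
      case True
      have "{x \<in> A - {a}. \<theta> \<le> g x} = {x \<in> A. \<theta> \<le> g x} - {a}"
        "{x \<in> B - {i}. \<theta> \<le> h x} = {x \<in> B. \<theta> \<le> h x} - {i}" by auto
      moreover have "a \<in> {x \<in> A. \<theta> \<le> g x}" "i \<in> {x \<in> B. \<theta> \<le> h x}" using a i True by auto
      ultimately show ?thesis using Suc.prems(4)[of \<theta>] by (simp add: card_Diff_singleton diff_le_mono)
    next
      case False
      then have "{x \<in> A - {a}. \<theta> \<le> g x} = {}" using a(2) by force
      then show ?thesis by (simp only: card.empty le0)
    qed
  qed (use Suc.prems in auto)
  moreover have "sum g A = g a + sum g (A - {a})" "sum h B = h i + sum h (B - {i})"
    using Suc.prems a i by (simp_all add: sum.remove)
  ultimately show ?case using i(2) by simp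
qed

context assortment_problem
begin

text \<open>
  The invariant \<open>P\<close> says that the values in \<open>S\<close> sum up to the gains of all kept products, that each value
  is at most twice the gain of its product (the value of the displaced product is smaller than the
  gain of the new one), and that for every \<open>\<theta>\<close> the level set \<open>{i \<in> S. \<theta> \<le> v i}\<close> spans all rejected
  products of gain at least \<open>\<theta>\<close>. The last part bounds the number of rejected products above each level
  in an independent set, hence their gains by the sum of the values in \<open>S\<close>, which is at most
  \<open>2 * f(S)\<close>. Together with the value of the kept products this is \<open>4 * f(S)\<close>.
\<close>

lemma matroid_loop:
  assumes mat: "matroid N \<I>"
  shows "\<exists>t. framework_loop I (run (matroid_swap I \<I> T) ()) = Some t \<and>
    (result t \<in> \<I> \<and> (\<forall>X\<in>\<I>. f X \<le> 4 * f (result t))) \<and>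
    ((\<forall>Y\<subseteq>N. f_time I Y \<le> u) \<and> (\<forall>Y\<subseteq>N. U_time I Y \<le> u) \<and> (\<forall>Y\<subseteq>N. T Y \<le> u) \<longrightarrow>
       cost t \<le> loop_cost (card N) (card N * (3 * u + 2 * (card N + 1) + card N * (u + (card N + 1)))) u)"
proof -
  define st where "st = (\<lambda>j s. result (matroid_step I \<I> T j s))"
  let ?rn = "run (matroid_swap I \<I> T) ()"
  let ?sets = "\<lambda>(S, R, v :: 'a \<Rightarrow> real). (S, R)"
  let ?inv = "\<lambda>(S, R :: 'a set, v :: 'a \<Rightarrow> real). S \<in> \<I>"
  have sub: "X \<subseteq> N" if "X \<in> \<I>" for X using mat that by (auto simp: matroid_def)
  have down: "Y \<in> \<I>" if "X \<in> \<I>" "Y \<subseteq> X" for X Y using mat that by (auto simp: matroid_def)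
  have aug: "\<exists>e\<in>Y - X. insert e X \<in> \<I>" if "X \<in> \<I>" "Y \<in> \<I>" "card X < card Y" for X Y
    using mat that by (auto simp: matroid_def)
  have empty: "{} \<in> \<I>" using mat by (auto simp: matroid_def)
  define circ where "circ j S = result (find_circuit I \<I> T (insert j S))" for j S
  have circ: "circuit \<I> (circ j S)" "circ j S \<subseteq> insert j S"
      "\<And>i. i \<in> circ j S \<Longrightarrow> insert j S - {i} \<in> \<I>"
    if S: "S \<in> \<I>" and dep: "insert j S \<notin> \<I>" and j: "j \<in> N" for j S
  proof -
    show "circuit \<I> (circ j S)" "circ j S \<subseteq> insert j S"
      using find_circuit_iff[OF mat S dep set_arrange, of "circ j S" T] by (auto simp: circ_def)
    have "finite (insert j S)" using finite_sub[OF sub[OF S]] by simp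
    then show "insert j S - {i} \<in> \<I>" if "i \<in> circ j S" for i
      using that set_arrange unfolding circ_def find_circuit_def query_indep_def
      by (auto simp: result_map_timed)
  qed
  let ?vmin = "\<lambda>j S v. Min (v ` (circ j S - {j}))"
  let ?out = "\<lambda>j S v. pick I {i \<in> circ j S - {j}. v i = ?vmin j S v}"
  have step: "st j (S, R, v) =
     (let w = f_oracle I (insert j (S \<union> R)) - f_oracle I (S \<union> R) in
      if insert j S \<in> \<I> then (insert j S, R, v(j := w))
      else if circ j S - {j} = {} then (S, R, v)
      else if ?vmin j S v < w
        then (insert j (S - {?out j S v}), insert (?out j S v) R, v(j := ?vmin j S v + w))
      else (S, R, v))" for j S R v
    by (simp add: st_def matroid_step_def query_indep_def circ_def Let_def)
  have run: "result (?rn xs) = ?sets (fold st xs ({}, {}, \<lambda>_. 0))" for xs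
    by (simp add: matroid_swap_def result_fold_timed st_def split: prod.splits)
  have out: "?out j S v \<in> S" "?out j S v \<noteq> j" "?out j S v \<in> circ j S" "v (?out j S v) = ?vmin j S v"
      "insert j (S - {?out j S v}) \<in> \<I>" "\<forall>i\<in>circ j S - {j}. ?vmin j S v \<le> v i"
    if S: "S \<in> \<I>" and dep: "insert j S \<notin> \<I>" and j: "j \<in> N" and ne: "circ j S - {j} \<noteq> {}"
    for j S and v :: "'a \<Rightarrow> real"
  proof -
    note c = circ[OF S dep j]
    have fin: "finite (circ j S)" using c(2) finite_sub[OF sub[OF S]] finite_subset by blast
    have "?vmin j S v \<in> v ` (circ j S - {j})" using fin ne by (intro Min_in) auto
    then have "{i \<in> circ j S - {j}. v i = ?vmin j S v} \<noteq> {}" by auto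
    then have o: "?out j S v \<in> {i \<in> circ j S - {j}. v i = ?vmin j S v}"
      using fin by (intro pick_in) auto
    then show "?out j S v \<in> S" "?out j S v \<noteq> j" "?out j S v \<in> circ j S" "v (?out j S v) = ?vmin j S v"
      using c(2) by auto
    have "insert j S - {?out j S v} \<in> \<I>" using c(3) o by blast
    moreover have "insert j S - {?out j S v} = insert j (S - {?out j S v})" using o by auto
    ultimately show "insert j (S - {?out j S v}) \<in> \<I>" by simp
    show "\<forall>i\<in>circ j S - {j}. ?vmin j S v \<le> v i"
      using fin by (intro ballI Min_le) auto
  qed
  interpret sieve N r \<phi> I st "({}, {}, \<lambda>_. 0)" ?inv ?sets ?rn
  proof
    show "result (?rn xs) = ?sets (fold st xs ({}, {}, \<lambda>_. 0))" for xs by (rule run)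
    show "?inv ({}, {}, \<lambda>_. 0)" using empty by simp
    fix s j
    assume inv: "?inv s" and j: "j \<in> N" "j \<notin> fst (?sets s) \<union> snd (?sets s)"
    obtain S R v where s: "s = (S, R, v)" by (cases s) auto
    have S: "S \<in> \<I>" using inv s by simp
    show "?inv (st j s) \<and> (st j s = s \<or>
        fst (?sets (st j s)) \<union> snd (?sets (st j s)) = insert j (fst (?sets s) \<union> snd (?sets s)))"
    proof (cases "insert j S \<in> \<I>")
      case True
      then show ?thesis by (simp add: s step Let_def)
    next
      case dep: False
      show ?thesis
      proof (cases "circ j S - {j} = {}")
        case True
        then show ?thesis using S dep by (simp add: s step Let_def)
      next
        case False
        note o = out[of _ _ v, OF S dep j(1) False]
        have "insert j (S - {?out j S v}) \<union> insert (?out j S v) R = insert j (S \<union> R)"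
          using o(1) by auto
        then show ?thesis using S dep False o(5) by (simp add: s step Let_def)
      qed
    qed
  qed simp
  let ?c1 = "3 * u + 2 * (card N + 1) + card N * (u + (card N + 1))"
  let ?c = "card N * ?c1"
  have run_cost: "cost (?rn xs) \<le> ?c"
    if u: "\<forall>Y\<subseteq>N. f_time I Y \<le> u" "\<forall>Y\<subseteq>N. T Y \<le> u" and xs: "distinct xs" "set xs \<subseteq> N" for xs
  proof -
    have "cost (fold_timed (matroid_step I \<I> T) xs ({}, {}, \<lambda>_. 0)) \<le> ?c"
    proof (rule cost_fold_products_le[OF xs, where P = "\<lambda>(S, R, v). S \<in> \<I> \<and> R \<subseteq> N"])
      fix j and s :: "'a set \<times> 'a set \<times> ('a \<Rightarrow> real)"
      assume jN: "j \<in> N" and inv: "case s of (S, R, v) \<Rightarrow> S \<in> \<I> \<and> R \<subseteq> N"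
      obtain S R v where s: "s = (S, R, v)" by (cases s) auto
      have S: "S \<in> \<I>" and R: "R \<subseteq> N" using inv s by auto
      have SN: "S \<subseteq> N" using sub[OF S] .
      have inv': "case st j s of (S, R, v) \<Rightarrow> S \<in> \<I> \<and> R \<subseteq> N"
      proof (cases "insert j S \<in> \<I> \<or> circ j S - {j} = {}")
        case True
        then show ?thesis using S R by (auto simp: s step Let_def)
      next
        case False
        then have "circ j S - {j} \<noteq> {}" and dep: "insert j S \<notin> \<I>" by auto
        note o = out[of _ _ v, OF S dep jN this(1)]
        then have "?out j S v \<in> N" using SN by auto
        then show ?thesis using S R False o(5) by (simp add: s step Let_def)
      qed
      have fin: "finite (insert j S)" using SN jN finite_sub by simp
      have circ_cost: "cost (find_circuit I \<I> T (insert j S)) \<le> card N * (u + (card N + 1))"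
      proof -
        have "(\<Sum>i\<leftarrow>arrange I (insert j S). T (insert j S - {i}) + (card N + 1))
            \<le> length (arrange I (insert j S)) * (u + (card N + 1))"
        proof (rule sum_list_le_length)
          fix i
          have "insert j S - {i} \<subseteq> N" using SN jN by auto
          then show "T (insert j S - {i}) + (card N + 1) \<le> u + (card N + 1)" using u(2) by simp
        qed
        also have "\<dots> \<le> card N * (u + (card N + 1))"
          using length_arrange[OF fin] card_mono[OF finite_N, of "insert j S"] SN jN
          by (intro mult_le_mono1) simp
        finally show ?thesis by (simp add: find_circuit_def query_indep_def cost_map_timed)
      qed
      have "f_time I (S \<union> R) \<le> u" "f_time I (insert j (S \<union> R)) \<le> u" "T (insert j S) \<le> u"
        using u SN R jN by simp_all
      then have "cost (matroid_step I \<I> T j s) \<le> ?c1"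
        unfolding s matroid_step_def using circ_cost by (auto simp: query_indep_def Let_def)
      then show "(case result (matroid_step I \<I> T j s) of (S, R, v) \<Rightarrow> S \<in> \<I> \<and> R \<subseteq> N) \<and>
          cost (matroid_step I \<I> T j s) \<le> ?c1" using inv' by (simp add: st_def)
    qed (simp add: empty)
    then show ?thesis by (simp add: matroid_swap_def split: prod.splits)
  qed
  obtain t \<pi> where t: "framework_loop I ?rn = Some t" and \<pi>: "complete_pass \<pi>"
    and res: "result t = fst (?sets (state_after \<pi>))"
    and cst: "(\<forall>xs. distinct xs \<and> set xs \<subseteq> N \<longrightarrow> cost (?rn xs) \<le> ?c) \<and> (\<forall>Y\<subseteq>N. U_time I Y \<le> u) \<longrightarrow>
       cost t \<le> loop_cost (card N) ?c u"
    using framework_loop_complete_pass[of ?c u] by blast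
  have dist: "distinct \<pi>" "set \<pi> \<subseteq> N" using \<pi> by (auto simp: complete_pass_def)
  define level where "level S v \<theta> = {i \<in> S. \<theta> \<le> v i}" for S :: "'a set" and v :: "'a \<Rightarrow> real" and \<theta>
  define P where "P p = (\<lambda>(S, R, v). S \<in> \<I> \<and> S \<union> R \<subseteq> set p \<and>
     (\<forall>i\<in>S. 0 \<le> v i \<and> v i \<le> 2 * gain \<pi> i) \<and> sum v S = sum (gain \<pi>) (S \<union> R) \<and>
     (\<forall>e\<in>set p - (S \<union> R). \<forall>\<theta>. {e} \<in> \<I> \<longrightarrow> \<theta> \<le> gain \<pi> e \<longrightarrow> insert e (level S v \<theta>) \<notin> \<I>))" for p
  have inv: "P p (state_after p)" if "\<exists>q. \<pi> = p @ q" for p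
    using \<pi> that
  proof (induction rule: prefix_induct)
    case Nil
    then show ?case using empty by (simp add: P_def)
  next
    case (snoc p j q)
    obtain S R v where s: "state_after p = (S, R, v)" by (cases "state_after p") auto
    have IH: "P p (S, R, v)" using snoc(4) s by simp
    have S: "S \<in> \<I>" and SR: "S \<union> R \<subseteq> set p" and v: "\<And>i. i \<in> S \<Longrightarrow> 0 \<le> v i \<and> v i \<le> 2 * gain \<pi> i"
      and sum_v: "sum v S = sum (gain \<pi>) (S \<union> R)"
      and span: "\<And>e \<theta>. e \<in> set p \<Longrightarrow> e \<notin> S \<union> R \<Longrightarrow> {e} \<in> \<I> \<Longrightarrow> \<theta> \<le> gain \<pi> e \<Longrightarrow>
        insert e (level S v \<theta>) \<notin> \<I>"
      using IH by (auto simp: P_def)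
    have jN: "j \<in> N" and jp: "j \<notin> set p" and pN: "set p \<subseteq> N" using snoc(2,3) by auto
    have j: "j \<notin> S" "j \<notin> R" "j \<notin> S \<union> R" using SR jp by auto
    have SRN: "S \<union> R \<subseteq> N" "insert j (S \<union> R) \<subseteq> N" using SR pN jN by auto
    have finSR: "finite (S \<union> R)" "finite S" using finite_sub SRN by auto
    have g: "gain \<pi> j = f (insert j (S \<union> R)) - f (S \<union> R)"
      using gain_split[of p j q] dist(1) snoc(1) by (simp add: kept_def s)
    have g0: "0 \<le> gain \<pi> j" unfolding g using f_mono[OF _ SRN(2), of "S \<union> R"] by auto
    have new: "state_after (p @ [j]) =
       (if insert j S \<in> \<I> then (insert j S, R, v(j := gain \<pi> j))
        else if circ j S - {j} = {} then (S, R, v)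
        else if ?vmin j S v < gain \<pi> j
          then (insert j (S - {?out j S v}), insert (?out j S v) R, v(j := ?vmin j S v + gain \<pi> j))
        else (S, R, v))"
      using f_oracle_eq[OF SRN(1)] f_oracle_eq[OF SRN(2)] by (simp add: s step Let_def g)
    show ?case
    proof (cases "insert j S \<in> \<I>")
      case True
      let ?v = "v(j := gain \<pi> j)"
      have "sum ?v (insert j S) = gain \<pi> j + sum v S"
        using finSR(2) j(1) by (simp add: sum.insert) (rule sum.cong, auto)
      moreover have "sum (gain \<pi>) (insert j S \<union> R) = gain \<pi> j + sum (gain \<pi>) (S \<union> R)"
        using finSR j by simp
      moreover have "insert e (level (insert j S) ?v \<theta>) \<notin> \<I>"
        if "e \<in> set (p @ [j]) - (insert j S \<union> R)" "{e} \<in> \<I>" "\<theta> \<le> gain \<pi> e" for e \<theta>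
      proof
        assume "insert e (level (insert j S) ?v \<theta>) \<in> \<I>"
        moreover have "insert e (level S v \<theta>) \<subseteq> insert e (level (insert j S) ?v \<theta>)"
          using j(1) by (auto simp: level_def)
        ultimately have "insert e (level S v \<theta>) \<in> \<I>" by (rule down)
        then show False using span[of e \<theta>] that by auto
      qed
      ultimately show ?thesis
        using True SR v g0 sum_v j unfolding new P_def by auto
    next
      case dep: False
      note c = circ[OF S dep jN]
      have c_dep: "circ j S \<notin> \<I>" using c(1) by (simp add: circuit_def)
      show ?thesis
      proof (cases "circ j S - {j} = {}")
        case True
        then have "circ j S \<subseteq> {j}" by auto
        \<comment> \<open>A loop of the matroid: the invariant makes no claim about it, and no independent set contains it.\<close>
        then have "{j} \<notin> \<I>" using c_dep down by blast
        moreover have "state_after (p @ [j]) = (S, R, v)" using new dep True by simp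
        ultimately show ?thesis using IH by (auto simp: P_def)
      next
        case False
        define i where "i = ?out j S v"
        define m where "m = ?vmin j S v"
        note o = out[of _ _ v, OF S dep jN False, folded i_def m_def]
        have cov: "circ j S \<subseteq> insert j (level S v \<theta>)" if "\<theta> \<le> m" for \<theta>
          using o(6) c(2) that by (force simp: level_def)
        then have dep_level: "insert j (level S v \<theta>) \<notin> \<I>" if "\<theta> \<le> m" for \<theta>
          using that c_dep down by blast
        show ?thesis
        proof (cases "m < gain \<pi> j")
          case F: False
          then have "state_after (p @ [j]) = (S, R, v)" using new dep False by (simp add: m_def)
          moreover have "insert j (level S v \<theta>) \<notin> \<I>" if "\<theta> \<le> gain \<pi> j" for \<theta>
            using dep_level that F by simp
          ultimately show ?thesis using IH by (auto simp: P_def)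
        next
          case True
          let ?v = "v(j := m + gain \<pi> j)" and ?S = "insert j (S - {i})" and ?R = "insert i R"
          have st': "state_after (p @ [j]) = (?S, ?R, ?v)"
            using new dep False True by (simp add: m_def i_def)
          have m0: "0 \<le> m" using v[OF o(1)] o(4) by simp
          have un: "?S \<union> ?R = insert j (S \<union> R)" using o(1) by auto
          have "sum ?v ?S = (m + gain \<pi> j) + sum v (S - {i})"
            using finSR(2) j(1) by (simp add: sum.insert) (rule sum.cong, auto)
          also have "sum v (S - {i}) = sum v S - m" using finSR(2) o(1,4) by (simp add: sum_diff1)
          finally have "sum ?v ?S = sum (gain \<pi>) (?S \<union> ?R)"
            unfolding un using finSR(1) j(3) sum_v by simp
          moreover have "insert e (level ?S ?v \<theta>) \<notin> \<I>"
            if e: "e \<in> set (p @ [j]) - (?S \<union> ?R)" "{e} \<in> \<I>" "\<theta> \<le> gain \<pi> e" for e \<theta>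
          proof
            assume ind: "insert e (level ?S ?v \<theta>) \<in> \<I>"
            have e': "e \<in> set p" "e \<notin> S \<union> R" "e \<noteq> j" using e(1) unfolding un by auto
            have sp: "insert e (level S v \<theta>) \<notin> \<I>" using span[OF e'(1,2) e(2,3)] .
            show False
            proof (cases "\<theta> \<le> m")
              case False
              \<comment> \<open>The displaced product lies below the level \<open>\<theta>\<close>, so the level set can only grow.\<close>
              then have "insert e (level S v \<theta>) \<subseteq> insert e (level ?S ?v \<theta>)"
                using o(4) j(1) by (auto simp: level_def)
              then show False using ind down sp by blast
            next
              case le: True
              \<comment> \<open>The whole circuit lies above the level, and \<open>j\<close> replaces \<open>i\<close> in the level set. If the new level set
                did not span \<open>e\<close>, augmenting the old one would contradict that it spans both \<open>e\<close> and \<open>j\<close>.\<close>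
              have lv: "level ?S ?v \<theta> = insert j (level S v \<theta> - {i})"
                using le g0 j(1) o(2) by (auto simp: level_def)
              have fl: "finite (level S v \<theta>)" using finSR(2) by (simp add: level_def)
              have il: "i \<in> level S v \<theta>" using o(1,4) le by (simp add: level_def)
              have jl: "j \<notin> level S v \<theta>" "e \<notin> level S v \<theta>" using j(1) e'(2) by (auto simp: level_def)
              have "card (insert j (level S v \<theta> - {i})) = card (level S v \<theta>)"
                using fl il jl(1) card_Suc_Diff1[OF fl il] by simp
              then have "card (level S v \<theta>) < card (insert e (level ?S ?v \<theta>))"
                unfolding lv using fl jl(2) e'(3) by simp
              moreover have "level S v \<theta> \<in> \<I>" using S by (rule down) (auto simp: level_def)
              ultimately obtain x where "x \<in> insert e (level ?S ?v \<theta>) - level S v \<theta>"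
                "insert x (level S v \<theta>) \<in> \<I>" using aug ind by blast
              then show False using sp dep_level[OF le] unfolding lv by auto
            qed
          qed
          moreover have "\<forall>k\<in>?S. 0 \<le> ?v k \<and> ?v k \<le> 2 * gain \<pi> k"
            using v m0 g0 True j(1) by auto
          moreover have "?S \<union> ?R \<subseteq> set (p @ [j])" unfolding un using SR by auto
          ultimately show ?thesis using o(5) unfolding st' P_def by blast
        qed
      qed
    qed
  qed
  obtain S R v where s: "state_after \<pi> = (S, R, v)" by (cases "state_after \<pi>") auto
  have kept: "kept \<pi> = S \<union> R" by (simp add: kept_def s)
  have P: "P \<pi> (S, R, v)" using inv[of \<pi>] s by simp
  have S: "S \<in> \<I>" and v: "\<And>i. i \<in> S \<Longrightarrow> 0 \<le> v i \<and> v i \<le> 2 * gain \<pi> i"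
    and sum_v: "sum v S = sum (gain \<pi>) (S \<union> R)"
    and span: "\<And>e \<theta>. e \<in> set \<pi> \<Longrightarrow> e \<notin> S \<union> R \<Longrightarrow> {e} \<in> \<I> \<Longrightarrow> \<theta> \<le> gain \<pi> e \<Longrightarrow>
        insert e (level S v \<theta>) \<notin> \<I>"
    using P by (auto simp: P_def)
  have fin: "finite S" using finite_sub[OF sub[OF S]] .
  have kept_value: "f (kept \<pi>) = sum v S" using sum_gain_kept[OF \<pi>] sum_v kept by simp
  have "sum v S \<le> (\<Sum>i\<in>S. 2 * gain \<pi> i)" by (rule sum_mono) (use v in auto)
  also have "\<dots> = 2 * sum (gain \<pi>) S" by (rule sum_distrib_left[symmetric])
  also have "\<dots> \<le> 2 * f S" using sum_gain_le[OF \<pi>, of S] kept by simp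
  finally have half: "sum v S \<le> 2 * f S" .
  have "f X \<le> 4 * f S" if X: "X \<in> \<I>" for X
  proof -
    let ?D = "X \<inter> set \<pi> - kept \<pi>"
    have finD: "finite ?D" using finite_sub[OF sub[OF X]] by auto
    have "sum (gain \<pi>) ?D \<le> sum v S"
    proof (rule sum_le_of_level_counts[OF finD fin])
      show "0 \<le> v i" if "i \<in> S" for i using v[OF that] by simp
      fix \<theta>
      show "card {a \<in> ?D. \<theta> \<le> gain \<pi> a} \<le> card {i \<in> S. \<theta> \<le> v i}"
      proof (rule ccontr)
        assume "\<not> ?thesis"
        then have "card (level S v \<theta>) < card {a \<in> ?D. \<theta> \<le> gain \<pi> a}" by (simp add: level_def)
        moreover have "level S v \<theta> \<in> \<I>" using S by (rule down) (auto simp: level_def)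
        moreover have "{a \<in> ?D. \<theta> \<le> gain \<pi> a} \<in> \<I>" using X by (rule down) auto
        ultimately obtain e where e: "e \<in> {a \<in> ?D. \<theta> \<le> gain \<pi> a}" "insert e (level S v \<theta>) \<in> \<I>"
          using aug by blast
        moreover have "{e} \<in> \<I>" using X by (rule down) (use e in auto)
        ultimately show False using span[of e \<theta>] kept by auto
      qed
    qed
    then show ?thesis
      using f_le_kept_plus_gain[OF \<pi> sub[OF X]] kept_value half by linarith
  qed
  then show ?thesis
    using t res S cst run_cost s by (intro exI[of _ t]) auto
qed

lemma matroid_guarantee:
  assumes mat: "matroid N \<I>"
    and cheap: "cheap \<Longrightarrow> (\<forall>Y\<subseteq>N. f_time I Y \<le> u) \<and> (\<forall>Y\<subseteq>N. U_time I Y \<le> u) \<and> (\<forall>Y\<subseteq>N. T Y \<le> u)"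
  shows "\<exists>out. framework (matroid_swap I \<I> T) I = Some out \<and>
     approximate_solution 0.25 \<I> f (result out) \<and>
     (cheap \<longrightarrow> cost out \<le> 0
       + 1 * loop_cost (card N) (card N * (3 * u + 2 * (card N + 1) + card N * (u + (card N + 1)))) u
       + 0 + 1 * (u + 1))"
proof (rule framework_guarantee[where good = "\<lambda>_ S. S \<in> \<I> \<and> (\<forall>X\<in>\<I>. f X \<le> 4 * f S)"])
  let ?A = "matroid_swap I \<I> T"
  have settings: "settings ?A = ret [()]" and cand: "candidates ?A = ret"
    by (simp_all add: matroid_swap_def)
  show "\<exists>t. framework_loop I (run ?A \<gamma>) = Some t \<and> (result t \<in> \<I> \<and> (\<forall>X\<in>\<I>. f X \<le> 4 * f (result t))) \<and>
     (cheap \<longrightarrow> cost t \<le>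
       loop_cost (card N) (card N * (3 * u + 2 * (card N + 1) + card N * (u + (card N + 1)))) u)" for \<gamma>
    using matroid_loop[OF mat, of T u] cheap by (cases \<gamma>) blast
  show "cheap \<Longrightarrow> cost (settings ?A) \<le> 0 \<and> length (result (settings ?A)) \<le> 1"
    by (simp add: settings)
  show "cheap \<Longrightarrow> Y \<subseteq> N \<Longrightarrow> f_time I Y \<le> u" for Y using cheap by auto
  show "\<I> \<subseteq> Pow N" using mat by (simp add: matroid_def)
  fix Ss assume ex: "\<forall>\<gamma>\<in>set (result (settings ?A)). \<exists>S\<in>set Ss. S \<in> \<I> \<and> (\<forall>X\<in>\<I>. f X \<le> 4 * f S)"
    and all: "\<forall>S\<in>set Ss. \<exists>\<gamma>\<in>set (result (settings ?A)). S \<in> \<I> \<and> (\<forall>X\<in>\<I>. f X \<le> 4 * f S)"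
    and len: "length Ss = length (result (settings ?A))"
  from ex obtain S where S: "S \<in> set Ss" "\<forall>X\<in>\<I>. f X \<le> 4 * f S" by (auto simp: settings)
  have "0.25 * f X \<le> f S" if "X \<in> \<I>" for X using S(2) that by auto
  then show "set (result (candidates ?A Ss)) \<subseteq> \<I> \<and> result (candidates ?A Ss) \<noteq> [] \<and>
      (\<forall>X\<in>\<I>. 0 < f X \<longrightarrow> (\<exists>C\<in>set (result (candidates ?A Ss)). 0.25 * f X \<le> f C)) \<and>
      (cheap \<longrightarrow> cost (candidates ?A Ss) \<le> 0 \<and> length (result (candidates ?A Ss)) \<le> 1)"
    using S(1) all len by (auto simp: cand settings)
qed

end

section \<open>Polynomial running time\<close>

lemma oracle_time_le_mono:
  assumes "assortment_input N r \<phi> I" "oracle_time_le I q" "card N \<le> m"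
  shows "(\<forall>Y\<subseteq>N. f_time I Y \<le> poly q m) \<and> (\<forall>Y\<subseteq>N. U_time I Y \<le> poly q m)"
  using assms poly_mono_nat[OF assms(3), of q]
  unfolding oracle_time_le_def assortment_input_def by (metis order_trans)

lemma cardinality_polynomial:
  assumes \<epsilon>: "0 < \<epsilon> \<and> \<epsilon> < 1"
  shows "\<exists>p :: nat poly. \<forall>(N :: 'a set) r \<phi> I k.
        compatible N r \<phi> \<and> assortment_input N r \<phi> I \<and> 1 \<le> k \<longrightarrow>
        (\<exists>out. framework (threshold_cardinality I \<epsilon> k) I = Some out
           \<and> approximate_solution ((1 - \<epsilon>) * 0.5) {S. S \<subseteq> N \<and> card S \<le> k}
               (best_revenue r \<phi>) (result out)
           \<and> (oracle_time_le I q \<longrightarrow> cost out \<le> poly p (card N + nat \<lceil>log 2 (real k)\<rceil>)))"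
    (is "\<exists>p. \<forall>N r \<phi> I k. ?hyp N r \<phi> I k \<longrightarrow> ?concl p N r \<phi> I k")
proof -
  let ?E = "\<lambda>n l u. (n * u + (n + 1) + l) + l * loop_cost n (n * (2 * (n + 1) + 2 * u)) u + 0 + l * (u + 1)"
  let ?c = "nat \<lceil>log (1 + \<epsilon>) 2\<rceil>"
  have "polynomial (\<lambda>m. ?E m (1 + ?c * m) (poly q m))"
    unfolding loop_cost_def by (rule polynomial_intros)+
  then obtain p where p: "\<And>m. poly p m = ?E m (1 + ?c * m) (poly q m)"
    unfolding polynomial_def by auto
  have mono: "?E n l u \<le> ?E n' l' u" if "n \<le> n'" "l \<le> l'" for n l n' l' u
    unfolding loop_cost_def using that by (intro add_mono mult_le_mono order_refl)
  show ?thesis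
  proof (intro exI[of _ p] allI impI)
    fix N :: "'a set" and r \<phi> I and k :: nat
    assume a: "?hyp N r \<phi> I k"
    then interpret assortment_problem N r \<phi> I by unfold_locales auto
    let ?m = "card N + nat \<lceil>log 2 (real k)\<rceil>"
    have L: "number_of_thresholds \<epsilon> k \<le> 1 + ?c * ?m"
      using number_of_thresholds_log[of \<epsilon> k] \<epsilon> a by (simp add: add_mult_distrib2)
    have "\<exists>out. framework (threshold_cardinality I \<epsilon> k) I = Some out \<and>
       approximate_solution ((1 - \<epsilon>) * 0.5) {S. S \<subseteq> N \<and> card S \<le> k} f (result out) \<and>
       (oracle_time_le I q \<longrightarrow> cost out \<le> ?E (card N) (number_of_thresholds \<epsilon> k) (poly q ?m))"
      by (rule cardinality_guarantee) (use \<epsilon> a oracle_time_le_mono[OF input, of q ?m] in auto)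
    moreover have "?E (card N) (number_of_thresholds \<epsilon> k) (poly q ?m) \<le> poly p ?m"
      unfolding p by (rule mono) (use L in auto)
    ultimately show "?concl p N r \<phi> I k"
      using order_trans by blast
  qed
qed

lemma budget_polynomial:
  assumes \<epsilon>: "0 < \<epsilon> \<and> \<epsilon> < 1"
  shows "\<exists>p :: nat poly. \<forall>(N :: 'a set) r \<phi> I b B.
        compatible N r \<phi> \<and> assortment_input N r \<phi> I \<and> 0 < B \<and> (\<forall>i\<in>N. 0 < b i) \<longrightarrow>
        (\<exists>out. framework (threshold_budget I \<epsilon> b B) I = Some out
           \<and> approximate_solution ((1 - \<epsilon>) / 3) {S. S \<subseteq> N \<and> sum b S \<le> B}
               (best_revenue r \<phi>) (result out)
           \<and> (oracle_time_le I q \<longrightarrow> cost out \<le> poly p (card N)))"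
    (is "\<exists>p. \<forall>N r \<phi> I b B. ?hyp N r \<phi> I b B \<longrightarrow> ?concl p N r \<phi> I b B")
proof -
  let ?E = "\<lambda>n l u. (n * u + (n + 1) + l) + l * loop_cost n (n * (2 * (n + 1) + 2 * u)) u
    + (n + 1) + (l + n) * (u + 1)"
  let ?c = "nat \<lceil>1 / ln (1 + \<epsilon>)\<rceil>"
  have "polynomial (\<lambda>m. ?E m (1 + ?c * m) (poly q m))"
    unfolding loop_cost_def by (rule polynomial_intros)+
  then obtain p where p: "\<And>m. poly p m = ?E m (1 + ?c * m) (poly q m)"
    unfolding polynomial_def by auto
  have mono: "?E n l u \<le> ?E n l' u" if "l \<le> l'" for n l l' u
    unfolding loop_cost_def using that by (intro add_mono mult_le_mono order_refl)
  show ?thesis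
  proof (intro exI[of _ p] allI impI)
    fix N :: "'a set" and r \<phi> I and b :: "'a \<Rightarrow> real" and B :: real
    assume a: "?hyp N r \<phi> I b B"
    then interpret assortment_problem N r \<phi> I by unfold_locales auto
    let ?m = "card N"
    have "\<exists>out. framework (threshold_budget I \<epsilon> b B) I = Some out \<and>
       approximate_solution ((1 - \<epsilon>) / 3) {S. S \<subseteq> N \<and> sum b S \<le> B} f (result out) \<and>
       (oracle_time_le I q \<longrightarrow> cost out \<le> ?E ?m (number_of_thresholds \<epsilon> ?m) (poly q ?m))"
      by (rule budget_guarantee) (use \<epsilon> a oracle_time_le_mono[OF input, of q ?m] in auto)
    moreover have "?E ?m (number_of_thresholds \<epsilon> ?m) (poly q ?m) \<le> poly p ?m"
      unfolding p by (rule mono, rule number_of_thresholds_linear) (use \<epsilon> in simp)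
    ultimately show "?concl p N r \<phi> I b B"
      using order_trans by blast
  qed
qed

lemma enumerate_polynomial:
  assumes \<epsilon>: "0 < \<epsilon> \<and> \<epsilon> < 0.5"
  shows "\<exists>p :: nat poly. \<forall>(N :: 'a set) r \<phi> I b B.
        compatible N r \<phi> \<and> assortment_input N r \<phi> I \<and> 0 < B \<and> (\<forall>i\<in>N. 0 < b i) \<longrightarrow>
        (\<exists>out. framework (enumerate_budget I \<epsilon> b B) I = Some out
           \<and> approximate_solution (0.5 - \<epsilon>) {S. S \<subseteq> N \<and> sum b S \<le> B}
               (best_revenue r \<phi>) (result out)
           \<and> (oracle_time_le I q \<longrightarrow> cost out \<le> poly p (card N)))"
    (is "\<exists>p. \<forall>N r \<phi> I b B. ?hyp N r \<phi> I b B \<longrightarrow> ?concl p N r \<phi> I b B")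
proof -
  let ?K = "\<lambda>n :: nat. (n + 1) ^ nat \<lfloor>1 / \<epsilon>\<rfloor>" and ?K' = "\<lambda>n :: nat. (n + 1) ^ (nat \<lfloor>1 / \<epsilon>\<rfloor> + 2)"
    and ?L = "\<lambda>n. 1 + nat \<lceil>1 / ln (1 + \<epsilon>)\<rceil> * n"
  let ?E = "\<lambda>n. (?K' n + ?K n * (n + 1) + ?K n * (2 * (n + 1) + n * poly q n + 2 * ?L n) + ?K n * ?L n)
       + ?K n * ?L n * loop_cost n (n * (2 * (n + 1) + 2 * poly q n + n * (n + 1))) (poly q n)
       + (?K n * ?L n * (n + 1) + (?K' n + ?K n * (n + 1))) + (?K n * ?L n + ?K n) * (poly q n + 1)"
  have "polynomial ?E"
    unfolding loop_cost_def by (rule polynomial_intros)+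
  then obtain p where p: "\<And>m. poly p m = ?E m"
    unfolding polynomial_def by auto
  show ?thesis
  proof (intro exI[of _ p] allI impI)
    fix N :: "'a set" and r \<phi> I and b :: "'a \<Rightarrow> real" and B :: real
    assume a: "?hyp N r \<phi> I b B"
    then interpret assortment_problem N r \<phi> I by unfold_locales auto
    show "?concl p N r \<phi> I b B"
      unfolding p
      by (rule enumerate_guarantee) (use \<epsilon> a oracle_time_le_mono[OF input, of q "card N"] in auto)
  qed
qed

lemma matroid_polynomial:
  "\<exists>p :: nat poly. \<forall>(N :: 'a set) r \<phi> I \<I> T.
        compatible N r \<phi> \<and> assortment_input N r \<phi> I \<and> matroid N \<I> \<longrightarrow>
        (\<exists>out. framework (matroid_swap I \<I> T) I = Some out
           \<and> approximate_solution 0.25 \<I> (best_revenue r \<phi>) (result out)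
           \<and> (oracle_time_le I q \<and> (\<forall>X\<subseteq>N. T X \<le> poly q (card N)) \<longrightarrow>
              cost out \<le> poly p (card N)))"
    (is "\<exists>p. \<forall>N r \<phi> I \<I> T. ?hyp N r \<phi> I \<I> T \<longrightarrow> ?concl p N r \<phi> I \<I> T")
proof -
  let ?E = "\<lambda>n. 0 + 1 * loop_cost n (n * (3 * poly q n + 2 * (n + 1) + n * (poly q n + (n + 1)))) (poly q n)
       + 0 + 1 * (poly q n + 1)"
  have "polynomial ?E"
    unfolding loop_cost_def by (rule polynomial_intros)+
  then obtain p where p: "\<And>m. poly p m = ?E m"
    unfolding polynomial_def by auto
  show ?thesis
  proof (intro exI[of _ p] allI impI)
    fix N :: "'a set" and r \<phi> I \<I> and T :: "'a set \<Rightarrow> nat"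
    assume a: "?hyp N r \<phi> I \<I> T"
    then interpret assortment_problem N r \<phi> I by unfold_locales auto
    show "?concl p N r \<phi> I \<I> T"
      unfolding p
      by (rule matroid_guarantee) (use a oracle_time_le_mono[OF input, of q "card N"] in auto)
  qed
qed

theorem theorem7:
  shows
    "(\<forall>(N :: 'a set) r lam \<rho>.
        finite N \<and> markov_parameters N lam \<rho> \<longrightarrow> compatible N r (markov_choice lam \<rho>))
   \<and> (\<forall>\<epsilon> q. 0 < \<epsilon> \<and> \<epsilon> < 1 \<longrightarrow> (\<exists>p :: nat poly. \<forall>(N :: 'a set) r \<phi> I k.
        compatible N r \<phi> \<and> assortment_input N r \<phi> I \<and> 1 \<le> k \<longrightarrow>
        (\<exists>out. framework (threshold_cardinality I \<epsilon> k) I = Some out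
           \<and> approximate_solution ((1 - \<epsilon>) * 0.5) {S. S \<subseteq> N \<and> card S \<le> k}
               (best_revenue r \<phi>) (result out)
           \<and> (oracle_time_le I q \<longrightarrow> cost out \<le> poly p (card N + nat \<lceil>log 2 (real k)\<rceil>)))))
   \<and> (\<forall>\<epsilon> q. 0 < \<epsilon> \<and> \<epsilon> < 1 \<longrightarrow> (\<exists>p :: nat poly. \<forall>(N :: 'a set) r \<phi> I b B.
        compatible N r \<phi> \<and> assortment_input N r \<phi> I \<and> 0 < B \<and> (\<forall>i\<in>N. 0 < b i) \<longrightarrow>
        (\<exists>out. framework (threshold_budget I \<epsilon> b B) I = Some out
           \<and> approximate_solution ((1 - \<epsilon>) / 3) {S. S \<subseteq> N \<and> sum b S \<le> B}
               (best_revenue r \<phi>) (result out)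
           \<and> (oracle_time_le I q \<longrightarrow> cost out \<le> poly p (card N)))))
   \<and> (\<forall>\<epsilon> q. 0 < \<epsilon> \<and> \<epsilon> < 0.5 \<longrightarrow> (\<exists>p :: nat poly. \<forall>(N :: 'a set) r \<phi> I b B.
        compatible N r \<phi> \<and> assortment_input N r \<phi> I \<and> 0 < B \<and> (\<forall>i\<in>N. 0 < b i) \<longrightarrow>
        (\<exists>out. framework (enumerate_budget I \<epsilon> b B) I = Some out
           \<and> approximate_solution (0.5 - \<epsilon>) {S. S \<subseteq> N \<and> sum b S \<le> B}
               (best_revenue r \<phi>) (result out)
           \<and> (oracle_time_le I q \<longrightarrow> cost out \<le> poly p (card N)))))
   \<and> (\<forall>q. \<exists>p :: nat poly. \<forall>(N :: 'a set) r \<phi> I \<I> T.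
        compatible N r \<phi> \<and> assortment_input N r \<phi> I \<and> matroid N \<I> \<longrightarrow>
        (\<exists>out. framework (matroid_swap I \<I> T) I = Some out
           \<and> approximate_solution 0.25 \<I> (best_revenue r \<phi>) (result out)
           \<and> (oracle_time_le I q \<and> (\<forall>X\<subseteq>N. T X \<le> poly q (card N)) \<longrightarrow>
              cost out \<le> poly p (card N))))"
proof (intro conjI allI impI, goal_cases)
  case (1 N r lam \<rho>)
  then show ?case by (intro markov_compatible) auto
next
  case (2 \<epsilon> q)
  then show ?case by (rule cardinality_polynomial)
next
  case (3 \<epsilon> q)
  then show ?case by (rule budget_polynomial)
next
  case (4 \<epsilon> q)
  then show ?case by (rule enumerate_polynomial)
next
  case (5 q)
  show ?case by (rule matroid_polynomial)
qed

end
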